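(* Let $V$ be a finite-dimensional complex vector space with $\dim V\ge 6$. Then $S_{(5,5,5,5,3,1)}V\subset I_8(\sigma_2(Ch_3(V^* )))$; that is, the $GL(V)$-module $I_8(\sigma_2(Ch_3(V^* )))\subset S^8(S^3V)$ contains an irreducible submodule isomorphic to $S_{(5,5,5,5,3,1)}V$.
   Context: For a finite-dimensional complex vector space $U$, the Chow variety is $Ch_d(U)=\mathbb{P}\{z\in S^dU \mid z=w_1\cdots w_d \text{ for some } w_i\in U\}\subset \mathbb{P}S^dU$. For a projective variety $X\subset\mathbb{P}W^*$, the $r$-th secant variety $\sigma_r(X)\subset\mathbb{P}W^*$ is the Zariski closure of $\bigcup_{p_1,\dots,p_r\in X}\langle p_1,\dots,p_r\rangle$, where $\langle p_1,\dots,p_r\rangle$ is the projective linear span. $I_\delta(X)\subset S^\delta W$ denotes the space of homogeneous degree-$\delta$ polynomials on $W^*$ vanishing on $X$; with $W=S^dV$ and $X=\sigma_r(Ch_d(V^* ))$ it is a $GL(V)$-submodule of $S^\delta(S^dV)$. For a partition $\lambda$, $S_\lambda V$ is the irreducible polynomial $GL(V)$-module of highest weight $\lambda$ (so $S_{(d)}V=S^dV$, $S_{(1^d)}V=\Lambda^dV$). *)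

theory Defs
  imports Complex_Main "HOL-Library.Function_Algebras"
begin

text \<open>
  A complex vector space is given by a scalar multiplication \<open>s\<close> on a type together with a carrier
  \<open>W\<close> that is a linear subspace. Functions on a carrier are extended by 0 outside of it,
  so that they form a vector space under pointwise operations.
\<close>

definition fun_scale :: "(complex \<Rightarrow> 'b \<Rightarrow> 'b) \<Rightarrow> complex \<Rightarrow> ('a \<Rightarrow> 'b) \<Rightarrow> 'a \<Rightarrow> 'b" where
  "fun_scale s c f = (\<lambda>x. s c (f x))"

lemma vector_space_fun_scale:
  fixes s :: "complex \<Rightarrow> 'b::ab_group_add \<Rightarrow> 'b"
  assumes "vector_space s"
  shows "vector_space (fun_scale s :: complex \<Rightarrow> ('a \<Rightarrow> 'b) \<Rightarrow> 'a \<Rightarrow> 'b)"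
proof -
  interpret vector_space s by fact
  show ?thesis
    by unfold_locales
      (auto simp: fun_scale_def fun_eq_iff scale_right_distrib scale_left_distrib)
qed

definition dual_space :: "(complex \<Rightarrow> 'w::ab_group_add \<Rightarrow> 'w) \<Rightarrow> 'w set \<Rightarrow> ('w \<Rightarrow> complex) set" where
  "dual_space s W = {f. (\<forall>x\<in>W. \<forall>y\<in>W. f (x + y) = f x + f y) \<and>
                        (\<forall>c. \<forall>x\<in>W. f (s c x) = c * f x) \<and>
                        (\<forall>x. x \<notin> W \<longrightarrow> f x = 0)}"

definition form_prod :: "'w set \<Rightarrow> nat \<Rightarrow> (nat \<Rightarrow> 'w \<Rightarrow> complex) \<Rightarrow> 'w \<Rightarrow> complex" where
  "form_prod W d w = (\<lambda>x. if x \<in> W then \<Prod>i<d. w i x else 0)"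

text \<open>
  The symmetric power \<open>S\<^sup>d(W\<^sup>*)\<close>, realised as the space of homogeneous polynomial functions of
  degree \<open>d\<close> on \<open>W\<close>.
\<close>

definition hom_poly :: "(complex \<Rightarrow> 'w::ab_group_add \<Rightarrow> 'w) \<Rightarrow> 'w set \<Rightarrow> nat \<Rightarrow> ('w \<Rightarrow> complex) set" where
  "hom_poly s W d = module.span (fun_scale (*))
     {form_prod W d w | w. \<forall>i<d. w i \<in> dual_space s W}"

definition poly_fun :: "(complex \<Rightarrow> 'w::ab_group_add \<Rightarrow> 'w) \<Rightarrow> 'w set \<Rightarrow> ('w \<Rightarrow> complex) set" where
  "poly_fun s W = module.span (fun_scale (*)) (\<Union>d. hom_poly s W d)"


section \<open>Projective geometry\<close>

text \<open>Points of a projective space are the one-dimensional linear subspaces.\<close>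

definition proj :: "(complex \<Rightarrow> 'w::ab_group_add \<Rightarrow> 'w) \<Rightarrow> 'w set \<Rightarrow> 'w set set" where
  "proj s Z = {module.span s {z} | z. z \<in> Z \<and> z \<noteq> 0}"

definition vanishes_on :: "('w \<Rightarrow> complex) \<Rightarrow> 'w set set \<Rightarrow> bool" where
  "vanishes_on F X \<longleftrightarrow> (\<forall>p\<in>X. \<forall>z\<in>p. F z = 0)"

definition zariski_closure ::
  "(complex \<Rightarrow> 'w::ab_group_add \<Rightarrow> 'w) \<Rightarrow> 'w set \<Rightarrow> 'w set set \<Rightarrow> 'w set set" where
  "zariski_closure s W X =
     {p \<in> proj s W. \<forall>d. \<forall>F\<in>hom_poly s W d. vanishes_on F X \<longrightarrow> vanishes_on F {p}}"

definition proj_span :: "(complex \<Rightarrow> 'w::ab_group_add \<Rightarrow> 'w) \<Rightarrow> 'w set set \<Rightarrow> 'w set set" where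
  "proj_span s P = proj s (module.span s (\<Union>P))"

definition secant_variety ::
  "(complex \<Rightarrow> 'w::ab_group_add \<Rightarrow> 'w) \<Rightarrow> 'w set \<Rightarrow> nat \<Rightarrow> 'w set set \<Rightarrow> 'w set set" where
  "secant_variety s W r X =
     zariski_closure s W (\<Union>ps\<in>{ps. length ps = r \<and> set ps \<subseteq> X}. proj_span s (set ps))"

definition ideal_part ::
  "(complex \<Rightarrow> 'w::ab_group_add \<Rightarrow> 'w) \<Rightarrow> 'w set \<Rightarrow> nat \<Rightarrow> 'w set set \<Rightarrow> ('w \<Rightarrow> complex) set" where
  "ideal_part s W \<delta> X = {F \<in> hom_poly s W \<delta>. vanishes_on F X}"

text \<open>The Chow variety \<open>Ch\<^sub>d(V\<^sup>*)\<close>, where \<open>V\<close> is the whole type; it lies in \<open>P S\<^sup>d(V\<^sup>*)\<close>.\<close>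

definition chow_dual :: "(complex \<Rightarrow> 'v::ab_group_add \<Rightarrow> 'v) \<Rightarrow> nat \<Rightarrow> ('v \<Rightarrow> complex) set set" where
  "chow_dual s d = proj (fun_scale (*))
     {z \<in> hom_poly s UNIV d. \<exists>w. (\<forall>i<d. w i \<in> dual_space s UNIV) \<and> z = form_prod UNIV d w}"


section \<open>Modules over the general linear group\<close>

definition End :: "(complex \<Rightarrow> 'v::ab_group_add \<Rightarrow> 'v) \<Rightarrow> ('v \<Rightarrow> 'v) set" where
  "End s = {g. Vector_Spaces.linear s s g}"

definition GL :: "(complex \<Rightarrow> 'v::ab_group_add \<Rightarrow> 'v) \<Rightarrow> ('v \<Rightarrow> 'v) set" where
  "GL s = {g \<in> End s. bij g}"

text \<open>Below, \<open>M\<close> is a subspace for the scalar multiplication \<open>t\<close>, and \<open>act\<close> is the action on \<open>M\<close>.\<close>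

definition GL_module ::
  "(complex \<Rightarrow> 'v::ab_group_add \<Rightarrow> 'v) \<Rightarrow> (complex \<Rightarrow> 'm::ab_group_add \<Rightarrow> 'm) \<Rightarrow>
   (('v \<Rightarrow> 'v) \<Rightarrow> 'm \<Rightarrow> 'm) \<Rightarrow> 'm set \<Rightarrow> bool" where
  "GL_module s t act M \<longleftrightarrow>
     vector_space t \<and> module.subspace t M \<and>
     (\<forall>g\<in>GL s. \<forall>m\<in>M. act g m \<in> M) \<and>
     (\<forall>g\<in>GL s. \<forall>m\<in>M. \<forall>m'\<in>M. act g (m + m') = act g m + act g m') \<and>
     (\<forall>g\<in>GL s. \<forall>c. \<forall>m\<in>M. act g (t c m) = t c (act g m)) \<and>
     (\<forall>m\<in>M. act id m = m) \<and>
     (\<forall>g\<in>GL s. \<forall>h\<in>GL s. \<forall>m\<in>M. act (g \<circ> h) m = act g (act h m))"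

definition irreducible_GL_module ::
  "(complex \<Rightarrow> 'v::ab_group_add \<Rightarrow> 'v) \<Rightarrow> (complex \<Rightarrow> 'm::ab_group_add \<Rightarrow> 'm) \<Rightarrow>
   (('v \<Rightarrow> 'v) \<Rightarrow> 'm \<Rightarrow> 'm) \<Rightarrow> 'm set \<Rightarrow> bool" where
  "irreducible_GL_module s t act M \<longleftrightarrow>
     GL_module s t act M \<and> M \<noteq> {0} \<and>
     (\<forall>N. N \<subseteq> M \<and> GL_module s t act N \<longrightarrow> N = {0} \<or> N = M)"

text \<open>
  Polynomial means finite-dimensional with all matrix coefficients being restrictions of polynomial
  functions on the vector space of endomorphisms.
\<close>

definition polynomial_GL_module ::
  "(complex \<Rightarrow> 'v::ab_group_add \<Rightarrow> 'v) \<Rightarrow> (complex \<Rightarrow> 'm::ab_group_add \<Rightarrow> 'm) \<Rightarrow>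
   (('v \<Rightarrow> 'v) \<Rightarrow> 'm \<Rightarrow> 'm) \<Rightarrow> 'm set \<Rightarrow> bool" where
  "polynomial_GL_module s t act M \<longleftrightarrow>
     GL_module s t act M \<and>
     (\<exists>B. finite B \<and> module.span t B = M) \<and>
     (\<forall>\<phi>\<in>dual_space t M. \<forall>m\<in>M. \<exists>P\<in>poly_fun (fun_scale s) (End s).
        \<forall>g\<in>GL s. \<phi> (act g m) = P g)"

definition ordered_basis :: "(complex \<Rightarrow> 'v::ab_group_add \<Rightarrow> 'v) \<Rightarrow> 'v list \<Rightarrow> bool" where
  "ordered_basis s bs \<longleftrightarrow>
     distinct bs \<and> \<not> module.dependent s (set bs) \<and> module.span s (set bs) = UNIV"

definition is_partition :: "nat list \<Rightarrow> bool" where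
  "is_partition la \<longleftrightarrow> sorted_wrt (\<ge>) la"

definition part :: "nat list \<Rightarrow> nat \<Rightarrow> nat" where
  "part la i = (if i < length la then la ! i else 0)"

text \<open>
  Highest weight vectors with respect to the torus and the upper triangular unipotent group of an
  ordered basis: torus elements scale \<open>m\<close> by the character \<open>la\<close>, unipotent ones fix \<open>m\<close>.
\<close>

definition highest_weight_vector ::
  "(complex \<Rightarrow> 'v::ab_group_add \<Rightarrow> 'v) \<Rightarrow> (complex \<Rightarrow> 'm::ab_group_add \<Rightarrow> 'm) \<Rightarrow>
   (('v \<Rightarrow> 'v) \<Rightarrow> 'm \<Rightarrow> 'm) \<Rightarrow> 'v list \<Rightarrow> nat list \<Rightarrow> 'm \<Rightarrow> bool" where
  "highest_weight_vector s t act bs la m \<longleftrightarrow>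
     m \<noteq> 0 \<and>
     (\<forall>g\<in>GL s. \<forall>a. (\<forall>i<length bs. g (bs ! i) = s (a i) (bs ! i)) \<longrightarrow>
        act g m = t (\<Prod>i<length bs. a i ^ part la i) m) \<and>
     (\<forall>g\<in>GL s. (\<forall>i<length bs. g (bs ! i) - bs ! i \<in> module.span s (set (take i bs))) \<longrightarrow>
        act g m = m)"

text \<open>
  \<open>M\<close> is (a copy of) \<open>S\<^sub>\<lambda>V\<close>: the irreducible polynomial module of highest weight \<open>la\<close>. The
  highest weight does not depend on the choice of the ordered basis, as any two are conjugate.
\<close>

definition is_Schur_module ::
  "(complex \<Rightarrow> 'v::ab_group_add \<Rightarrow> 'v) \<Rightarrow> nat list \<Rightarrow> (complex \<Rightarrow> 'm::ab_group_add \<Rightarrow> 'm) \<Rightarrow>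
   (('v \<Rightarrow> 'v) \<Rightarrow> 'm \<Rightarrow> 'm) \<Rightarrow> 'm set \<Rightarrow> bool" where
  "is_Schur_module s la t act M \<longleftrightarrow>
     is_partition la \<and> length la \<le> vector_space.dim s UNIV \<and>
     irreducible_GL_module s t act M \<and> polynomial_GL_module s t act M \<and>
     (\<forall>bs. ordered_basis s bs \<longrightarrow> (\<exists>m\<in>M. highest_weight_vector s t act bs la m))"

text \<open>
  The action on polynomial functions \<open>F\<close> on \<open>S\<^sup>d(V\<^sup>*)\<close>: \<open>g\<close> sends \<open>z \<in> S\<^sup>d(V\<^sup>*)\<close> to \<open>z \<circ> g\<^sup>-\<^sup>1\<close>,
  hence \<open>F\<close> to \<open>z \<mapsto> F (g\<^sup>-\<^sup>1 \<cdot> z) = F (z \<circ> g)\<close>. Evaluation at \<open>v \<in> V\<close> goes to evaluation at \<open>g v\<close>,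
  so this is the standard action on \<open>S\<^sup>\<delta>(S\<^sup>d V)\<close>.
\<close>

definition plethysm_act ::
  "('v \<Rightarrow> 'v) \<Rightarrow> (('v \<Rightarrow> complex) \<Rightarrow> complex) \<Rightarrow> ('v \<Rightarrow> complex) \<Rightarrow> complex" where
  "plethysm_act g F = (\<lambda>z. F (z \<circ> g))"

end

theory Submission
  imports Defs "Jordan_Normal_Form.Determinant"
begin

text \<open>
  Label the ten 3-subsets of five columns by ten trilinear forms on \<open>C\<^sup>6\<close>. Every column then meets six
  labels, and antisymmetrising over each column gives a multilinear form \<open>Psi\<close> that is multiplied by
  \<open>det\<^sup>5\<close> under base change. Putting the polarisation of a cubic \<open>z\<close> at eight labels and
  \<open>x\<^sub>5 \<otimes> x\<^sub>4 \<otimes> x\<^sub>5\<close>, \<open>x\<^sub>5 \<otimes> x\<^sub>5 \<otimes> x\<^sub>4\<close>, where \<open>x\<^sub>4, x\<^sub>5\<close> are the last two coordinate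
  functionals (numbered from 0), at the other two, yields a polynomial of degree 8 in \<open>z\<close> which is a
  highest weight vector of weight \<open>(5,5,5,5,3,1)\<close>. It is nonzero: its value at
  \<open>x\<^sub>1x\<^sub>2x\<^sub>4 + x\<^sub>0x\<^sub>3x\<^sub>5 + x\<^sub>2x\<^sub>3\<^sup>2/2 + x\<^sub>0\<^sup>2x\<^sub>1/2\<close> is 3360.

  It vanishes at \<open>z = y\<^sub>0y\<^sub>1y\<^sub>2 + y\<^sub>3y\<^sub>4y\<^sub>5\<close>. If the \<open>y\<^sub>i\<close> are dependent, the column without
  \<open>x\<^sub>4, x\<^sub>5\<close> vanishes. Otherwise take them as coordinates, at the price of making \<open>x\<^sub>4, x\<^sub>5\<close>
  arbitrary. In a filling with nonzero sign each of the six values occurs in every column, so that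
  \<open>0, 1, 2\<close> occur equally often at the six slots of \<open>x\<^sub>4, x\<^sub>5\<close>, and so do \<open>3, 4, 5\<close>, with
  frequencies adding up to 2. Hence two values of one block are distributed in the same way between
  \<open>x\<^sub>4\<close> and \<open>x\<^sub>5\<close>, and exchanging them changes the sign of the term, as there are five columns.

  A Hermitian form on the 24th tensor power of \<open>V\<close> gives complete reducibility, hence an irreducible
  submodule onto which the highest weight vector has a nonzero equivariant projection. The projection
  is again a highest weight vector of the same weight.
\<close>

section \<open>Determinants and the tableau invariant\<close>

definition det6 :: "(nat \<Rightarrow> nat \<Rightarrow> complex) \<Rightarrow> complex" where
  "det6 R = det (mat 6 6 (\<lambda>(i, j). R i j))"

lemma det6_perm: "det6 R = (\<Sum>p | p permutes {0..<6}. of_int (sign p) * (\<Prod>i<6. R i (p i)))"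
proof -
  have "det6 R = (\<Sum>p | p permutes {0..<6}. of_int (sign p) *
      (\<Prod>i = 0..<6. mat 6 6 (\<lambda>(i, j). R i j) $$ (i, p i)))"
    unfolding det6_def by (rule det_def') simp
  also have "\<dots> = (\<Sum>p | p permutes {0..<6}. of_int (sign p) * (\<Prod>i<6. R i (p i)))"
  proof (intro sum.cong refl arg_cong2[where f = "(*)"])
    fix p :: "nat \<Rightarrow> nat" assume "p \<in> {p. p permutes {0..<6}}"
    then have "p i < 6" if "i < 6" for i
      using that permutes_in_image[of p "{0..<6}" i] by auto
    then show "(\<Prod>i = 0..<6. mat 6 6 (\<lambda>(i, j). R i j) $$ (i, p i)) = (\<Prod>i<6. R i (p i))"
      by (auto simp: atLeast0LessThan intro!: prod.cong)
  qed
  finally show ?thesis .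
qed

lemma det6_cong: "(\<And>i j. i < 6 \<Longrightarrow> j < 6 \<Longrightarrow> R i j = R' i j) \<Longrightarrow> det6 R = det6 R'"
  unfolding det6_def by (intro arg_cong[where f = det] cong_mat) auto

lemma det6_mult: "det6 (\<lambda>i j. \<Sum>r<6. R i r * G r j) = det6 R * det6 G"
proof -
  have e: "mat 6 6 (\<lambda>(i, j). \<Sum>r<6. R i r * G r j) =
      mat 6 6 (\<lambda>(i, j). R i j) * mat 6 6 (\<lambda>(i, j). G i j)"
    by (rule eq_matI) (auto simp: scalar_prod_def atLeast0LessThan intro!: sum.cong)
  show ?thesis
    unfolding det6_def e by (rule det_mult[of _ 6]) simp_all
qed

lemma det6_add_row:
  assumes "k < 6" "l < 6" "k \<noteq> l"
  shows "det6 (R(k := (\<lambda>j. R k j + t * R l j))) = det6 R"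
proof -
  have "mat 6 6 (\<lambda>(i, j). (R(k := (\<lambda>j. R k j + t * R l j))) i j) =
      addrow t k l (mat 6 6 (\<lambda>(i, j). R i j))"
    by (rule eq_matI) (use assms in \<open>auto simp: fun_upd_def\<close>)
  then show ?thesis
    unfolding det6_def using det_addrow[of l 6 k "mat 6 6 (\<lambda>(i, j). R i j)" t] assms by (simp only: mat_carrier simp_thms)
qed

lemma det6_eq_rows:
  assumes "k < 6" "l < 6" "k \<noteq> l" "\<And>j. j < 6 \<Longrightarrow> R k j = R l j"
  shows "det6 R = 0"
  unfolding det6_def using assms
  by (intro det_identical_rows[of _ 6 k l]) (auto intro!: eq_vecI)

lemma det6_swap_columns:
  assumes "k < 6" "l < 6" "k \<noteq> l"
  shows "det6 (\<lambda>i j. R i (transpose k l j)) = - det6 R"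
proof -
  have "mat 6 6 (\<lambda>(i, j). R i (transpose k l j)) = swapcols k l (mat 6 6 (\<lambda>(i, j). R i j))"
    by (rule eq_matI) (use assms in \<open>auto simp: transpose_def\<close>)
  then show ?thesis
    unfolding det6_def using det_swapcols[of k 6 l "mat 6 6 (\<lambda>(i, j). R i j)"] assms by simp
qed

lemma det6_upper_triangular:
  assumes "\<And>i j. i < 6 \<Longrightarrow> j < i \<Longrightarrow> G i j = 0"
  shows "det6 G = (\<Prod>i<6. G i i)"
proof -
  have "det (mat 6 6 (\<lambda>(i, j). G i j)) = prod_list (diag_mat (mat 6 6 (\<lambda>(i, j). G i j)))"
    by (rule det_upper_triangular[of _ 6]) (use assms in \<open>auto simp: upper_triangular_def\<close>)
  also have "\<dots> = (\<Prod>i<6. G i i)"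
    by (simp add: diag_mat_def numeral_eq_Suc lessThan_Suc ac_simps)
  finally show ?thesis unfolding det6_def .
qed

lemma det6_inverse:
  assumes "det6 Y \<noteq> 0"
  obtains X where "\<And>i j. i < 6 \<Longrightarrow> j < 6 \<Longrightarrow> (\<Sum>r<6. X i r * Y r j) = (if i = j then 1 else 0)"
proof -
  let ?Y = "mat 6 6 (\<lambda>(i, j). Y i j)"
  have "?Y \<in> Units (ring_mat TYPE(complex) 6 undefined)"
    by (rule det_non_zero_imp_unit) (use assms in \<open>auto simp: det6_def\<close>)
  then obtain A where A: "A \<in> carrier_mat 6 6" "A * ?Y = 1\<^sub>m 6"
    by (auto simp: Units_def ring_mat_def)
  have "(\<Sum>r<6. A $$ (i, r) * Y r j) = (if i = j then 1 else 0)" if "i < 6" "j < 6" for i j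
  proof -
    have "(A * ?Y) $$ (i, j) = (\<Sum>r<6. A $$ (i, r) * Y r j)"
      using that A(1) by (auto simp: scalar_prod_def atLeast0LessThan intro!: sum.cong)
    then show ?thesis using A(2) that by simp
  qed
  then show ?thesis by (rule that)
qed

text \<open>
  The labels 0 and 1 are those of \<open>x\<^sub>4, x\<^sub>5\<close>. The cells of a column are pairs \<open>(a, k)\<close>, for the
  \<open>k\<close>-th argument of the form at label \<open>a\<close>.
\<close>

definition columns_of :: "nat list list" where
  "columns_of = [[1,3,4],[2,3,4],[1,2,3],[0,1,3],[0,2,3],[0,3,4],[0,1,2],[0,1,4],[0,2,4],[1,2,4]]"

definition column_cells :: "nat \<Rightarrow> (nat \<times> nat) list" where
  "column_cells c = [(a, k). a \<leftarrow> [0..<10], k \<leftarrow> [0..<3], columns_of ! a ! k = c]"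

text \<open>The row of the cell \<open>(a, k)\<close>: the cells of a column are ordered by label,
  and no label meets a column twice.\<close>

definition position_of :: "nat \<Rightarrow> nat \<Rightarrow> nat" where
  "position_of a k = length (filter (\<lambda>b. columns_of ! a ! k \<in> set (columns_of ! b)) [0..<a])"

lemma column_cells_simps:
  "column_cells 0 = [(3,0),(4,0),(5,0),(6,0),(7,0),(8,0)]"
  "column_cells 1 = [(0,0),(2,0),(3,1),(6,1),(7,1),(9,0)]"
  "column_cells (Suc 0) = [(0,0),(2,0),(3,1),(6,1),(7,1),(9,0)]"
  "column_cells 2 = [(1,0),(2,1),(4,1),(6,2),(8,1),(9,1)]"
  "column_cells 3 = [(0,1),(1,1),(2,2),(3,2),(4,2),(5,1)]"
  "column_cells 4 = [(0,2),(1,2),(5,2),(7,2),(8,2),(9,2)]"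
  by (simp_all add: column_cells_def columns_of_def upt_rec)

lemma less_numeral_cases:
  "(a::nat) < 10 \<longleftrightarrow> a = 0 \<or> a = 1 \<or> a = 2 \<or> a = 3 \<or> a = 4 \<or> a = 5 \<or> a = 6 \<or> a = 7 \<or> a = 8 \<or> a = 9"
  "(a::nat) < 5 \<longleftrightarrow> a = 0 \<or> a = 1 \<or> a = 2 \<or> a = 3 \<or> a = 4"
  "(a::nat) < 6 \<longleftrightarrow> a = 0 \<or> a = 1 \<or> a = 2 \<or> a = 3 \<or> a = 4 \<or> a = 5"
  "(a::nat) < 3 \<longleftrightarrow> a = 0 \<or> a = 1 \<or> a = 2"
  by - presburger+

lemma columns_of_bounds: "a < 10 \<Longrightarrow> k < 3 \<Longrightarrow> columns_of ! a ! k < 5 \<and> position_of a k < 6"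
  unfolding less_numeral_cases(1,4)
  by (elim disjE; hypsubst) (simp_all add: columns_of_def position_of_def upt_rec)

lemma column_cells_slot: "a < 10 \<Longrightarrow> k < 3 \<Longrightarrow> column_cells (columns_of ! a ! k) ! position_of a k = (a, k)"
  unfolding less_numeral_cases(1,4)
  by (elim disjE; hypsubst) (simp_all add: columns_of_def position_of_def upt_rec column_cells_simps)

lemma slot_column_cells:
  assumes "c < 5" "i < 6"
  shows "case column_cells c ! i of (a, k) \<Rightarrow> a < 10 \<and> k < 3 \<and> columns_of ! a ! k = c \<and> position_of a k = i"
  using assms unfolding less_numeral_cases(2,3)
  by (elim disjE; hypsubst; simp add: column_cells_simps; simp add: columns_of_def position_of_def upt_rec)

text \<open>The thirty cells are indexed once by label and argument, once by column and row;
  \<open>column_cells_slot\<close> and \<open>slot_column_cells\<close> make these indexings inverse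
  to each other. This turns products over labels into products over columns.\<close>

lemma prod_cells:
  fixes h :: "nat \<Rightarrow> nat \<Rightarrow> nat \<Rightarrow> nat \<Rightarrow> complex"
  shows "(\<Prod>a<10. \<Prod>k<3. h (columns_of ! a ! k) (position_of a k) a k) =
    (\<Prod>c<5. \<Prod>i<6. case column_cells c ! i of (a, k) \<Rightarrow> h c i a k)"
  unfolding prod.cartesian_product
  by (rule prod.reindex_bij_witness[where j = "\<lambda>(a, k). (columns_of ! a ! k, position_of a k)" and i = "\<lambda>(c, i). column_cells c ! i"])
    (use slot_column_cells in \<open>fastforce simp: column_cells_slot columns_of_bounds split: prod.splits\<close>)+

abbreviation slot :: "(nat \<Rightarrow> nat \<Rightarrow> nat) \<Rightarrow> nat \<Rightarrow> nat \<Rightarrow> nat" where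
  "slot P a k \<equiv> P (columns_of ! a ! k) (position_of a k)"

text \<open>Five simultaneous Leibniz expansions: column \<open>c\<close> is filled by the
  permutation \<open>P c\<close>, and each label reads its indices from three different columns. In
  invariant terms, ten trilinear forms are contracted with five volume forms.\<close>

definition Psi :: "(nat \<Rightarrow> nat \<Rightarrow> nat \<Rightarrow> nat \<Rightarrow> complex) \<Rightarrow> complex" where
  "Psi Z = (\<Sum>P\<in>PiE {..<5} (\<lambda>_. {p. p permutes {0..<6}}).
     (\<Prod>c<5. of_int (sign (P c))) * (\<Prod>a<10. Z a (slot P a 0) (slot P a 1) (slot P a 2)))"

lemma slot_less:
  assumes "P \<in> PiE {..<5} (\<lambda>_. {p. p permutes {0..<6}})" "a < 10" "k < 3"
  shows "slot P a k < 6"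
proof -
  have "P (columns_of ! a ! k) permutes {0..<6}"
    using PiE_mem[OF assms(1), of "columns_of ! a ! k"] columns_of_bounds[OF assms(2,3)] by auto
  moreover have "position_of a k \<in> {0..<6}"
    using columns_of_bounds[OF assms(2,3)] by simp
  ultimately have "slot P a k \<in> {0..<6}"
    by (simp only: permutes_in_image)
  then show ?thesis by simp
qed

lemma Psi_cong:
  assumes "\<And>a i j k. a < 10 \<Longrightarrow> i < 6 \<Longrightarrow> j < 6 \<Longrightarrow> k < 6 \<Longrightarrow> Z a i j k = Z' a i j k"
  shows "Psi Z = Psi Z'"
proof -
  have "Z a (slot P a 0) (slot P a 1) (slot P a 2) = Z' a (slot P a 0) (slot P a 1) (slot P a 2)"
    if "P \<in> PiE {..<5} (\<lambda>_. {p. p permutes {0..<6::nat}})" "a < 10" for P a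
    using that by (intro assms slot_less) simp_all
  then show ?thesis
    unfolding Psi_def by simp
qed

lemma finite_perms: "finite {p. p permutes {0..<6::nat}}"
  by (rule finite_permutations) simp

text \<open>Once a rank-one term \<open>\<tau> a\<close> is chosen for each label, every cell
  carries a single covector. Grouping the cells by columns lets the sum over \<open>P\<close> factor
  into five determinants.\<close>

lemma Psi_sum_rank_one:
  assumes fin: "\<And>a. a < 10 \<Longrightarrow> finite (\<Theta> a)"
  shows "Psi (\<lambda>a i j k. \<Sum>\<theta>\<in>\<Theta> a. w a \<theta> * (f a \<theta> 0 i * f a \<theta> 1 j * f a \<theta> 2 k)) =
    (\<Sum>\<tau>\<in>PiE {..<10} \<Theta>. (\<Prod>a<10. w a (\<tau> a)) *
       (\<Prod>c<5. det6 (\<lambda>i j. case column_cells c ! i of (a, k) \<Rightarrow> f a (\<tau> a) k j)))"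
proof -
  let ?Q = "PiE {..<5} (\<lambda>_. {p. p permutes {0..<6::nat}})"
  let ?row = "\<lambda>\<tau> c i j. case column_cells c ! i of (a, k) \<Rightarrow> f a (\<tau> a) k j"
  have expand: "(\<Prod>a<10. \<Sum>\<theta>\<in>\<Theta> a. w a \<theta> *
        (f a \<theta> 0 (slot P a 0) * f a \<theta> 1 (slot P a 1) * f a \<theta> 2 (slot P a 2))) =
      (\<Sum>\<tau>\<in>PiE {..<10} \<Theta>. (\<Prod>a<10. w a (\<tau> a)) * (\<Prod>c<5. \<Prod>i<6. ?row \<tau> c i (P c i)))" for P
  proof -
    have "(\<Prod>a<10. \<Sum>\<theta>\<in>\<Theta> a. w a \<theta> *
          (f a \<theta> 0 (slot P a 0) * f a \<theta> 1 (slot P a 1) * f a \<theta> 2 (slot P a 2))) =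
        (\<Prod>a<10. \<Sum>\<theta>\<in>\<Theta> a. w a \<theta> * (\<Prod>k<3. f a \<theta> k (slot P a k)))"
      by (simp add: numeral_3_eq_3 numeral_2_eq_2)
    also have "\<dots> = (\<Sum>\<tau>\<in>PiE {..<10} \<Theta>. \<Prod>a<10. w a (\<tau> a) * (\<Prod>k<3. f a (\<tau> a) k (slot P a k)))"
      by (rule prod_sum_PiE) (use fin in auto)
    also have "\<dots> = (\<Sum>\<tau>\<in>PiE {..<10} \<Theta>. (\<Prod>a<10. w a (\<tau> a)) * (\<Prod>c<5. \<Prod>i<6. ?row \<tau> c i (P c i)))"
    proof (rule sum.cong[OF refl])
      fix \<tau>
      show "(\<Prod>a<10. w a (\<tau> a) * (\<Prod>k<3. f a (\<tau> a) k (slot P a k))) =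
          (\<Prod>a<10. w a (\<tau> a)) * (\<Prod>c<5. \<Prod>i<6. ?row \<tau> c i (P c i))"
        unfolding prod.distrib prod_cells[of "\<lambda>c i a k. f a (\<tau> a) k (P c i)"] by (rule refl)
    qed
    finally show ?thesis .
  qed
  have collect: "(\<Sum>P\<in>?Q. (\<Prod>c<5. of_int (sign (P c))) * ((\<Prod>a<10. w a (\<tau> a)) * (\<Prod>c<5. \<Prod>i<6. ?row \<tau> c i (P c i)))) =
      (\<Prod>a<10. w a (\<tau> a)) * (\<Prod>c<5. det6 (?row \<tau> c))" for \<tau>
  proof -
    have "(\<Sum>P\<in>?Q. (\<Prod>c<5. of_int (sign (P c))) * ((\<Prod>a<10. w a (\<tau> a)) * (\<Prod>c<5. \<Prod>i<6. ?row \<tau> c i (P c i)))) =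
        (\<Prod>a<10. w a (\<tau> a)) * (\<Sum>P\<in>?Q. \<Prod>c<5. of_int (sign (P c)) * (\<Prod>i<6. ?row \<tau> c i (P c i)))"
      unfolding sum_distrib_left prod.distrib by (simp only: ac_simps)
    also have "(\<Sum>P\<in>?Q. \<Prod>c<5. of_int (sign (P c)) * (\<Prod>i<6. ?row \<tau> c i (P c i))) = (\<Prod>c<5. det6 (?row \<tau> c))"
      unfolding det6_perm
      by (rule prod_sum_PiE[symmetric]) (simp_all add: finite_perms)
    finally show ?thesis .
  qed
  have "Psi (\<lambda>a i j k. \<Sum>\<theta>\<in>\<Theta> a. w a \<theta> * (f a \<theta> 0 i * f a \<theta> 1 j * f a \<theta> 2 k)) =
      (\<Sum>P\<in>?Q. \<Sum>\<tau>\<in>PiE {..<10} \<Theta>. (\<Prod>c<5. of_int (sign (P c))) *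
        ((\<Prod>a<10. w a (\<tau> a)) * (\<Prod>c<5. \<Prod>i<6. ?row \<tau> c i (P c i))))"
    unfolding Psi_def expand sum_distrib_left by (rule refl)
  also have "\<dots> = (\<Sum>\<tau>\<in>PiE {..<10} \<Theta>. \<Sum>P\<in>?Q. (\<Prod>c<5. of_int (sign (P c))) *
        ((\<Prod>a<10. w a (\<tau> a)) * (\<Prod>c<5. \<Prod>i<6. ?row \<tau> c i (P c i))))"
    by (rule sum.swap)
  also have "\<dots> = (\<Sum>\<tau>\<in>PiE {..<10} \<Theta>. (\<Prod>a<10. w a (\<tau> a)) * (\<Prod>c<5. det6 (?row \<tau> c)))"
    unfolding collect by (rule refl)
  finally show ?thesis .
qed

definition idx :: "nat \<times> nat \<times> nat \<Rightarrow> nat \<Rightarrow> nat" where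
  "idx t k = (case t of (p, q, r) \<Rightarrow> if k = 0 then p else if k = 1 then q else r)"

lemma idx_simps [simp]:
  "idx (p, q, r) 0 = p" "idx (p, q, r) (Suc 0) = q" "idx (p, q, r) 1 = q" "idx (p, q, r) 2 = r"
  by (simp_all add: idx_def)

abbreviation triples6 :: "(nat \<times> nat \<times> nat) set" where
  "triples6 \<equiv> {..<6} \<times> {..<6} \<times> {..<6}"

text \<open>Zero unless \<open>v\<close> maps 0..5 bijectively onto itself, and the sign otherwise.
  The form as a determinant gives access to \<open>det6_mult\<close> and
  \<open>det6_swap_columns\<close>.\<close>

definition levi_civita :: "(nat \<Rightarrow> nat) \<Rightarrow> complex" where
  "levi_civita v = det6 (\<lambda>i j. if v i = j then 1 else 0)"

abbreviation col :: "(nat \<Rightarrow> nat \<times> nat \<times> nat) \<Rightarrow> nat \<Rightarrow> nat \<Rightarrow> nat" where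
  "col \<tau> c i \<equiv> case column_cells c ! i of (a, k) \<Rightarrow> idx (\<tau> a) k"

text \<open>Expansion into elementary tensors, restricted to a support \<open>\<Theta> a\<close> of
  each form. Both the vanishing and the numerical evaluation start from it.\<close>

lemma Psi_levi_civita:
  assumes fin: "\<And>a. a < 10 \<Longrightarrow> finite (\<Theta> a)"
  shows "Psi (\<lambda>a i j k. if (i, j, k) \<in> \<Theta> a then Z a (i, j, k) else 0) =
    (\<Sum>\<tau>\<in>PiE {..<10} \<Theta>. (\<Prod>a<10. Z a (\<tau> a)) * (\<Prod>c<5. levi_civita (col \<tau> c)))"
proof -
  have delta: "(if (i, j, k) \<in> \<Theta> a then Z a (i, j, k) else 0) =
      (\<Sum>\<theta>\<in>\<Theta> a. Z a \<theta> * ((if idx \<theta> 0 = i then 1 else 0) *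
        (if idx \<theta> 1 = j then 1 else 0) * (if idx \<theta> 2 = k then 1 else 0)))"
    if "a < 10" for a i j k
  proof -
    have "(\<Sum>\<theta>\<in>\<Theta> a. Z a \<theta> * ((if idx \<theta> 0 = i then 1 else 0) *
        (if idx \<theta> 1 = j then 1 else 0) * (if idx \<theta> 2 = k then 1 else 0))) =
        (\<Sum>\<theta>\<in>\<Theta> a. if \<theta> = (i, j, k) then Z a \<theta> else 0)"
      by (intro sum.cong) auto
    then show ?thesis using fin[OF that] by (simp add: sum.delta)
  qed
  have "Psi (\<lambda>a i j k. if (i, j, k) \<in> \<Theta> a then Z a (i, j, k) else 0) =
      Psi (\<lambda>a i j k. \<Sum>\<theta>\<in>\<Theta> a. Z a \<theta> * ((if idx \<theta> 0 = i then 1 else 0) *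
        (if idx \<theta> 1 = j then 1 else 0) * (if idx \<theta> 2 = k then 1 else 0)))"
    by (rule Psi_cong) (simp add: delta)
  also have "\<dots> = (\<Sum>\<tau>\<in>PiE {..<10} \<Theta>. (\<Prod>a<10. Z a (\<tau> a)) *
       (\<Prod>c<5. det6 (\<lambda>i j. case column_cells c ! i of (a, k) \<Rightarrow> if idx (\<tau> a) k = j then 1 else 0)))"
    by (rule Psi_sum_rank_one[where f = "\<lambda>a \<theta> k j. if idx \<theta> k = j then 1 else 0"]) (rule fin)
  also have "\<dots> = (\<Sum>\<tau>\<in>PiE {..<10} \<Theta>. (\<Prod>a<10. Z a (\<tau> a)) * (\<Prod>c<5. levi_civita (col \<tau> c)))"
    unfolding levi_civita_def by (intro sum.cong refl arg_cong2[where f = "(*)"] prod.cong det6_cong)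
      (auto split: prod.splits)
  finally show ?thesis .
qed

lemma Psi_triples6:
  "Psi Z = (\<Sum>\<tau>\<in>PiE {..<10} (\<lambda>_. triples6). (\<Prod>a<10. case \<tau> a of (i, j, k) \<Rightarrow> Z a i j k) * (\<Prod>c<5. levi_civita (col \<tau> c)))"
proof -
  have "Psi Z = Psi (\<lambda>a i j k. if (i, j, k) \<in> triples6 then case (i, j, k) of (i, j, k) \<Rightarrow> Z a i j k else 0)"
    by (rule Psi_cong) simp
  also have "\<dots> = (\<Sum>\<tau>\<in>PiE {..<10} (\<lambda>_. triples6). (\<Prod>a<10. case \<tau> a of (i, j, k) \<Rightarrow> Z a i j k) * (\<Prod>c<5. levi_civita (col \<tau> c)))"
    by (rule Psi_levi_civita) simp
  finally show ?thesis .
qed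

section \<open>Base change of the tableau invariant\<close>

definition pull :: "(nat \<Rightarrow> nat \<Rightarrow> complex) \<Rightarrow> (nat \<Rightarrow> nat \<Rightarrow> nat \<Rightarrow> complex) \<Rightarrow> nat \<Rightarrow> nat \<Rightarrow> nat \<Rightarrow> complex" where
  "pull g Z i j k = (\<Sum>(p, q, r)\<in>triples6. Z p q r * (g p i * g q j * g r k))"

text \<open>The matrix \<open>G a\<close> may depend on the label;
  \<open>Psixi_pull_singular\<close> uses this to pull back only the labels from 2 on.\<close>

lemma Psi_pull_rows:
  "Psi (\<lambda>a. pull (G a) (Z a)) =
    (\<Sum>\<tau>\<in>PiE {..<10} (\<lambda>_. triples6). (\<Prod>a<10. case \<tau> a of (i, j, k) \<Rightarrow> Z a i j k) *
       (\<Prod>c<5. det6 (\<lambda>i j. case column_cells c ! i of (a, k) \<Rightarrow> G a (idx (\<tau> a) k) j)))"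
proof -
  have "Psi (\<lambda>a. pull (G a) (Z a)) =
      Psi (\<lambda>a i j k. \<Sum>\<theta>\<in>triples6. (case \<theta> of (i, j, k) \<Rightarrow> Z a i j k) *
        (G a (idx \<theta> 0) i * G a (idx \<theta> 1) j * G a (idx \<theta> 2) k))"
    unfolding pull_def by (rule Psi_cong) (auto intro!: sum.cong)
  also have "\<dots> = (\<Sum>\<tau>\<in>PiE {..<10} (\<lambda>_. triples6). (\<Prod>a<10. case \<tau> a of (i, j, k) \<Rightarrow> Z a i j k) *
       (\<Prod>c<5. det6 (\<lambda>i j. case column_cells c ! i of (a, k) \<Rightarrow> G a (idx (\<tau> a) k) j)))"
    by (rule Psi_sum_rank_one[where f = "\<lambda>a \<theta> k. G a (idx \<theta> k)"]) simp
  finally show ?thesis .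
qed

lemma col_less:
  assumes "\<tau> \<in> PiE {..<10} (\<lambda>_. triples6)" "c < 5" "i < 6"
  shows "col \<tau> c i < 6"
proof -
  obtain a k where ak: "column_cells c ! i = (a, k)" by force
  then have "a < 10" using slot_column_cells[OF assms(2,3)] by simp
  then have "\<tau> a \<in> triples6" using assms(1) by auto
  then show ?thesis by (auto simp: ak idx_def)
qed

text \<open>Selecting rows of \<open>g\<close> according to \<open>col \<tau> c\<close> is
  multiplication by a 0-1 matrix, whose determinant is the Levi-Civita symbol.\<close>

lemma det6_col_mult:
  assumes "\<tau> \<in> PiE {..<10} (\<lambda>_. triples6)" "c < 5"
    and "\<And>i j. i < 6 \<Longrightarrow> j < 6 \<Longrightarrow> R i j = g (col \<tau> c i) j"
  shows "det6 R = levi_civita (col \<tau> c) * det6 g"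
proof -
  have "det6 R = det6 (\<lambda>i j. \<Sum>r<6. (if col \<tau> c i = r then 1 else 0) * g r j)"
    by (rule det6_cong) (use assms(3) col_less[OF assms(1,2)] in \<open>simp add: if_distrib[of "\<lambda>x. x * _"] cong: if_cong\<close>)
  then show ?thesis unfolding levi_civita_def by (simp add: det6_mult)
qed

text \<open>Every column contributes one factor \<open>det6 g\<close>, whatever the filling.\<close>

lemma Psi_pull: "Psi (\<lambda>a. pull g (Z a)) = det6 g ^ 5 * Psi Z"
proof -
  have "(\<Prod>c<5. det6 (\<lambda>i j. case column_cells c ! i of (a, k) \<Rightarrow> g (idx (\<tau> a) k) j)) =
      det6 g ^ 5 * (\<Prod>c<5. levi_civita (col \<tau> c))"
    if "\<tau> \<in> PiE {..<10} (\<lambda>_. triples6)" for \<tau>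
  proof -
    have "(\<Prod>c<5. det6 (\<lambda>i j. case column_cells c ! i of (a, k) \<Rightarrow> g (idx (\<tau> a) k) j)) =
        (\<Prod>c<5. levi_civita (col \<tau> c) * det6 g)"
      by (rule prod.cong[OF refl], rule det6_col_mult[OF that]) (auto split: prod.splits)
    then show ?thesis by (simp add: prod.distrib)
  qed
  then show ?thesis
    unfolding Psi_pull_rows Psi_triples6[of Z] sum_distrib_left
    by (intro sum.cong) auto
qed

text \<open>Columns 3 and 4 receive one \<open>x4\<close> and one \<open>x5\<close> each, columns 1
  and 2 one \<open>x5\<close> each, column 0 neither. The cells left over form columns of lengths 6,
  5, 5, 4, 4, the conjugate partition of (5,5,5,5,3,1).\<close>

definition with_xi ::
  "(nat \<Rightarrow> complex) \<Rightarrow> (nat \<Rightarrow> complex) \<Rightarrow> (nat \<Rightarrow> nat \<Rightarrow> nat \<Rightarrow> complex) \<Rightarrow> nat \<Rightarrow> nat \<Rightarrow> nat \<Rightarrow> nat \<Rightarrow> complex" where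
  "with_xi x4 x5 Z a =
    (if a = 0 then (\<lambda>i j k. x5 i * x4 j * x5 k)
     else if a = 1 then (\<lambda>i j k. x5 i * x5 j * x4 k) else Z)"

definition Psixi :: "(nat \<Rightarrow> complex) \<Rightarrow> (nat \<Rightarrow> complex) \<Rightarrow> (nat \<Rightarrow> nat \<Rightarrow> nat \<Rightarrow> complex) \<Rightarrow> complex" where
  "Psixi x4 x5 Z = Psi (with_xi x4 x5 Z)"

definition pull1 :: "(nat \<Rightarrow> nat \<Rightarrow> complex) \<Rightarrow> (nat \<Rightarrow> complex) \<Rightarrow> nat \<Rightarrow> complex" where
  "pull1 g x j = (\<Sum>r<6. x r * g r j)"

lemma pull_rank_one: "pull g (\<lambda>i j k. x i * y j * z k) i j k = pull1 g x i * pull1 g y j * pull1 g z k"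
  unfolding pull_def pull1_def sum_product sum.cartesian_product
  by (rule sum.reindex_bij_witness[of _ "\<lambda>((p, q), r). (p, q, r)" "\<lambda>(p, q, r). ((p, q), r)"]) auto

text \<open>Rank-one forms pull back factor by factor, so the whole family \<open>with_xi\<close> is
  pulled back by one matrix.\<close>

lemma Psixi_pull: "Psixi (pull1 g x4) (pull1 g x5) (pull g Z) = det6 g ^ 5 * Psixi x4 x5 Z"
proof -
  have "with_xi (pull1 g x4) (pull1 g x5) (pull g Z) = (\<lambda>a. pull g (with_xi x4 x5 Z a))"
    by (auto simp: with_xi_def fun_eq_iff pull_rank_one)
  then show ?thesis unfolding Psixi_def by (simp add: Psi_pull)
qed

lemma Psixi_cong:
  assumes "\<And>i j k. i < 6 \<Longrightarrow> j < 6 \<Longrightarrow> k < 6 \<Longrightarrow> Z i j k = Z' i j k"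
    "\<And>i. i < 6 \<Longrightarrow> x4 i = x4' i" "\<And>i. i < 6 \<Longrightarrow> x5 i = x5' i"
  shows "Psixi x4 x5 Z = Psixi x4' x5' Z'"
  unfolding Psixi_def by (rule Psi_cong) (auto simp: with_xi_def assms)

text \<open>Column 0 meets neither of the labels 0 and 1.\<close>

lemma Psixi_pull_singular:
  assumes "det6 g = 0"
  shows "Psixi x4 x5 (pull g Z) = 0"
proof -
  let ?one = "\<lambda>i j :: nat. if i = j then 1 else 0 :: complex"
  \<comment> \<open>The identity matrix at labels 0 and 1 leaves the forms there unchanged, so that
    \<open>Psi_pull_rows\<close> covers all labels at once.\<close>
  let ?G = "\<lambda>a::nat. if a < 2 then ?one else g"
  have one: "pull ?one Z i j k = Z i j k" if "i < 6" "j < 6" "k < 6" for Z i j k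
  proof -
    have "pull ?one Z i j k = (\<Sum>t\<in>triples6. if t = (i, j, k) then Z i j k else 0)"
      unfolding pull_def by (rule sum.cong) (auto split: if_splits)
    then show ?thesis using that by (simp add: sum.delta)
  qed
  have "Psixi x4 x5 (pull g Z) = Psi (\<lambda>a. pull (?G a) (with_xi x4 x5 Z a))"
    unfolding Psixi_def by (rule Psi_cong) (auto simp: with_xi_def one)
  also have "\<dots> = 0"
    unfolding Psi_pull_rows
  proof (rule sum.neutral, rule ballI)
    fix \<tau> :: "nat \<Rightarrow> nat \<times> nat \<times> nat" assume \<tau>: "\<tau> \<in> PiE {..<10} (\<lambda>_. triples6)"
    have "det6 (\<lambda>i j. case column_cells 0 ! i of (a, k) \<Rightarrow> ?G a (idx (\<tau> a) k) j) = levi_civita (col \<tau> 0) * det6 g"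
      by (rule det6_col_mult[OF \<tau>]) (auto simp: less_numeral_cases(3) column_cells_simps)
    then have "(\<Prod>c<5. det6 (\<lambda>i j. case column_cells c ! i of (a, k) \<Rightarrow> ?G a (idx (\<tau> a) k) j)) = 0"
      using assms by (intro prod_zero) auto
    then show "(\<Prod>a<10. case \<tau> a of (i, j, k) \<Rightarrow> with_xi x4 x5 Z a i j k) *
       (\<Prod>c<5. det6 (\<lambda>i j. case column_cells c ! i of (a, k) \<Rightarrow> ?G a (idx (\<tau> a) k) j)) = 0"
      by simp
  qed
  finally show ?thesis .
qed

lemma Psixi_scale: "Psixi (\<lambda>j. c * x4 j) (\<lambda>j. d * x5 j) Z = c ^ 2 * d ^ 4 * Psixi x4 x5 Z"
proof -
  \<comment> \<open>Each of the labels 0 and 1 holds one \<open>x4\<close> and two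
    \<open>x5\<close>.\<close>
  let ?w = "\<lambda>a::nat. if a < 2 then c * d ^ 2 else 1"
  have "Psixi (\<lambda>j. c * x4 j) (\<lambda>j. d * x5 j) Z = Psi (\<lambda>a i j k. ?w a * with_xi x4 x5 Z a i j k)"
    unfolding Psixi_def by (rule Psi_cong) (auto simp: with_xi_def power2_eq_square)
  also have "\<dots> = (\<Prod>a<10. ?w a) * Psixi x4 x5 Z"
    unfolding Psixi_def Psi_def prod.distrib sum_distrib_left by (simp only: ac_simps)
  also have "(\<Prod>a<10. ?w a) = c ^ 2 * d ^ 4"
    by (simp add: eval_nat_numeral lessThan_Suc)
  finally show ?thesis .
qed

text \<open>In each of the columns 3 and 4 the row of \<open>x4\<close> is accompanied by a row of \<open>x5\<close>.\<close>

lemma Psixi_add: "Psixi (\<lambda>j. x4 j + t * x5 j) x5 Z = Psixi x4 x5 Z"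
proof -
  \<comment> \<open>The forms at labels 0 and 1 already have rank one, so a single dummy index
    serves there.\<close>
  let ?\<Theta> = "\<lambda>a::nat. if a < 2 then {(0, 0, 0)} else triples6"
  let ?w = "\<lambda>a::nat. if a < 2 then (\<lambda>_. 1) else (\<lambda>(i, j, k). Z i j k)"
  let ?f = "\<lambda>x4 a \<theta> k.
    if a = 0 then if k = 1 then x4 else x5
    else if a = 1 then if k = 2 then x4 else x5
    else (\<lambda>j. if idx \<theta> k = j then 1 else 0)"
  have rows: "Psixi x4 x5 Z = (\<Sum>\<tau>\<in>PiE {..<10} ?\<Theta>. (\<Prod>a<10. ?w a (\<tau> a)) *
       (\<Prod>c<5. det6 (\<lambda>i j. case column_cells c ! i of (a, k) \<Rightarrow> ?f x4 a (\<tau> a) k j)))" for x4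
  proof -
    have Z: "Z i j k = (\<Sum>\<theta>\<in>triples6. (case \<theta> of (i, j, k) \<Rightarrow> Z i j k) * ((if idx \<theta> 0 = i then 1 else 0) *
        (if idx \<theta> 1 = j then 1 else 0) * (if idx \<theta> 2 = k then 1 else 0)))"
      if "i < 6" "j < 6" "k < 6" for i j k
    proof -
      have "(\<Sum>\<theta>\<in>triples6. (case \<theta> of (i, j, k) \<Rightarrow> Z i j k) * ((if idx \<theta> 0 = i then 1 else 0) *
          (if idx \<theta> 1 = j then 1 else 0) * (if idx \<theta> 2 = k then 1 else 0))) =
          (\<Sum>\<theta>\<in>triples6. if \<theta> = (i, j, k) then Z i j k else 0)"
        by (rule sum.cong) (auto split: if_splits)
      then show ?thesis using that by (simp add: sum.delta)
    qed
    have "Psixi x4 x5 Z = Psi (\<lambda>a i j k. \<Sum>\<theta>\<in>?\<Theta> a. ?w a \<theta> * (?f x4 a \<theta> 0 i * ?f x4 a \<theta> 1 j * ?f x4 a \<theta> 2 k))"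
      unfolding Psixi_def by (rule Psi_cong) (auto simp: with_xi_def Z)
    also have "\<dots> = (\<Sum>\<tau>\<in>PiE {..<10} ?\<Theta>. (\<Prod>a<10. ?w a (\<tau> a)) *
       (\<Prod>c<5. det6 (\<lambda>i j. case column_cells c ! i of (a, k) \<Rightarrow> ?f x4 a (\<tau> a) k j)))"
      by (rule Psi_sum_rank_one) simp
    finally show ?thesis .
  qed
  have "det6 (\<lambda>i j. case column_cells c ! i of (a, k) \<Rightarrow> ?f (\<lambda>j. x4 j + t * x5 j) a (\<tau> a) k j) =
      det6 (\<lambda>i j. case column_cells c ! i of (a, k) \<Rightarrow> ?f x4 a (\<tau> a) k j)" if c: "c < 5"
    for c and \<tau> :: "nat \<Rightarrow> nat \<times> nat \<times> nat"
  proof -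
    let ?R = "\<lambda>i j. case column_cells c ! i of (a, k) \<Rightarrow> ?f x4 a (\<tau> a) k j"
    consider "c < 3" | "c = 3" | "c = 4" using c by linarith
    then show ?thesis
    proof cases
      case 1
      then show ?thesis
        by (intro det6_cong) (auto simp: less_numeral_cases column_cells_simps)
    next
      case 2
      \<comment> \<open>In column 3, row 0 is the cell of \<open>x4\<close> and row 1 a cell of
        \<open>x5\<close>; in column 4 it is the other way round.\<close>
      have "det6 (\<lambda>i j. case column_cells c ! i of (a, k) \<Rightarrow> ?f (\<lambda>j. x4 j + t * x5 j) a (\<tau> a) k j) =
          det6 (?R(0 := (\<lambda>j. ?R 0 j + t * ?R 1 j)))"
        by (intro det6_cong) (auto simp: 2 less_numeral_cases(3) column_cells_simps)
      also have "\<dots> = det6 ?R" by (rule det6_add_row) simp_all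
      finally show ?thesis .
    next
      case 3
      have "det6 (\<lambda>i j. case column_cells c ! i of (a, k) \<Rightarrow> ?f (\<lambda>j. x4 j + t * x5 j) a (\<tau> a) k j) =
          det6 (?R(1 := (\<lambda>j. ?R 1 j + t * ?R 0 j)))"
        by (intro det6_cong) (auto simp: 3 less_numeral_cases(3) column_cells_simps)
      also have "\<dots> = det6 ?R" by (rule det6_add_row) simp_all
      finally show ?thesis .
    qed
  qed
  then show ?thesis unfolding rows by simp
qed

section \<open>Vanishing on sums of two products\<close>

text \<open>Serves to count how often a value occurs in a filling, by labels and by columns.\<close>

lemma sum_cells:
  fixes h :: "nat \<Rightarrow> nat \<Rightarrow> nat \<Rightarrow> nat \<Rightarrow> nat"
  shows "(\<Sum>a<10. \<Sum>k<3. h (columns_of ! a ! k) (position_of a k) a k) =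
    (\<Sum>c<5. \<Sum>i<6. case column_cells c ! i of (a, k) \<Rightarrow> h c i a k)"
  unfolding sum.cartesian_product
  by (rule sum.reindex_bij_witness[where j = "\<lambda>(a, k). (columns_of ! a ! k, position_of a k)" and i = "\<lambda>(c, i). column_cells c ! i"])
    (use slot_column_cells in \<open>fastforce simp: column_cells_slot columns_of_bounds split: prod.splits\<close>)+

text \<open>The support of the polarisation of y0y1y2 + y3y4y5 in the coordinates y; every entry on
  it is 1.\<close>

definition block_triples :: "(nat \<times> nat \<times> nat) set" where
  "block_triples = {(0,1,2),(0,2,1),(1,0,2),(1,2,0),(2,0,1),(2,1,0),(3,4,5),(3,5,4),(4,3,5),(4,5,3),(5,3,4),(5,4,3)}"

definition map3 :: "(nat \<Rightarrow> nat) \<Rightarrow> nat \<times> nat \<times> nat \<Rightarrow> nat \<times> nat \<times> nat" where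
  "map3 h t = (case t of (p, q, r) \<Rightarrow> (h p, h q, h r))"

lemma idx_map3 [simp]: "idx (map3 h t) k = h (idx t k)"
  by (auto simp: idx_def map3_def split: prod.splits)

definition same_block :: "nat \<Rightarrow> nat \<Rightarrow> bool" where
  "same_block i j \<longleftrightarrow> i < 6 \<and> j < 6 \<and> i \<noteq> j \<and> (i < 3 \<longleftrightarrow> j < 3)"

lemma map3_block_triples: "same_block i j \<Longrightarrow> t \<in> block_triples \<Longrightarrow> map3 (transpose i j) t \<in> block_triples"
  unfolding same_block_def less_numeral_cases(3) block_triples_def
  by (elim conjE insertE disjE; simp add: map3_def transpose_def)

lemma map3_triples6: "same_block i j \<Longrightarrow> t \<in> triples6 \<Longrightarrow> map3 (transpose i j) t \<in> triples6"
  by (auto simp: same_block_def map3_def transpose_def)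

lemma map3_transpose_twice: "map3 (transpose i j) (map3 (transpose i j) t) = t"
  by (auto simp: map3_def split: prod.splits)

text \<open>Exchanging the values \<open>k\<close> and \<open>l\<close> exchanges two columns of the
  0-1 matrix behind the symbol.\<close>

lemma levi_civita_transpose:
  assumes "same_block k l" "\<And>i. i < 6 \<Longrightarrow> v' i = transpose k l (v i)"
  shows "levi_civita v' = - levi_civita v"
proof -
  have "levi_civita v' = det6 (\<lambda>i j. if v i = transpose k l j then 1 else 0)"
    unfolding levi_civita_def
  proof (rule det6_cong)
    fix i j :: nat assume "i < 6"
    then have "v' i = j \<longleftrightarrow> v i = transpose k l j"
      by (metis assms(2) transpose_involutory)
    then show "(if v' i = j then 1 else 0 :: complex) = (if v i = transpose k l j then 1 else 0)"
      by (simp only:)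
  qed
  also have "\<dots> = - levi_civita v"
    unfolding levi_civita_def by (rule det6_swap_columns[of k l "\<lambda>i j. if v i = j then 1 else 0"])
      (use assms(1) in \<open>auto simp: same_block_def\<close>)
  finally show ?thesis .
qed

text \<open>A repeated value would give two equal rows, so \<open>v\<close> is a bijection of
  0..5.\<close>

lemma levi_civita_nonzero_count:
  assumes "levi_civita v \<noteq> 0" "\<And>i. i < 6 \<Longrightarrow> v i < 6" "x < 6"
  shows "(\<Sum>i<6. if v i = x then 1 else 0 :: nat) = 1"
proof -
  have inj: "inj_on v {..<6}"
  proof (rule inj_onI, rule ccontr)
    fix i j assume "i \<in> {..<6::nat}" "j \<in> {..<6::nat}" "v i = v j" "i \<noteq> j"
    then have "levi_civita v = 0" unfolding levi_civita_def by (intro det6_eq_rows[of i j]) auto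
    then show False using assms(1) by simp
  qed
  have "v ` {..<6} = {..<6}"
    using inj assms(2) by (intro endo_inj_surj) auto
  then obtain k where k: "k < 6" "v k = x" using assms(3) by (metis imageE lessThan_iff)
  have "(\<Sum>i<6. if v i = x then 1 else 0 :: nat) = (\<Sum>i<6. if i = k then 1 else 0)"
    by (rule sum.cong) (use inj k in \<open>auto simp: inj_on_def\<close>)
  then show ?thesis using k by simp
qed

text \<open>A block triple is an arrangement of its block, so it contains each value of that block
  once.\<close>

lemma block_triples_count:
  assumes "t \<in> block_triples" "x < 6"
  shows "(\<Sum>k<3. if idx t k = x then 1 else 0 :: nat) = (if x < 3 \<longleftrightarrow> fst t < 3 then 1 else 0)"
proof -
  have "(\<Sum>k<3. if idx t k = x then 1 else 0 :: nat) =
      (if idx t 0 = x then 1 else 0) + (if idx t 1 = x then 1 else 0) + (if idx t 2 = x then 1 else 0)"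
    by (simp add: numeral_3_eq_3 numeral_2_eq_2)
  moreover have "\<dots> = (if x < 3 \<longleftrightarrow> fst t < 3 then 1 else 0)"
    using assms unfolding block_triples_def less_numeral_cases(3)
    by (elim insertE disjE emptyE; hypsubst; simp)
  ultimately show ?thesis by simp
qed

lemma eq_neg_imp_zero: "x = - x \<Longrightarrow> x = 0" for x :: complex
  unfolding eq_neg_iff_add_eq_0 by (simp flip: mult_2)

text \<open>The terms are grouped by \<open>y \<tau>\<close>, the frequencies of the six values at
  the cells of \<open>x4\<close> and of \<open>x5\<close>. If two values of a block have equal
  frequencies, exchanging them everywhere is a sign-reversing involution of the group; if not,
  counting values shows that all signs in the group are 0.\<close>

lemma Psixi_two_triples: "Psixi x4 x5 (\<lambda>i j k. if (i, j, k) \<in> block_triples then 1 else 0) = 0"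
proof -
  let ?\<Theta> = "\<lambda>a::nat. if a < 2 then triples6 else block_triples"
  let ?T = "PiE {..<10} ?\<Theta>"
  let ?w = "\<lambda>a::nat. if a = 0 then (\<lambda>(i, j, k). x5 i * x4 j * x5 k)
    else if a = 1 then (\<lambda>(i, j, k). x5 i * x5 j * x4 k) else (\<lambda>_. 1)"
  let ?f = "\<lambda>\<tau>. (\<Prod>a<10. ?w a (\<tau> a)) * (\<Prod>c<5. levi_civita (col \<tau> c))"
  let ?d = "\<lambda>s v::nat. if s = v then 1 else 0 :: nat"
  \<comment> \<open>By \<open>with_xi\<close>, \<open>x4\<close> sits at the cells
    \<open>(0, 1)\<close> and \<open>(1, 2)\<close>, and \<open>x5\<close> at the other four cells
    of labels 0 and 1.\<close>
  define n4 where "n4 \<tau> v = ?d (idx (\<tau> 0) 1) v + ?d (idx (\<tau> 1) 2) v"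
    for \<tau> :: "nat \<Rightarrow> nat \<times> nat \<times> nat" and v
  define n5 where "n5 \<tau> v = ?d (idx (\<tau> 0) 0) v + ?d (idx (\<tau> 0) 2) v + ?d (idx (\<tau> 1) 0) v + ?d (idx (\<tau> 1) 1) v"
    for \<tau> :: "nat \<Rightarrow> nat \<times> nat \<times> nat" and v
  define y where "y \<tau> v = (n4 \<tau> v, n5 \<tau> v)" for \<tau> v
  have fin_block: "finite block_triples" by (simp add: block_triples_def)
  have block6: "block_triples \<subseteq> triples6" by (auto simp: block_triples_def)
  have T6: "\<tau> \<in> PiE {..<10} (\<lambda>_. triples6)" if "\<tau> \<in> ?T" for \<tau>
    using that block6 by (auto simp: PiE_iff split: if_splits)
  \<comment> \<open>The coefficient of a filling depends on its frequencies only, since the other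
    eight forms have entries 1.\<close>
  have w: "(\<Prod>a<10. ?w a (\<tau> a)) = (\<Prod>v<6. x4 v ^ fst (y \<tau> v) * x5 v ^ snd (y \<tau> v))"
    if "\<tau> \<in> ?T" for \<tau>
  proof -
    obtain a b c a' b' c' where t: "\<tau> 0 = (a, b, c)" "\<tau> 1 = (a', b', c')" by (metis prod_cases3)
    have "\<tau> 0 \<in> triples6" "\<tau> 1 \<in> triples6" using PiE_mem[OF T6[OF that], of 0] PiE_mem[OF T6[OF that], of 1] by simp_all
    then have l: "a < 6" "b < 6" "c < 6" "a' < 6" "b' < 6" "c' < 6"
      unfolding t by simp_all
    have p: "(\<Prod>v<6. x v ^ ?d s v) = x s" if "s < 6" for s and x :: "nat \<Rightarrow> complex"
    proof -
      have "(\<Prod>v<6. x v ^ ?d s v) = (\<Prod>v<6. if s = v then x v else 1)"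
        by (rule prod.cong) auto
      then show ?thesis using that by simp
    qed
    have "(\<Prod>v<6. x4 v ^ fst (y \<tau> v) * x5 v ^ snd (y \<tau> v)) = x4 b * x4 c' * (x5 a * x5 c * x5 a' * x5 b')"
      unfolding y_def n4_def n5_def fst_conv snd_conv power_add prod.distrib t idx_simps
      by (simp only: p l)
    moreover have "(\<Prod>a<10. ?w a (\<tau> a)) = x5 a * x4 b * x5 c * (x5 a' * x5 b' * x4 c')"
    proof -
      have "{..<10::nat} = insert 0 (insert 1 {2..<10})" by auto
      then have "(\<Prod>a<10. ?w a (\<tau> a)) = ?w 0 (\<tau> 0) * (?w 1 (\<tau> 1) * (\<Prod>a\<in>{2..<10}. ?w a (\<tau> a)))"
        by simp
      also have "(\<Prod>a\<in>{2..<10}. ?w a (\<tau> a)) = 1"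
        by (rule prod.neutral) auto
      finally show ?thesis using t by simp
    qed
    ultimately show ?thesis by simp
  qed
  have zero: "sum ?f {\<tau> \<in> ?T. y \<tau> = z} = 0" for z
  proof (cases "\<exists>i j. same_block i j \<and> z i = z j")
    case True
    then obtain i j where ij: "same_block i j" "z i = z j" by blast
    \<comment> \<open>\<open>restrict\<close> keeps the function extensional, as \<open>PiE\<close>
      demands.\<close>
    define H where "H \<tau> = restrict (\<lambda>a. map3 (transpose i j) (\<tau> a)) {..<10}"
      for \<tau> :: "nat \<Rightarrow> nat \<times> nat \<times> nat"
    have H: "H \<tau> a = map3 (transpose i j) (\<tau> a)" if "a < 10" for \<tau> a
      using that by (simp add: H_def)
    have HT: "H \<tau> \<in> ?T" if "\<tau> \<in> ?T" for \<tau>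
      unfolding PiE_iff
    proof (intro conjI ballI)
      fix a assume "a \<in> {..<10::nat}"
      then show "H \<tau> a \<in> ?\<Theta> a"
        using PiE_mem[OF that, of a] map3_block_triples[OF ij(1)] map3_triples6[OF ij(1)] by (auto simp: H split: if_splits)
    qed (simp add: H_def)
    have d: "?d (transpose i j s) v = ?d s (transpose i j v)" for s v
      by (metis transpose_involutory)
    have yH: "y (H \<tau>) v = y \<tau> (transpose i j v)" for \<tau> v
      unfolding y_def n4_def n5_def by (simp add: H d)
    have z: "z (transpose i j v) = z v" for v
      using ij(2) by (auto simp: transpose_def)
    have HA: "H \<tau> \<in> {\<tau> \<in> ?T. y \<tau> = z}" if "\<tau> \<in> {\<tau> \<in> ?T. y \<tau> = z}" for \<tau>
      using that HT z yH by (auto simp: fun_eq_iff)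
    have HH: "H (H \<tau>) = \<tau>" if "\<tau> \<in> ?T" for \<tau>
    proof (rule PiE_ext[OF HT[OF HT[OF that]] that])
      fix a assume "a \<in> {..<10::nat}"
      then show "H (H \<tau>) a = \<tau> a" by (simp add: H map3_transpose_twice)
    qed
    have fH: "?f (H \<tau>) = - ?f \<tau>" if "\<tau> \<in> {\<tau> \<in> ?T. y \<tau> = z}" for \<tau>
    proof -
      have "y (H \<tau>) = y \<tau>" using that HA[OF that] by simp
      then have "(\<Prod>a<10. ?w a (H \<tau> a)) = (\<Prod>a<10. ?w a (\<tau> a))"
        using w[of \<tau>] w[of "H \<tau>"] that HT[of \<tau>] by (simp only: mem_Collect_eq)
      moreover have "(\<Prod>c<5. levi_civita (col (H \<tau>) c)) = (\<Prod>c<5. - levi_civita (col \<tau> c))"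
      proof (rule prod.cong[OF refl])
        fix c assume c: "c \<in> {..<5::nat}"
        have "col (H \<tau>) c k = transpose i j (col \<tau> c k)" if k: "k < 6" for k
        proof -
          obtain a b where ab: "column_cells c ! k = (a, b)" by force
          then have "a < 10" using slot_column_cells[of c k] c k by simp
          then show ?thesis by (simp add: ab H)
        qed
        then show "levi_civita (col (H \<tau>) c) = - levi_civita (col \<tau> c)"
          by (rule levi_civita_transpose[OF ij(1)])
      qed
      \<comment> \<open>Five columns, hence an odd number of sign changes.\<close>
      moreover have "(\<Prod>c<5. - levi_civita (col \<tau> c)) = - (\<Prod>c<5. levi_civita (col \<tau> c))"
        by (simp add: prod_uminus)
      ultimately show ?thesis by simp
    qed
    have "sum ?f {\<tau> \<in> ?T. y \<tau> = z} = sum (\<lambda>\<tau>. - ?f \<tau>) {\<tau> \<in> ?T. y \<tau> = z}"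
    proof (rule sum.reindex_bij_witness[of _ H H])
      fix \<tau> assume \<tau>: "\<tau> \<in> {\<tau> \<in> ?T. y \<tau> = z}"
      then have "\<tau> \<in> ?T" by (simp only: mem_Collect_eq)
      then show "H (H \<tau>) = \<tau>" "H (H \<tau>) = \<tau>" by (rule HH)+
      show "H \<tau> \<in> {\<tau> \<in> ?T. y \<tau> = z}" "H \<tau> \<in> {\<tau> \<in> ?T. y \<tau> = z}" using \<tau> by (rule HA)+
      show "- ?f (H \<tau>) = ?f \<tau>" unfolding fH[OF \<tau>] by (rule minus_minus)
    qed
    then have "sum ?f {\<tau> \<in> ?T. y \<tau> = z} = - sum ?f {\<tau> \<in> ?T. y \<tau> = z}"
      unfolding sum_negf .
    then show ?thesis by (rule eq_neg_imp_zero)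
  next
    case False
    have "(\<Prod>c<5. levi_civita (col \<tau> c)) = 0" if \<tau>: "\<tau> \<in> ?T" "y \<tau> = z" for \<tau>
    proof (rule ccontr)
      assume "(\<Prod>c<5. levi_civita (col \<tau> c)) \<noteq> 0"
      then have nz: "levi_civita (col \<tau> c) \<noteq> 0" if "c < 5" for c
        using that by auto
      \<comment> \<open>The labels from 2 on are counted by the block of their triple.\<close>
      define m where "m = (\<Sum>a\<in>{2..<10}. if fst (\<tau> a) < 3 then 1 else 0 :: nat)"
      define m' where "m' = (\<Sum>a\<in>{2..<10}. if fst (\<tau> a) < 3 then 0 else 1 :: nat)"
      have "m + m' = (\<Sum>a\<in>{2..<10::nat}. 1)"
        unfolding m_def m'_def sum.distrib[symmetric] by (rule sum.cong) auto
      then have mm: "m + m' = 8" by simp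
      \<comment> \<open>A nonzero sign puts each value exactly once into each of the five
        columns.\<close>
      have count: "n4 \<tau> v + n5 \<tau> v + (if v < 3 then m else m') = 5" if v: "v < 6" for v
      proof -
        have "(\<Sum>a<10. \<Sum>k<3. ?d (idx (\<tau> a) k) v) =
            (\<Sum>c<5. \<Sum>i<6. case column_cells c ! i of (a, k) \<Rightarrow> ?d (idx (\<tau> a) k) v)"
          by (rule sum_cells[of "\<lambda>c i a k. ?d (idx (\<tau> a) k) v"])
        also have "\<dots> = (\<Sum>c<5. \<Sum>i<6. ?d (col \<tau> c i) v)"
          by (intro sum.cong refl) (auto split: prod.splits)
        also have "\<dots> = (\<Sum>c<(5::nat). 1)"
        proof (rule sum.cong[OF refl])
          fix c assume c: "c \<in> {..<5::nat}"
          show "(\<Sum>i<6. ?d (col \<tau> c i) v) = 1"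
            by (rule levi_civita_nonzero_count[OF nz _ v]) (use c in \<open>auto intro: col_less[OF T6[OF \<tau>(1)]]\<close>)
        qed
        finally have total: "(\<Sum>a<10. \<Sum>k<3. ?d (idx (\<tau> a) k) v) = 5" by simp
        have "{..<10::nat} = insert 0 (insert 1 {2..<10})" by auto
        then have split: "(\<Sum>a<10. \<Sum>k<3. ?d (idx (\<tau> a) k) v) =
            (\<Sum>k<3. ?d (idx (\<tau> 0) k) v) + ((\<Sum>k<3. ?d (idx (\<tau> 1) k) v) + (\<Sum>a\<in>{2..<10}. \<Sum>k<3. ?d (idx (\<tau> a) k) v))"
          by simp
        have "(\<Sum>a\<in>{2..<10}. \<Sum>k<3. ?d (idx (\<tau> a) k) v) = (\<Sum>a\<in>{2..<10}. if v < 3 \<longleftrightarrow> fst (\<tau> a) < 3 then 1 else 0)"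
        proof (rule sum.cong[OF refl])
          fix a assume "a \<in> {2..<10::nat}"
          then have "\<tau> a \<in> block_triples" using PiE_mem[OF \<tau>(1), of a] by auto
          then show "(\<Sum>k<3. ?d (idx (\<tau> a) k) v) = (if v < 3 \<longleftrightarrow> fst (\<tau> a) < 3 then 1 else 0)"
            using v by (rule block_triples_count)
        qed
        also have "\<dots> = (if v < 3 then m else m')"
          by (cases "v < 3") (auto simp: m_def m'_def intro!: sum.cong)
        finally have rest: "(\<Sum>a\<in>{2..<10}. \<Sum>k<3. ?d (idx (\<tau> a) k) v) = (if v < 3 then m else m')" .
        have three: "(\<Sum>k<3. ?d (idx t k) v) = ?d (idx t 0) v + ?d (idx t 1) v + ?d (idx t 2) v" for t
          by (simp add: numeral_3_eq_3 numeral_2_eq_2)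
        show ?thesis
          using total[unfolded split rest, unfolded three] unfolding n4_def n5_def
          by (simp only: ac_simps)
      qed
      have dist: "z i \<noteq> z j" if "same_block i j" for i j
        using False that by blast
      have z: "z v = (n4 \<tau> v, n5 \<tau> v)" for v using \<tau>(2) by (auto simp: y_def)
      \<comment> \<open>The two components of \<open>z v\<close> add up to \<open>5 - m\<close> on
        the first block and to \<open>5 - m'\<close> on the second, and these totals add up to 2.
        Three different pairs for 0, 1, 2 need a total of at least 2, so the other total is 0 and
        the pairs of 3 and 4 agree.\<close>
      have "z 0 \<noteq> z 1" "z 0 \<noteq> z 2" "z 1 \<noteq> z 2" "z 3 \<noteq> z 4"
        by (intro dist; simp add: same_block_def)+
      then show False
        using count[of 0] count[of 1] count[of 2] count[of 3] count[of 4] mm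
        unfolding z prod.inject by simp
    qed
    then show ?thesis by (intro sum.neutral) auto
  qed
  have "Psixi x4 x5 (\<lambda>i j k. if (i, j, k) \<in> block_triples then 1 else 0) =
      Psi (\<lambda>a i j k. if (i, j, k) \<in> ?\<Theta> a then ?w a (i, j, k) else 0)"
    unfolding Psixi_def by (rule Psi_cong) (auto simp: with_xi_def)
  also have "\<dots> = sum ?f ?T"
    by (rule Psi_levi_civita) (simp add: fin_block)
  also have "\<dots> = (\<Sum>z\<in>y ` ?T. sum ?f {\<tau> \<in> ?T. y \<tau> = z})"
    by (rule sum.image_gen) (intro finite_PiE; simp add: fin_block)
  also have "\<dots> = 0"
    unfolding zero by simp
  finally show ?thesis .
qed

section \<open>Counting signed fillings\<close>

text \<open>
  A layered evaluation of the sum over all fillings: after each label, partial fillings that use up the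
  same values in all columns are merged. A column is the list of flags telling which values are still
  available; the flag in \<open>Res\<close> is the parity. Everything is defined by pattern matching, as
  \<open>code_simp\<close> would traverse the whole tree again at each \<open>if\<close> or \<open>case\<close>.
\<close>

datatype 'a res = Fail | Res bool 'a

fun flip :: "bool \<Rightarrow> bool \<Rightarrow> bool" where
  "flip True True = False" | "flip True False = True" | "flip False b = b"

fun cons_res :: "bool \<Rightarrow> 'a \<Rightarrow> 'a list res \<Rightarrow> 'a list res" where
  "cons_res b x Fail = Fail"
| "cons_res b x (Res s xs) = Res (flip b s) (x # xs)"

text \<open>The flag is the parity of the number of available values below \<open>x\<close>, the
  sign in a Laplace expansion along the row that holds \<open>x\<close>.\<close>

fun pick :: "nat \<Rightarrow> bool list \<Rightarrow> bool list res" where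
  "pick x [] = Fail"
| "pick 0 (True # bs) = Res False (False # bs)"
| "pick 0 (False # bs) = Fail"
| "pick (Suc x) (b # bs) = cons_res b b (pick x bs)"

text \<open>The pattern has one entry per column, \<open>None\<close> where the label does not meet
  the column.\<close>

fun place :: "nat option list \<Rightarrow> bool list list \<Rightarrow> bool list list res" and
  place_rest :: "bool list res \<Rightarrow> nat option list \<Rightarrow> bool list list \<Rightarrow> bool list list res" where
  "place [] cs = Res False cs"
| "place (p # ps) [] = Fail"
| "place (None # ps) (c # cs) = cons_res False c (place ps cs)"
| "place (Some x # ps) (c # cs) = place_rest (pick x c) ps cs"
| "place_rest Fail ps cs = Fail"
| "place_rest (Res s c) ps cs = cons_res s c (place ps cs)"

fun signed :: "bool \<Rightarrow> int \<Rightarrow> int" where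
  "signed True c = - c" | "signed False c = c"

lemma signed_if: "signed s c = (if s then - c else c)"
  by (cases s) simp_all

lemma flip_iff: "flip s s' \<longleftrightarrow> s \<noteq> s'"
  by (cases s; cases s') simp_all

datatype tree = Leaf | Val "bool list list" int | Node tree tree

fun merge :: "bool \<Rightarrow> bool list list \<Rightarrow> int \<Rightarrow> bool list list \<Rightarrow> int \<Rightarrow> tree" where
  "merge True st c st' c' = Val st (c + c')"
| "merge False st c st' c' = Node (Val st c) (Val st' c')"

text \<open>The path serves to bring equal states together. \<open>tree_value\<close> sums over all
  leaves, so the place of a state affects only how much is merged.\<close>

fun add :: "bool list \<Rightarrow> bool list list \<Rightarrow> int \<Rightarrow> tree \<Rightarrow> tree" where
  "add [] st c Leaf = Val st c"
| "add (True # bs) st c Leaf = Node (add bs st c Leaf) Leaf"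
| "add (False # bs) st c Leaf = Node Leaf (add bs st c Leaf)"
| "add bs st c (Val st' c') = merge (st = st') st c st' c'"
| "add [] st c (Node l r) = Node (add [] st c l) r"
| "add (True # bs) st c (Node l r) = Node (add bs st c l) r"
| "add (False # bs) st c (Node l r) = Node l (add bs st c r)"

fun add_res :: "bool list list res \<Rightarrow> int \<Rightarrow> tree \<Rightarrow> tree" where
  "add_res Fail c t = t"
| "add_res (Res s st) c t = add (concat st) st (signed s c) t"

fun spread :: "nat option list list \<Rightarrow> bool list list \<Rightarrow> int \<Rightarrow> tree \<Rightarrow> tree" where
  "spread [] st c t = t"
| "spread (p # ps) st c t = spread ps st c (add_res (place p st) c t)"

fun layer :: "nat option list list \<Rightarrow> tree \<Rightarrow> tree \<Rightarrow> tree" where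
  "layer ps Leaf t = t"
| "layer ps (Val st c) t = spread ps st c t"
| "layer ps (Node l r) t = layer ps r (layer ps l t)"

fun run :: "nat option list list list \<Rightarrow> tree \<Rightarrow> tree" where
  "run [] t = t"
| "run (ps # pss) t = run pss (layer ps t Leaf)"

fun tree_value :: "(bool list list \<Rightarrow> int) \<Rightarrow> tree \<Rightarrow> int" where
  "tree_value f Leaf = 0"
| "tree_value f (Val st c) = c * f st"
| "tree_value f (Node l r) = tree_value f l + tree_value f r"

fun res_val :: "('a \<Rightarrow> int) \<Rightarrow> 'a res \<Rightarrow> int" where
  "res_val f Fail = 0"
| "res_val f (Res s x) = signed s (f x)"

text \<open>The signed count of completions of a state, as the direct recursion that
  \<open>run\<close> evaluates with merging.\<close>

fun fillings :: "nat option list list list \<Rightarrow> bool list list \<Rightarrow> int" where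
  "fillings [] st = 1"
| "fillings (ps # pss) st = (\<Sum>p\<leftarrow>ps. res_val (fillings pss) (place p st))"

lemma tree_value_add: "tree_value f (add bs st c t) = tree_value f t + c * f st"
proof -
  have "tree_value f (merge b st c st' c') = c' * f st' + c * f st" if "b = (st = st')" for b st' c'
    using that by (cases b) (simp_all add: distrib_right)
  then show ?thesis by (induction bs st c t rule: add.induct) simp_all
qed

lemma tree_value_spread: "tree_value f (spread ps st c t) = tree_value f t + c * (\<Sum>p\<leftarrow>ps. res_val f (place p st))"
proof (induction ps st c t rule: spread.induct)
  case (2 p ps st c t)
  have "tree_value f (add_res r c t) = tree_value f t + c * res_val f r" for r
    by (cases r) (simp_all add: tree_value_add signed_if)
  then show ?case using 2 by (simp add: distrib_left)
qed simp

text \<open>\<open>fillings\<close> for the longer list is by definition the sum that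
  \<open>spread\<close> distributes over the tree, so moving one label into the tree preserves the
  total.\<close>

lemma tree_value_layer: "tree_value (fillings pss) (layer ps t u) = tree_value (fillings pss) u + tree_value (fillings (ps # pss)) t"
  by (induction ps t u rule: layer.induct) (simp_all add: tree_value_spread)

lemma tree_value_run: "tree_value (\<lambda>_. 1) (run pss t) = tree_value (fillings pss) t"
proof (induction pss arbitrary: t)
  case Nil
  show ?case by (induction t) simp_all
next
  case (Cons ps pss)
  then show ?case by (simp add: tree_value_layer del: fillings.simps)
qed

section \<open>Column signs computed label by label\<close>

fun list_sign :: "bool list \<Rightarrow> nat list \<Rightarrow> int" where
  "list_sign av [] = 1"
| "list_sign av (x # xs) = res_val (\<lambda>av'. list_sign av' xs) (pick x av)"

definition col_signs :: "bool list list \<Rightarrow> nat list list \<Rightarrow> int" where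
  "col_signs st ls = prod_list (map2 list_sign st ls)"

definition prepend :: "nat option list \<Rightarrow> nat list list \<Rightarrow> nat list list" where
  "prepend ps ls = map2 (\<lambda>p l. case p of None \<Rightarrow> l | Some x \<Rightarrow> x # l) ps ls"

lemma res_val_cons: "res_val f (cons_res b x r) = signed b (res_val (\<lambda>xs. f (x # xs)) r)"
  by (cases r) (simp_all add: signed_if flip_iff)

text \<open>Columns do not interact, so the values of one label can be picked first in all columns
  that it meets, with the product of the picking signs in front.\<close>

lemma col_signs_prepend:
  assumes "length ps = length st" "length ls = length st"
  shows "col_signs st (prepend ps ls) = res_val (\<lambda>st'. col_signs st' ls) (place ps st)"
  using assms
proof (induction ps arbitrary: st ls)
  case Nil
  then show ?case by (simp add: col_signs_def prepend_def)
next
  case (Cons p ps)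
  obtain c cs where st: "st = c # cs" using Cons.prems by (cases st) auto
  obtain l ls' where ls: "ls = l # ls'" using Cons.prems st by (cases ls) auto
  have IH: "col_signs cs (prepend ps ls') = res_val (\<lambda>st'. col_signs st' ls') (place ps cs)"
    using Cons st ls by simp
  have step: "col_signs (c # cs) (l # ls) = list_sign c l * col_signs cs ls" for c l cs ls
    by (simp add: col_signs_def)
  have factor: "res_val (\<lambda>st'. a * f st') r = a * res_val f r" for a f and r :: "bool list list res"
    by (cases r) (simp_all add: signed_if)
  show ?case
  proof (cases p)
    case None
    then have "col_signs st (prepend (p # ps) ls) = list_sign c l * col_signs cs (prepend ps ls')"
      by (simp add: st ls prepend_def step)
    then show ?thesis
      by (simp add: None st ls res_val_cons step IH factor)
  next
    case (Some x)
    then have "col_signs st (prepend (p # ps) ls) = list_sign c (x # l) * col_signs cs (prepend ps ls')"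
      by (simp add: st ls prepend_def step)
    then show ?thesis
      by (cases "pick x c") (simp_all add: Some st ls res_val_cons step IH factor signed_if)
  qed
qed


lemma sum_PiE_insert:
  assumes "a \<notin> S"
  shows "(\<Sum>\<tau>\<in>PiE (insert a S) \<Theta>. g \<tau>) = (\<Sum>t\<in>\<Theta> a. \<Sum>\<tau>\<in>PiE S \<Theta>. g (\<tau>(a := t)) :: int)"
proof -
  have "(\<Sum>\<tau>\<in>PiE (insert a S) \<Theta>. g \<tau>) = (\<Sum>(t, \<tau>)\<in>\<Theta> a \<times> PiE S \<Theta>. g (\<tau>(a := t)))"
    unfolding PiE_insert_eq
    by (subst sum.reindex[OF inj_combinator[OF assms]]) (simp add: case_prod_unfold)
  then show ?thesis by (simp add: sum.cartesian_product)
qed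

text \<open>A merge along the columns \<open>c\<close>, \<open>c + 1\<close> and so on; it relies on
  \<open>cs\<close> being increasing, as are all lists in \<open>columns_of\<close>.\<close>

fun pattern :: "nat \<Rightarrow> nat list \<Rightarrow> nat list \<Rightarrow> nat \<Rightarrow> nat option list" where
  "pattern c cs xs 0 = []"
| "pattern c cs xs (Suc k) = (case cs of [] \<Rightarrow> None # pattern (Suc c) cs xs k | c' # cs' \<Rightarrow>
     if c = c' then Some (hd xs) # pattern (Suc c) cs' (tl xs) k else None # pattern (Suc c) cs xs k)"

definition label_pattern :: "nat \<Rightarrow> nat \<times> nat \<times> nat \<Rightarrow> nat option list" where
  "label_pattern a t = pattern 0 (columns_of ! a) [idx t 0, idx t 1, idx t 2] 5"

lemma length_pattern: "length (pattern c cs xs k) = k"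
  by (induction c cs xs k rule: pattern.induct) (simp_all split: list.splits)

lemma cons_res_Res: "cons_res b x r = Res s ys \<Longrightarrow> \<exists>s' xs. r = Res s' xs \<and> ys = x # xs"
  by (cases r) auto

lemma length_place: "place ps st = Res s st' \<Longrightarrow> length st' = length st"
  and length_place_rest: "place_rest r ps st = Res s st' \<Longrightarrow> length st' = Suc (length st)"
  by (induction ps st and r ps st arbitrary: s st' and s st' rule: place_place_rest.induct)
    (auto dest!: cons_res_Res)

fun fill :: "nat list \<Rightarrow> (nat \<Rightarrow> nat \<times> nat \<times> nat) \<Rightarrow> nat list list" where
  "fill [] \<tau> = replicate 5 []"
| "fill (a # as) \<tau> = prepend (label_pattern a (\<tau> a)) (fill as \<tau>)"

lemma length_fill: "length (fill as \<tau>) = 5"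
  by (induction as) (simp_all add: prepend_def label_pattern_def length_pattern)

lemma fill_upd: "a \<notin> set as \<Longrightarrow> fill as (\<tau>(a := t)) = fill as \<tau>"
  by (induction as) simp_all

text \<open>Splitting off the choice at the first label and moving it through the signs by
  \<open>col_signs_prepend\<close> reproduces the recursion of \<open>fillings\<close>.\<close>

lemma sum_fill:
  assumes "distinct as" "\<And>a. distinct (ent a)" "length st = 5"
  shows "(\<Sum>\<tau>\<in>PiE (set as) (\<lambda>a. set (ent a)). col_signs st (fill as \<tau>)) =
    fillings (map (\<lambda>a. map (label_pattern a) (ent a)) as) st"
  using assms(1,3)
proof (induction as arbitrary: st)
  case Nil
  then show ?case by (simp add: col_signs_def numeral_eq_Suc length_Suc_conv) (auto simp: length_Suc_conv)
next
  case (Cons a as)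
  let ?P = "PiE (set as) (\<lambda>a. set (ent a))"
  have res_sum: "(\<Sum>\<tau>\<in>?P. res_val (\<lambda>st'. f \<tau> st') r) = res_val (\<lambda>st'. \<Sum>\<tau>\<in>?P. f \<tau> st') r"
    for f and r :: "bool list list res"
    by (cases r) (simp_all add: signed_if sum_negf)
  have "(\<Sum>\<tau>\<in>PiE (set (a # as)) (\<lambda>a. set (ent a)). col_signs st (fill (a # as) \<tau>)) =
      (\<Sum>t\<in>set (ent a). \<Sum>\<tau>\<in>?P. col_signs st (prepend (label_pattern a t) (fill as \<tau>)))"
    using Cons.prems(1) by (simp add: sum_PiE_insert fill_upd)
  also have "\<dots> = (\<Sum>t\<in>set (ent a). res_val (\<lambda>st'. \<Sum>\<tau>\<in>?P. col_signs st' (fill as \<tau>)) (place (label_pattern a t) st))"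
    using Cons.prems(2)
    by (simp add: col_signs_prepend length_fill length_pattern label_pattern_def res_sum)
  also have "\<dots> = (\<Sum>t\<in>set (ent a). res_val (fillings (map (\<lambda>a. map (label_pattern a) (ent a)) as)) (place (label_pattern a t) st))"
  proof (rule sum.cong[OF refl])
    fix t
    show "res_val (\<lambda>st'. \<Sum>\<tau>\<in>?P. col_signs st' (fill as \<tau>)) (place (label_pattern a t) st) =
        res_val (fillings (map (\<lambda>a. map (label_pattern a) (ent a)) as)) (place (label_pattern a t) st)"
      using Cons.IH Cons.prems length_place[of "label_pattern a t" st]
      by (cases "place (label_pattern a t) st") simp_all
  qed
  also have "\<dots> = fillings (map (\<lambda>a. map (label_pattern a) (ent a)) (a # as)) st"
    using assms(2) by (simp add: sum_list_distinct_conv_sum_set o_def)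
  finally show ?case .
qed

section \<open>Comparison of the picking signs with determinants\<close>

fun avail :: "nat \<Rightarrow> bool list \<Rightarrow> nat list" where
  "avail k [] = []"
| "avail k (b # bs) = (if b then [k] else []) @ avail (Suc k) bs"

lemma avail_ge: "x \<in> set (avail k bs) \<Longrightarrow> k \<le> x"
  by (induction k bs rule: avail.induct) (auto split: if_splits dest: Suc_leD)

lemma distinct_avail: "distinct (avail k bs)"
  by (induction k bs rule: avail.induct) (auto dest: avail_ge)

lemma pick_Fail: "pick x bs = Fail \<Longrightarrow> k + x \<notin> set (avail k bs)"
proof (induction x bs arbitrary: k rule: pick.induct)
  case (2 bs)
  then show ?case by simp
next
  case (3 bs)
  then show ?case by (auto dest: avail_ge)
next
  case (4 x b bs)
  then show ?case using "4.IH"[of "Suc k"] by (cases "pick x bs") auto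
qed simp

text \<open>The index \<open>p\<close> is the column of the value in the matrix that remains, so the
  flag is the cofactor sign.\<close>

lemma pick_Res:
  assumes "pick x bs = Res s bs'"
  shows "\<exists>p<length (avail k bs). avail k bs ! p = k + x \<and> (s \<longleftrightarrow> odd p) \<and>
    avail k bs' = take p (avail k bs) @ drop (Suc p) (avail k bs)"
  using assms
proof (induction x bs arbitrary: k s bs' rule: pick.induct)
  case (2 bs)
  then show ?case by (intro exI[of _ 0]) auto
next
  case (4 x b bs)
  then obtain s' cs where r: "pick x bs = Res s' cs" by (cases "pick x bs") auto
  obtain p where p: "p < length (avail (Suc k) bs)" "avail (Suc k) bs ! p = Suc k + x" "s' \<longleftrightarrow> odd p"
    "avail (Suc k) cs = take p (avail (Suc k) bs) @ drop (Suc p) (avail (Suc k) bs)"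
    using "4.IH"[OF r, of "Suc k"] by blast
  show ?case
  proof (cases b)
    case True
    then show ?thesis using 4 p r by (intro exI[of _ "Suc p"]) (auto simp: flip_iff)
  next
    case False
    then show ?thesis using 4 p r by (intro exI[of _ p]) (auto simp: flip_iff)
  qed
qed auto

lemma det_fill:
  "length (avail 0 av) = length xs \<Longrightarrow>
    det (mat (length xs) (length xs) (\<lambda>(i, j). if xs ! i = avail 0 av ! j then 1 else 0)) =
    complex_of_int (list_sign av xs)"
proof (induction xs arbitrary: av)
  case Nil
  then show ?case by simp
next
  case (Cons x xs)
  let ?us = "avail 0 av" and ?k = "length xs"
  let ?A = "mat (Suc ?k) (Suc ?k) (\<lambda>(i, j). if (x # xs) ! i = ?us ! j then 1 else 0 :: complex)"
  have laplace: "det ?A = (\<Sum>j<Suc ?k. (if x = ?us ! j then 1 else 0) * cofactor ?A 0 j)"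
    by (subst laplace_expansion_row[of _ "Suc ?k" 0]) auto
  show ?case
  proof (cases "pick x av")
    case Fail
    then have "x \<notin> set ?us" using pick_Fail[of x av 0] by simp
    then have "det ?A = 0"
      unfolding laplace using Cons.prems by (intro sum.neutral) (auto simp: in_set_conv_nth)
    then show ?thesis using Fail by simp
  next
    case (Res s av')
    obtain p where p: "p < length ?us" "?us ! p = x" "s \<longleftrightarrow> odd p"
      "avail 0 av' = take p ?us @ drop (Suc p) ?us"
      using pick_Res[OF Res, of 0] by auto
    have len: "length (avail 0 av') = length xs" using p(1,4) Cons.prems by simp
    have "x = ?us ! j \<longleftrightarrow> j = p" if "j < Suc ?k" for j
      using that p(1,2) Cons.prems distinct_avail[of 0 av] by (metis length_Cons nth_eq_iff_index_eq)
    then have "det ?A = (\<Sum>j<Suc ?k. if j = p then cofactor ?A 0 j else 0)"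
      unfolding laplace by (intro sum.cong) auto
    also have "\<dots> = cofactor ?A 0 p" using p(1) Cons.prems by simp
    also have "\<dots> = (-1) ^ p * det (mat_delete ?A 0 p)" by (simp add: cofactor_def)
    also have "mat_delete ?A 0 p = mat ?k ?k (\<lambda>(i, j). if xs ! i = avail 0 av' ! j then 1 else 0)"
      using p(1,4) Cons.prems by (intro eq_matI) (auto simp: mat_delete_def nth_append)
    also have "det \<dots> = of_int (list_sign av' xs)" by (rule Cons.IH[OF len])
    finally show ?thesis using Res p(3) by (simp add: signed_if)
  qed
qed

lemma levi_civita_list_sign: "levi_civita v = of_int (list_sign [True, True, True, True, True, True] (map v [0..<6]))"
proof -
  have "levi_civita v = det (mat 6 6 (\<lambda>(i, j). if map v [0..<6] ! i = avail 0 [True, True, True, True, True, True] ! j then 1 else 0))"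
    unfolding levi_civita_def det6_def
    by (intro arg_cong[where f = det] cong_mat) (auto simp: less_numeral_cases(3))
  then show ?thesis
    using det_fill[of "[True, True, True, True, True, True]" "map v [0..<6]"] by simp
qed

section \<open>Weight, unipotent invariance and a nonzero value\<close>

definition unit_row :: "nat \<Rightarrow> nat \<Rightarrow> complex" where
  "unit_row m j = (if j = m then 1 else 0)"

text \<open>For singular \<open>Y\<close>, column 0 gives 0. Otherwise the unit rows are the
  pullbacks of the rows 4 and 5 of the inverse \<open>X\<close>, and equivariance reduces the claim
  to \<open>Psixi_two_triples\<close> with these rows as \<open>x4\<close>,
  \<open>x5\<close>.\<close>

lemma Psixi_pull_two_triples:
  "Psixi (unit_row 4) (unit_row 5) (pull Y (\<lambda>i j k. if (i, j, k) \<in> block_triples then 1 else 0)) = 0"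
proof (cases "det6 Y = 0")
  case True
  then show ?thesis by (rule Psixi_pull_singular)
next
  case False
  obtain X where X: "\<And>i j. i < 6 \<Longrightarrow> j < 6 \<Longrightarrow> (\<Sum>r<6. X i r * Y r j) = (if i = j then 1 else 0)"
    using det6_inverse[OF False] by blast
  have "Psixi (unit_row 4) (unit_row 5) (pull Y (\<lambda>i j k. if (i, j, k) \<in> block_triples then 1 else 0)) =
      Psixi (pull1 Y (X 4)) (pull1 Y (X 5)) (pull Y (\<lambda>i j k. if (i, j, k) \<in> block_triples then 1 else 0))"
    by (rule Psixi_cong) (simp_all add: pull1_def X unit_row_def)
  then show ?thesis by (simp add: Psixi_pull Psixi_two_triples)
qed

text \<open>The fifth power of the determinant gives exponent 5 throughout; the two factors
  \<open>x4\<close> and four factors \<open>x5\<close> take away \<open>a 4 ^ 2\<close> and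
  \<open>a 5 ^ 4\<close>.\<close>

lemma Psixi_torus:
  assumes "a 4 \<noteq> 0" "a 5 \<noteq> 0"
  shows "Psixi (unit_row 4) (unit_row 5) (pull (\<lambda>p i. if p = i then a i else 0) Z) =
    (a 0 ^ 5 * a 1 ^ 5 * a 2 ^ 5 * a 3 ^ 5 * a 4 ^ 3 * a 5) * Psixi (unit_row 4) (unit_row 5) Z"
proof -
  let ?M = "\<lambda>p i. if p = i then a i else 0"
  have det: "det6 ?M = a 0 * a 1 * a 2 * a 3 * a 4 * a 5"
    by (subst det6_upper_triangular) (simp_all add: numeral_eq_Suc lessThan_Suc)
  have row: "pull1 ?M (unit_row m) j = a m * unit_row m j" if "m < 6" for m j
    using that by (simp add: pull1_def unit_row_def if_distrib[of "\<lambda>x. x * _"] cong: if_cong)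
  have split4: "a 4 ^ 5 = a 4 ^ 2 * a 4 ^ 3" and split5: "a 5 ^ 5 = a 5 ^ 4 * a 5"
    by (simp_all flip: power_add power_Suc2)
  have "det6 ?M ^ 5 * Psixi (unit_row 4) (unit_row 5) Z = Psixi (pull1 ?M (unit_row 4)) (pull1 ?M (unit_row 5)) (pull ?M Z)"
    by (rule Psixi_pull[symmetric])
  also have "\<dots> = Psixi (\<lambda>j. a 4 * unit_row 4 j) (\<lambda>j. a 5 * unit_row 5 j) (pull ?M Z)"
    by (rule Psixi_cong) (simp_all add: row)
  also have "\<dots> = a 4 ^ 2 * a 5 ^ 4 * Psixi (unit_row 4) (unit_row 5) (pull ?M Z)"
    by (rule Psixi_scale)
  finally have "a 4 ^ 2 * a 5 ^ 4 * Psixi (unit_row 4) (unit_row 5) (pull ?M Z) =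
      a 4 ^ 2 * a 5 ^ 4 * ((a 0 ^ 5 * a 1 ^ 5 * a 2 ^ 5 * a 3 ^ 5 * a 4 ^ 3 * a 5) * Psixi (unit_row 4) (unit_row 5) Z)"
    unfolding det power_mult_distrib split4 split5 by (simp only: ac_simps)
  then show ?thesis using assms by simp
qed

text \<open>\<open>M\<close> has determinant 1, fixes the functional \<open>unit_row 5\<close> and
  adds a multiple of it to \<open>unit_row 4\<close>, which \<open>Psixi_add\<close>
  absorbs.\<close>

lemma Psixi_unipotent:
  assumes diag: "\<And>i. i < 6 \<Longrightarrow> M i i = 1" and low: "\<And>i j. i < 6 \<Longrightarrow> j < i \<Longrightarrow> M i j = 0"
  shows "Psixi (unit_row 4) (unit_row 5) (pull M Z) = Psixi (unit_row 4) (unit_row 5) Z"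
proof -
  have det: "det6 M = 1"
    by (subst det6_upper_triangular) (simp_all add: diag low)
  have row: "pull1 M (unit_row m) j = M m j" if "m < 6" for m j
    using that by (simp add: pull1_def unit_row_def if_distrib[of "\<lambda>x. x * _"] cong: if_cong)
  have "Psixi (unit_row 4) (unit_row 5) Z = Psixi (pull1 M (unit_row 4)) (pull1 M (unit_row 5)) (pull M Z)"
    by (simp add: Psixi_pull det)
  also have "\<dots> = Psixi (\<lambda>j. unit_row 4 j + M 4 5 * unit_row 5 j) (unit_row 5) (pull M Z)"
    by (rule Psixi_cong) (auto simp: row unit_row_def less_numeral_cases(3) diag low)
  also have "\<dots> = Psixi (unit_row 4) (unit_row 5) (pull M Z)"
    by (rule Psixi_add)
  finally show ?thesis by simp
qed

text \<open>The support of the polarisation of the cubic \<open>z\<close> in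
  \<open>hw_poly_nonzero\<close>.\<close>

definition witness_entries :: "(nat \<times> nat \<times> nat) list" where
  "witness_entries = [(1,2,4),(1,4,2),(2,1,4),(2,4,1),(4,1,2),(4,2,1),
    (0,3,5),(0,5,3),(3,0,5),(3,5,0),(5,0,3),(5,3,0),
    (2,3,3),(3,2,3),(3,3,2),(0,0,1),(0,1,0),(1,0,0)]"

text \<open>The single triples at labels 0 and 1 come from \<open>with_xi\<close> with the unit rows
  4 and 5.\<close>

definition label_entries :: "nat \<Rightarrow> (nat \<times> nat \<times> nat) list" where
  "label_entries a = (if a = 0 then [(5,4,5)] else if a = 1 then [(5,5,4)] else witness_entries)"

text \<open>The full sum has \<open>18 ^ 8\<close> terms; \<open>tree_value_run\<close> replaces it
  by the merged layers of \<open>run\<close>, which are evaluated.\<close>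

lemma fillings_value:
  "fillings (map (\<lambda>a. map (label_pattern a) (label_entries a)) [0,1,2,3,4,5,6,7,8,9]) (replicate 5 (replicate 6 True)) = 3360"
proof -
  have "tree_value (\<lambda>_. 1) (run (map (\<lambda>a. map (label_pattern a) (label_entries a)) [0,1,2,3,4,5,6,7,8,9]) (Val (replicate 5 (replicate 6 True)) 1)) = 3360"
    by code_simp
  then show ?thesis by (simp only: tree_value_run tree_value.simps mult_1)
qed

lemma label_pattern_simps:
  "label_pattern 0 t = [None, Some (idx t 0), None, Some (idx t 1), Some (idx t 2)]"
  "label_pattern 1 t = [None, None, Some (idx t 0), Some (idx t 1), Some (idx t 2)]"
  "label_pattern (Suc 0) t = [None, None, Some (idx t 0), Some (idx t 1), Some (idx t 2)]"
  "label_pattern 2 t = [None, Some (idx t 0), Some (idx t 1), Some (idx t 2), None]"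
  "label_pattern 3 t = [Some (idx t 0), Some (idx t 1), None, Some (idx t 2), None]"
  "label_pattern 4 t = [Some (idx t 0), None, Some (idx t 1), Some (idx t 2), None]"
  "label_pattern 5 t = [Some (idx t 0), None, None, Some (idx t 1), Some (idx t 2)]"
  "label_pattern 6 t = [Some (idx t 0), Some (idx t 1), Some (idx t 2), None, None]"
  "label_pattern 7 t = [Some (idx t 0), Some (idx t 1), None, None, Some (idx t 2)]"
  "label_pattern 8 t = [Some (idx t 0), None, Some (idx t 1), None, Some (idx t 2)]"
  "label_pattern 9 t = [None, Some (idx t 0), Some (idx t 1), None, Some (idx t 2)]"
  by (simp_all add: label_pattern_def columns_of_def numeral_eq_Suc)

lemma upt_5_6: "[0..<5] = [0, 1, 2, 3, 4]" "[0..<6] = [0, 1, 2, 3, 4, 5]"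
  by (simp_all add: upt_rec)

lemma replicate_5: "replicate 5 x = [x, x, x, x, x]"
  by (simp add: numeral_eq_Suc)

text \<open>Prepending label by label lists each column in the order of \<open>column_cells\<close>,
  which is the order of the labels.\<close>

lemma fill_all: "fill [0,1,2,3,4,5,6,7,8,9] \<tau> = map (\<lambda>c. map (col \<tau> c) [0..<6]) [0..<5]"
  unfolding upt_5_6 by (simp add: prepend_def label_pattern_simps replicate_5 column_cells_simps)

text \<open>All entries on the supports are 1, so the value is a signed number of fillings, which
  \<open>sum_fill\<close> reduces to \<open>fillings_value\<close>.\<close>

lemma Psixi_nonzero: "Psixi (unit_row 4) (unit_row 5) (\<lambda>i j k. if (i, j, k) \<in> set witness_entries then 1 else 0) = 3360"
proof -
  let ?av = "[True, True, True, True, True, True]"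
  let ?\<Theta> = "\<lambda>a. set (label_entries a)"
  have "Psixi (unit_row 4) (unit_row 5) (\<lambda>i j k. if (i, j, k) \<in> set witness_entries then 1 else 0) =
      Psi (\<lambda>a i j k. if (i, j, k) \<in> ?\<Theta> a then 1 else 0)"
    unfolding Psixi_def by (rule Psi_cong) (auto simp: with_xi_def unit_row_def label_entries_def)
  also have "\<dots> = (\<Sum>\<tau>\<in>PiE {..<10} ?\<Theta>. (\<Prod>a<(10::nat). 1) * (\<Prod>c<5. levi_civita (col \<tau> c)))"
    by (rule Psi_levi_civita) simp
  also have "\<dots> = of_int (\<Sum>\<tau>\<in>PiE (set [0,1,2,3,4,5,6,7,8,9]) ?\<Theta>. col_signs (replicate 5 ?av) (fill [0,1,2,3,4,5,6,7,8,9] \<tau>))"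
    unfolding of_int_sum
  proof (rule sum.cong)
    show "PiE {..<10} ?\<Theta> = PiE (set [0,1,2,3,4,5,6,7,8,9]) ?\<Theta>"
      by (intro arg_cong[where f = "\<lambda>A. PiE A ?\<Theta>"]) auto
    fix \<tau> :: "nat \<Rightarrow> nat \<times> nat \<times> nat"
    show "(\<Prod>a<(10::nat). 1) * (\<Prod>c<5. levi_civita (col \<tau> c)) = of_int (col_signs (replicate 5 ?av) (fill [0,1,2,3,4,5,6,7,8,9] \<tau>))"
    proof -
      have five: "{..<5::nat} = {0, 1, 2, 3, 4}" by auto
      show ?thesis
        unfolding fill_all levi_civita_list_sign col_signs_def replicate_5 upt_5_6(1) five
        by (simp del: list_sign.simps upt_Suc)
    qed
  qed
  also have "(\<Sum>\<tau>\<in>PiE (set [0,1,2,3,4,5,6,7,8,9]) ?\<Theta>. col_signs (replicate 5 ?av) (fill [0,1,2,3,4,5,6,7,8,9] \<tau>)) = 3360"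
    by (subst sum_fill) (use fillings_value in \<open>simp_all add: label_entries_def witness_entries_def numeral_eq_Suc\<close>)
  finally show ?thesis by simp
qed

section \<open>Cubic forms and their polarisations\<close>

abbreviation fscale :: "complex \<Rightarrow> ('a \<Rightarrow> complex) \<Rightarrow> 'a \<Rightarrow> complex" where
  "fscale \<equiv> fun_scale (*)"

interpretation fn: vector_space "fscale :: complex \<Rightarrow> ('a \<Rightarrow> complex) \<Rightarrow> 'a \<Rightarrow> complex"
  by (rule vector_space_fun_scale) (unfold_locales; simp add: algebra_simps)

lemma fscale_apply [simp]: "fscale c f x = c * f x"
  by (simp add: fun_scale_def)

text \<open>The third difference at 0, up to the term \<open>z 0\<close>, which is 0 for cubics. It
  is not normalised: for a cubic, \<open>pol z v v v\<close> is six times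
  \<open>z v\<close>.\<close>

definition pol :: "('v::ab_group_add \<Rightarrow> complex) \<Rightarrow> 'v \<Rightarrow> 'v \<Rightarrow> 'v \<Rightarrow> complex" where
  "pol z u v w = z (u + v + w) - z (u + v) - z (u + w) - z (v + w) + z u + z v + z w"

lemma pol_commute: "pol z u v w = pol z v u w" "pol z u v w = pol z u w v"
  by (simp_all add: pol_def ac_simps)

lemma pol_rotate: "pol z u v w = pol z w u v"
  by (simp add: pol_def ac_simps)

lemma pol_add: "pol (z + z') u v w = pol z u v w + pol z' u v w"
  by (simp add: pol_def algebra_simps)

lemma pol_scale: "pol (fscale c z) u v w = c * pol z u v w"
  by (simp add: pol_def algebra_simps)

lemma dual_spaceD:
  assumes "l \<in> dual_space s UNIV"
  shows "l (x + y) = l x + l y" "l (s c x) = c * l x"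
  using assms by (auto simp: dual_space_def)

lemma subspace_hom_poly: "fn.subspace (hom_poly s W d)"
  unfolding hom_poly_def by (rule fn.subspace_span)

locale complex_space = vector_space s for s :: "complex \<Rightarrow> 'v::ab_group_add \<Rightarrow> 'v"
begin

abbreviation cubics :: "('v \<Rightarrow> complex) set" where
  "cubics \<equiv> hom_poly s UNIV 3"

text \<open>The permanent of the three forms at the three arguments.\<close>

lemma pol_form_prod:
  assumes "\<forall>i<3. l i \<in> dual_space s UNIV"
  shows "pol (form_prod UNIV 3 l) u v w =
    l 0 u * l 1 v * l 2 w + l 0 u * l 2 v * l 1 w + l 1 u * l 0 v * l 2 w +
    l 1 u * l 2 v * l 0 w + l 2 u * l 0 v * l 1 w + l 2 u * l 1 v * l 0 w"
proof -
  have "l 0 \<in> dual_space s UNIV" "l 1 \<in> dual_space s UNIV" "l 2 \<in> dual_space s UNIV"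
    using assms by simp_all
  note add = this[THEN dual_spaceD(1)]
  have prod: "form_prod UNIV 3 l x = l 0 x * l 1 x * l 2 x" for x
    by (simp add: form_prod_def numeral_3_eq_3 numeral_2_eq_2)
  show ?thesis
    unfolding pol_def prod add by (simp add: algebra_simps)
qed

lemma cubics_induct [consumes 1, case_names zero step]:
  assumes "z \<in> cubics" "P 0"
    "\<And>c l z. \<forall>i<3. l i \<in> dual_space s UNIV \<Longrightarrow> P z \<Longrightarrow> P (fscale c (form_prod UNIV 3 l) + z)"
  shows "P z"
  using assms(1) unfolding hom_poly_def
proof (induction rule: fn.span_induct_alt)
  case base
  show ?case by (rule assms(2))
next
  case (step c x y)
  then show ?case using assms(3) by blast
qed

text \<open>\<open>pol\<close> is linear in \<open>z\<close>, so products of linear forms suffice.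
  The other arguments are reached by symmetry.\<close>

lemma pol_linear:
  assumes "z \<in> cubics"
  shows "pol z (u + u') v w = pol z u v w + pol z u' v w" "pol z (s c u) v w = c * pol z u v w"
proof -
  have "(\<forall>u u' v w c. pol z (u + u') v w = pol z u v w + pol z u' v w \<and> pol z (s c u) v w = c * pol z u v w)"
    using assms
  proof (induction rule: cubics_induct)
    case zero
    show ?case by (simp add: pol_def)
  next
    case (step c l z)
    have "l 0 \<in> dual_space s UNIV" "l 1 \<in> dual_space s UNIV" "l 2 \<in> dual_space s UNIV"
      using step.hyps by simp_all
    note dual = this[THEN dual_spaceD(1)] this[THEN dual_spaceD(2)]
    show ?case
      using step.IH unfolding pol_add pol_scale pol_form_prod[OF step.hyps] dual
      by (simp add: algebra_simps)
  qed
  then show "pol z (u + u') v w = pol z u v w + pol z u' v w" "pol z (s c u) v w = c * pol z u v w"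
    by auto
qed

lemma pol_sum:
  assumes "z \<in> cubics"
  shows "pol z (\<Sum>i\<in>I. s (a i) (x i)) v w = (\<Sum>i\<in>I. a i * pol z (x i) v w)"
proof (induction I rule: infinite_finite_induct)
  case (insert i I)
  then show ?case by (simp add: pol_linear[OF assms])
qed (use pol_linear(2)[OF assms, of 0 0] in simp_all)

lemma pol_sum3:
  assumes "z \<in> cubics"
  shows "pol z (\<Sum>i\<in>I. s (a i) (x i)) (\<Sum>j\<in>J. s (b j) (y j)) (\<Sum>k\<in>K. s (c k) (w k)) =
    (\<Sum>(i, j, k)\<in>I \<times> J \<times> K. pol z (x i) (y j) (w k) * (a i * b j * c k))"
proof -
  have second: "pol z u (\<Sum>j\<in>J. s (b j) (y j)) v = (\<Sum>j\<in>J. b j * pol z u (y j) v)" for u v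
    by (simp add: pol_commute(1)[of z u] pol_sum[OF assms])
  have third: "pol z u v (\<Sum>k\<in>K. s (c k) (w k)) = (\<Sum>k\<in>K. c k * pol z u v (w k))" for u v
    by (simp only: pol_rotate[of z u v] pol_sum[OF assms])
  have "pol z (\<Sum>i\<in>I. s (a i) (x i)) (\<Sum>j\<in>J. s (b j) (y j)) (\<Sum>k\<in>K. s (c k) (w k)) =
      (\<Sum>i\<in>I. a i * (\<Sum>j\<in>J. b j * (\<Sum>k\<in>K. c k * pol z (x i) (y j) (w k))))"
    unfolding pol_sum[OF assms] unfolding second unfolding third by (rule refl)
  also have "\<dots> = (\<Sum>(i, j, k)\<in>I \<times> J \<times> K. pol z (x i) (y j) (w k) * (a i * b j * c k))"
    by (simp add: sum.cartesian_product[symmetric] sum_distrib_left ac_simps)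
  finally show ?thesis .
qed

lemma cubics_comp:
  assumes "Vector_Spaces.linear s s g" "z \<in> cubics"
  shows "z \<circ> g \<in> cubics"
  using assms(2)
proof (induction rule: cubics_induct)
  case zero
  have "(0 :: 'v \<Rightarrow> complex) \<circ> g = 0" by (simp add: fun_eq_iff)
  then show ?case using fn.subspace_0[OF subspace_hom_poly] by (simp only:)
next
  case (step c l z)
  interpret g: Vector_Spaces.linear s s g by fact
  have "form_prod UNIV 3 l \<circ> g = form_prod UNIV 3 (\<lambda>i. l i \<circ> g)"
    by (auto simp: form_prod_def)
  moreover have "l i \<circ> g \<in> dual_space s UNIV" if "i < 3" for i
    using step.hyps that by (auto simp: dual_space_def g.add g.scale)
  ultimately have "form_prod UNIV 3 l \<circ> g \<in> cubics"
    unfolding hom_poly_def by (intro fn.span_base) auto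
  moreover have "(fscale c (form_prod UNIV 3 l) + z) \<circ> g = fscale c (form_prod UNIV 3 l \<circ> g) + (z \<circ> g)"
    by (auto simp: fun_eq_iff)
  ultimately show ?case
    using step.IH fn.subspace_add[OF subspace_hom_poly fn.subspace_scale[OF subspace_hom_poly]]
    by (simp only:)
qed

lemma GLD: "g \<in> GL s \<Longrightarrow> Vector_Spaces.linear s s g" "g \<in> GL s \<Longrightarrow> bij g"
  by (auto simp: GL_def End_def)

lemma GL_comp: "g \<in> GL s \<Longrightarrow> h \<in> GL s \<Longrightarrow> g \<circ> h \<in> GL s"
  by (auto simp: GL_def End_def intro: bij_comp Vector_Spaces.linear_compose)

lemma GL_inv: "g \<in> GL s \<Longrightarrow> Hilbert_Choice.inv g \<in> GL s"
proof -
  assume g: "g \<in> GL s"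
  interpret g: Vector_Spaces.linear s s g using GLD(1)[OF g] .
  have [simp]: "g (Hilbert_Choice.inv g x) = x" "Hilbert_Choice.inv g (g x) = x" for x
    using GLD(2)[OF g] by (simp_all add: bij_is_surj surj_f_inv_f bij_is_inj inv_f_f)
  have "Hilbert_Choice.inv g (x + y) = Hilbert_Choice.inv g x + Hilbert_Choice.inv g y" for x y
    using g.add[of "Hilbert_Choice.inv g x" "Hilbert_Choice.inv g y"] by (metis \<open>\<And>x. g (Hilbert_Choice.inv g x) = x\<close> \<open>\<And>x. Hilbert_Choice.inv g (g x) = x\<close>)
  moreover have "Hilbert_Choice.inv g (s c x) = s c (Hilbert_Choice.inv g x)" for c x
    using g.scale[of c "Hilbert_Choice.inv g x"] by (metis \<open>\<And>x. g (Hilbert_Choice.inv g x) = x\<close> \<open>\<And>x. Hilbert_Choice.inv g (g x) = x\<close>)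
  ultimately have "Vector_Spaces.linear s s (Hilbert_Choice.inv g)"
    by unfold_locales
  then show "Hilbert_Choice.inv g \<in> GL s"
    using GLD(2)[OF g] by (simp add: GL_def End_def bij_imp_bij_inv)
qed

text \<open>Polynomials are extended by 0 outside \<open>cubics\<close>; this makes the action
  compatible with the extension.\<close>

lemma cubics_comp_GL_iff:
  assumes "g \<in> GL s"
  shows "z \<circ> g \<in> cubics \<longleftrightarrow> z \<in> cubics"
proof
  assume "z \<circ> g \<in> cubics"
  then have "z \<circ> g \<circ> Hilbert_Choice.inv g \<in> cubics"
    by (rule cubics_comp[OF GLD(1)[OF GL_inv[OF assms]]])
  moreover have "z \<circ> g \<circ> Hilbert_Choice.inv g = z"
    using GLD(2)[OF assms] by (simp add: fun_eq_iff bij_is_surj surj_f_inv_f)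
  ultimately show "z \<in> cubics" by simp
qed (rule cubics_comp[OF GLD(1)[OF assms]])

text \<open>The action is a substitution, so its linearity and the composition laws are
  automatic.\<close>

lemma GL_module_iff:
  "GL_module s fscale plethysm_act N \<longleftrightarrow>
    fn.subspace N \<and> (\<forall>g\<in>GL s. \<forall>m\<in>N. plethysm_act g m \<in> N)"
  unfolding GL_module_def
  by (auto simp: fn.vector_space_axioms plethysm_act_def fun_eq_iff comp_def)

end

section \<open>Coordinates, matrices and adjoints for an ordered basis\<close>

locale based_space = complex_space +
  fixes bs :: "'a list"
  assumes basis: "ordered_basis s bs"
begin

abbreviation n :: nat where "n \<equiv> length bs"

lemma basis_simps [simp]: "distinct bs" "independent (set bs)" "span (set bs) = UNIV"
  using basis by (simp_all add: ordered_basis_def)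

definition coord :: "nat \<Rightarrow> 'a \<Rightarrow> complex" where
  "coord i v = representation (set bs) v (bs ! i)"

lemma coord_add: "coord i (u + v) = coord i u + coord i v"
  unfolding coord_def by (simp add: representation_add)

lemma coord_scale: "coord i (s c v) = c * coord i v"
  unfolding coord_def by (simp add: representation_scale)

lemma coord_basis: "i < n \<Longrightarrow> j < n \<Longrightarrow> coord i (bs ! j) = (if i = j then 1 else 0)"
  unfolding coord_def by (simp add: representation_basis nth_eq_iff_index_eq)

lemma sum_coord: "(\<Sum>i<n. s (coord i v) (bs ! i)) = v"
proof -
  have "(\<Sum>i<n. s (coord i v) (bs ! i)) = (\<Sum>b\<in>set bs. s (representation (set bs) v b) b)"
    unfolding coord_def by (rule sum.reindex_bij_betw[OF bij_betw_nth]) auto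
  also have "\<dots> = v"
    by (rule sum_representation_eq) auto
  finally show ?thesis .
qed

lemma coord_eqI: "(\<And>i. i < n \<Longrightarrow> coord i u = coord i v) \<Longrightarrow> u = v"
  using sum_coord[of u] sum_coord[of v] by (metis (no_types, lifting) lessThan_iff sum.cong)

lemma coord_sum: "coord i (\<Sum>j\<in>J. f j) = (\<Sum>j\<in>J. coord i (f j))"
proof (induction J rule: infinite_finite_induct)
  case (insert j J)
  then show ?case by (simp add: coord_add)
qed (use coord_scale[of i 0 0] in simp_all)

lemma coord_lincomb: "i < n \<Longrightarrow> coord i (\<Sum>j<n. s (c j) (bs ! j)) = c i"
  by (simp add: coord_sum coord_scale coord_basis if_distrib cong: if_cong)

lemma coord_dual: "coord i \<in> dual_space s UNIV"
  by (simp add: dual_space_def coord_add coord_scale)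

definition matrix :: "('a \<Rightarrow> 'a) \<Rightarrow> nat \<Rightarrow> nat \<Rightarrow> complex" where
  "matrix g i j = coord i (g (bs ! j))"

definition of_matrix :: "(nat \<Rightarrow> nat \<Rightarrow> complex) \<Rightarrow> 'a \<Rightarrow> 'a" where
  "of_matrix M v = (\<Sum>i<n. s (\<Sum>j<n. M i j * coord j v) (bs ! i))"

lemma linear_of_matrix: "Vector_Spaces.linear s s (of_matrix M)"
  unfolding of_matrix_def
  by unfold_locales
    (auto simp: coord_add coord_scale algebra_simps sum.distrib scale_sum_right sum_distrib_left scale_left_distrib scale_right_distrib)

lemma coord_of_matrix: "i < n \<Longrightarrow> coord i (of_matrix M v) = (\<Sum>j<n. M i j * coord j v)"
  unfolding of_matrix_def by (rule coord_lincomb)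

lemma matrix_of_matrix: "i < n \<Longrightarrow> j < n \<Longrightarrow> matrix (of_matrix M) i j = M i j"
  by (simp add: matrix_def coord_of_matrix coord_basis if_distrib cong: if_cong)

lemma of_matrix_comp: "of_matrix M (of_matrix N v) = of_matrix (\<lambda>i j. \<Sum>k<n. M i k * N k j) v"
proof (rule coord_eqI)
  fix i assume i: "i < n"
  have "coord i (of_matrix M (of_matrix N v)) = (\<Sum>k<n. \<Sum>j<n. M i k * N k j * coord j v)"
    using i by (simp add: coord_of_matrix sum_distrib_left mult.assoc)
  also have "\<dots> = (\<Sum>j<n. \<Sum>k<n. M i k * N k j * coord j v)"
    by (rule sum.swap)
  also have "\<dots> = coord i (of_matrix (\<lambda>i j. \<Sum>k<n. M i k * N k j) v)"
    using i by (simp add: coord_of_matrix sum_distrib_right)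
  finally show "coord i (of_matrix M (of_matrix N v)) = coord i (of_matrix (\<lambda>i j. \<Sum>k<n. M i k * N k j) v)" .
qed

lemma linear_matrix:
  assumes "Vector_Spaces.linear s s g"
  shows "g v = of_matrix (matrix g) v"
proof (rule coord_eqI)
  interpret g: Vector_Spaces.linear s s g by fact
  fix i assume "i < n"
  have "g v = (\<Sum>j<n. s (coord j v) (g (bs ! j)))"
    by (subst sum_coord[of v, symmetric]) (simp add: g.sum g.scale)
  then show "coord i (g v) = coord i (of_matrix (matrix g) v)"
    using \<open>i < n\<close> by (simp add: coord_of_matrix coord_sum coord_scale matrix_def mult.commute)
qed

lemma matrix_comp:
  assumes "Vector_Spaces.linear s s g"
  shows "i < n \<Longrightarrow> matrix (g \<circ> h) i j = (\<Sum>k<n. matrix g i k * matrix h k j)"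
  by (simp add: matrix_def linear_matrix[OF assms, of "h _"] coord_of_matrix)

text \<open>The adjoint for the Hermitian form in which \<open>bs\<close> is orthonormal.\<close>

definition adj :: "('a \<Rightarrow> 'a) \<Rightarrow> 'a \<Rightarrow> 'a" where
  "adj g = of_matrix (\<lambda>i j. cnj (matrix g j i))"

lemma matrix_adj: "i < n \<Longrightarrow> j < n \<Longrightarrow> matrix (adj g) i j = cnj (matrix g j i)"
  unfolding adj_def by (rule matrix_of_matrix)

lemma adj_comp_inverse:
  assumes "Vector_Spaces.linear s s h" "h \<circ> g = id"
  shows "adj g (adj h v) = v"
proof (rule coord_eqI)
  fix i assume i: "i < n"
  have delta: "(\<Sum>k<n. cnj (matrix g k i) * cnj (matrix h j k)) = (if i = j then 1 else 0)" if "j < n" for j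
  proof -
    have "(\<Sum>k<n. cnj (matrix g k i) * cnj (matrix h j k)) = cnj (matrix (h \<circ> g) j i)"
      using that by (simp add: matrix_comp[OF assms(1)] mult.commute)
    then show ?thesis
      using i that by (simp add: assms(2)) (simp add: matrix_def coord_basis)
  qed
  have "coord i (adj g (adj h v)) = (\<Sum>j<n. (\<Sum>k<n. cnj (matrix g k i) * cnj (matrix h j k)) * coord j v)"
    using i by (simp add: adj_def of_matrix_comp coord_of_matrix)
  also have "\<dots> = (\<Sum>j<n. (if i = j then 1 else 0) * coord j v)"
    by (intro sum.cong refl arg_cong2[where f = "(*)"] delta) simp
  also have "\<dots> = coord i v"
    using i by (simp add: if_distrib[of "\<lambda>x. x * _"] cong: if_cong)
  finally show "coord i (adj g (adj h v)) = coord i v" .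
qed

text \<open>The adjoint of the inverse inverts the adjoint.\<close>

lemma adj_GL:
  assumes "g \<in> GL s"
  shows "adj g \<in> GL s"
proof -
  note g = GLD[OF assms] and h = GLD(1)[OF GL_inv[OF assms]]
  have "Hilbert_Choice.inv g \<circ> g = id" "g \<circ> Hilbert_Choice.inv g = id"
    using g(2) by (auto simp: fun_eq_iff bij_is_inj bij_is_surj surj_f_inv_f)
  then have "adj g (adj (Hilbert_Choice.inv g) v) = v" "adj (Hilbert_Choice.inv g) (adj g v) = v" for v
    using adj_comp_inverse[OF h, of g] adj_comp_inverse[OF g(1), of "Hilbert_Choice.inv g"] by auto
  then have "bij (adj g)"
    by (metis bijI')
  then show ?thesis
    using linear_of_matrix by (simp add: GL_def End_def adj_def)
qed

end

section \<open>Complete reducibility\<close>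

context based_space
begin

abbreviation X :: "(nat \<times> nat \<times> nat) set" where
  "X \<equiv> {..<n} \<times> {..<n} \<times> {..<n}"

abbreviation Idx :: "(nat \<Rightarrow> nat \<times> nat \<times> nat) set" where
  "Idx \<equiv> PiE {..<8} (\<lambda>_. X)"

lemma finite_Idx: "finite Idx"
  by (intro finite_PiE) auto

definition polar_entry :: "('a \<Rightarrow> complex) \<Rightarrow> nat \<times> nat \<times> nat \<Rightarrow> complex" where
  "polar_entry z = (\<lambda>(i, j, k). pol z (bs ! i) (bs ! j) (bs ! k))"

definition polar_monomial :: "(nat \<Rightarrow> nat \<times> nat \<times> nat) \<Rightarrow> ('a \<Rightarrow> complex) \<Rightarrow> complex" where
  "polar_monomial t z = (if z \<in> cubics then \<Prod>k<8. polar_entry z (t k) else 0)"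

text \<open>On \<open>Idx\<close>, eight triples of indices, \<open>A\<close> is an element of the
  24th tensor power of V in coordinates; this is its image among the polynomials of degree 8 on
  cubics.\<close>

definition tensor_poly :: "((nat \<Rightarrow> nat \<times> nat \<times> nat) \<Rightarrow> complex) \<Rightarrow> ('a \<Rightarrow> complex) \<Rightarrow> complex" where
  "tensor_poly A z = (\<Sum>t\<in>Idx. A t * polar_monomial t z)"

definition kernel :: "('a \<Rightarrow> 'a) \<Rightarrow> nat \<times> nat \<times> nat \<Rightarrow> nat \<times> nat \<times> nat \<Rightarrow> complex" where
  "kernel g = (\<lambda>(i, j, k) (i', j', k'). matrix g i i' * matrix g j j' * matrix g k k')"

definition tensor_act :: "('a \<Rightarrow> 'a) \<Rightarrow> ((nat \<Rightarrow> nat \<times> nat \<times> nat) \<Rightarrow> complex) \<Rightarrow> (nat \<Rightarrow> nat \<times> nat \<times> nat) \<Rightarrow> complex" where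
  "tensor_act g A t = (\<Sum>u\<in>Idx. (\<Prod>k<8. kernel g (t k) (u k)) * A u)"

lemma pol_comp:
  assumes "Vector_Spaces.linear s s g"
  shows "pol (z \<circ> g) u v w = pol z (g u) (g v) (g w)"
proof -
  interpret g: Vector_Spaces.linear s s g by fact
  show ?thesis by (simp add: pol_def g.add)
qed

lemma linear_basis: "g (bs ! j) = (\<Sum>p<n. s (matrix g p j) (bs ! p))"
  unfolding matrix_def by (rule sum_coord[symmetric])

lemma polar_entry_comp:
  assumes "Vector_Spaces.linear s s g" "z \<in> cubics"
  shows "polar_entry (z \<circ> g) u = (\<Sum>t\<in>X. polar_entry z t * kernel g t u)"
proof -
  obtain i j k where u: "u = (i, j, k)" by (cases u)
  have "polar_entry (z \<circ> g) u = pol z (\<Sum>p<n. s (matrix g p i) (bs ! p)) (\<Sum>p<n. s (matrix g p j) (bs ! p)) (\<Sum>p<n. s (matrix g p k) (bs ! p))"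
    unfolding u polar_entry_def prod.case pol_comp[OF assms(1)] linear_basis[of g] by (rule refl)
  also have "\<dots> = (\<Sum>t\<in>X. polar_entry z t * kernel g t u)"
    unfolding pol_sum3[OF assms(2)] u by (rule sum.cong) (auto simp: polar_entry_def kernel_def)
  finally show ?thesis .
qed

text \<open>Polarisation commutes with substitution, so each polar entry of
  \<open>z \<circ> g\<close> expands by the matrix of \<open>g\<close>; multiplying out the eight
  factors gives the tensor action.\<close>

lemma tensor_poly_act:
  assumes "g \<in> GL s"
  shows "tensor_poly (tensor_act g A) = plethysm_act g (tensor_poly A)"
proof
  fix z
  show "tensor_poly (tensor_act g A) z = plethysm_act g (tensor_poly A) z"
  proof (cases "z \<in> cubics")
    case True
    have "plethysm_act g (tensor_poly A) z = (\<Sum>u\<in>Idx. A u * (\<Prod>k<8. polar_entry (z \<circ> g) (u k)))"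
      using True cubics_comp_GL_iff[OF assms] by (simp add: plethysm_act_def tensor_poly_def polar_monomial_def)
    also have "\<dots> = (\<Sum>u\<in>Idx. A u * (\<Sum>t\<in>Idx. \<Prod>k<8. polar_entry z (t k) * kernel g (t k) (u k)))"
      unfolding polar_entry_comp[OF GLD(1)[OF assms] True] by (subst prod_sum_PiE) auto
    also have "\<dots> = (\<Sum>u\<in>Idx. \<Sum>t\<in>Idx. (\<Prod>k<8. kernel g (t k) (u k)) * A u * (\<Prod>k<8. polar_entry z (t k)))"
      by (simp add: sum_distrib_left prod.distrib ac_simps)
    also have "\<dots> = (\<Sum>t\<in>Idx. \<Sum>u\<in>Idx. (\<Prod>k<8. kernel g (t k) (u k)) * A u * (\<Prod>k<8. polar_entry z (t k)))"
      by (rule sum.swap)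
    also have "\<dots> = tensor_poly (tensor_act g A) z"
      using True by (simp add: tensor_poly_def tensor_act_def polar_monomial_def sum_distrib_right)
    finally show ?thesis by simp
  next
    case False
    then show ?thesis
      using cubics_comp_GL_iff[OF assms] by (simp add: plethysm_act_def tensor_poly_def polar_monomial_def)
  qed
qed

lemma tensor_poly_add: "tensor_poly (A + B) = tensor_poly A + tensor_poly B"
  by (simp add: fun_eq_iff tensor_poly_def distrib_right sum.distrib)

lemma tensor_poly_scale: "tensor_poly (fscale c A) = fscale c (tensor_poly A)"
  by (simp add: fun_eq_iff tensor_poly_def sum_distrib_left mult.assoc)

lemma tensor_poly_0: "tensor_poly 0 = 0"
  by (simp add: fun_eq_iff tensor_poly_def)

lemma subspace_tensor_poly_image: "fn.subspace S \<Longrightarrow> fn.subspace (tensor_poly ` S)"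
  unfolding fn.subspace_def
  by (auto simp: tensor_poly_0[symmetric] tensor_poly_add[symmetric] tensor_poly_scale[symmetric])

lemma tensor_poly_cong: "(\<And>t. t \<in> Idx \<Longrightarrow> A t = B t) \<Longrightarrow> tensor_poly A = tensor_poly B"
  unfolding tensor_poly_def by (rule ext, rule sum.cong) auto

definition poly_space :: "(('a \<Rightarrow> complex) \<Rightarrow> complex) set" where
  "poly_space = range tensor_poly"

lemma poly_space_module: "GL_module s fscale plethysm_act poly_space"
  unfolding GL_module_iff poly_space_def
  using subspace_tensor_poly_image[OF fn.subspace_UNIV] by (auto simp: tensor_poly_act[symmetric])

lemma tensor_poly_monomials: "tensor_poly A = (\<Sum>t\<in>Idx. fscale (A t) (polar_monomial t))"
proof -
  have "(\<Sum>t\<in>S. fscale (A t) (polar_monomial t)) z = (\<Sum>t\<in>S. A t * polar_monomial t z)" for S z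
    by (induction S rule: infinite_finite_induct) auto
  then show ?thesis by (simp add: fun_eq_iff tensor_poly_def)
qed

lemma poly_space_span: "poly_space = fn.span (polar_monomial ` Idx)"
proof
  show "poly_space \<subseteq> fn.span (polar_monomial ` Idx)"
  proof
    fix x assume "x \<in> poly_space"
    then obtain A where "x = tensor_poly A" by (auto simp: poly_space_def)
    then show "x \<in> fn.span (polar_monomial ` Idx)"
      unfolding tensor_poly_monomials by (simp only:) (intro fn.span_sum fn.span_scale fn.span_base imageI)
  qed
  have "polar_monomial t \<in> poly_space" if "t \<in> Idx" for t
  proof -
    have "tensor_poly (\<lambda>u. if u = t then 1 else 0) = polar_monomial t"
      by (rule ext) (use that finite_Idx in \<open>simp add: tensor_poly_def if_distrib[of "\<lambda>x. x * _"] cong: if_cong\<close>)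
    then show ?thesis unfolding poly_space_def by (metis rangeI)
  qed
  then show "fn.span (polar_monomial ` Idx) \<subseteq> poly_space"
    using poly_space_module by (intro fn.span_minimal) (auto simp: GL_module_iff)
qed

section \<open>A Hermitian form on tensors and invariant complements\<close>

definition inner :: "((nat \<Rightarrow> nat \<times> nat \<times> nat) \<Rightarrow> complex) \<Rightarrow> ((nat \<Rightarrow> nat \<times> nat \<times> nat) \<Rightarrow> complex) \<Rightarrow> complex" where
  "inner A B = (\<Sum>t\<in>Idx. A t * cnj (B t))"

lemma inner_simps:
  "inner (A + A') B = inner A B + inner A' B" "inner (A - A') B = inner A B - inner A' B"
  "inner (fscale c A) B = c * inner A B" "inner A (B + B') = inner A B + inner A B'"
  "inner A (fscale c B) = cnj c * inner A B"
  by (simp_all add: inner_def algebra_simps sum.distrib sum_subtractf sum_distrib_left)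

text \<open>The form sees an array on \<open>Idx\<close> only and is definite there;
  \<open>tensor_poly\<close> sees the same part.\<close>

lemma inner_self_eq_0:
  assumes "inner A A = 0" "t \<in> Idx"
  shows "A t = 0"
proof -
  have "inner A A = (\<Sum>t\<in>Idx. of_real ((cmod (A t))\<^sup>2))"
    unfolding inner_def complex_norm_square by (rule refl)
  also have "\<dots> = of_real (\<Sum>t\<in>Idx. (cmod (A t))\<^sup>2)"
    by (rule of_real_sum[symmetric])
  finally have "complex_of_real (\<Sum>t\<in>Idx. (cmod (A t))\<^sup>2) = 0"
    using assms(1) by (rule trans[OF sym])
  then have "(\<Sum>t\<in>Idx. (cmod (A t))\<^sup>2) = 0"
    by (rule of_real_eq_0_iff[THEN iffD1])
  then show ?thesis
    using assms(2) finite_Idx by (simp add: sum_nonneg_eq_0_iff)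
qed

text \<open>Gram-Schmidt: \<open>a'\<close> is the part of the new generator orthogonal to the span
  reached so far.\<close>

lemma orthogonal_projection:
  assumes "finite S"
  shows "\<exists>y\<in>fn.span S. \<forall>u\<in>fn.span S. inner (x - y) u = 0"
  using assms
proof (induction S arbitrary: x)
  case empty
  have "inner A 0 = 0" for A by (simp add: inner_def)
  then show ?case
    unfolding fn.span_empty by blast
next
  case (insert a S)
  obtain ya where ya: "ya \<in> fn.span S" "\<And>u. u \<in> fn.span S \<Longrightarrow> inner (a - ya) u = 0"
    using insert.IH[of a] by blast
  obtain yx where yx: "yx \<in> fn.span S" "\<And>u. u \<in> fn.span S \<Longrightarrow> inner (x - yx) u = 0"
    using insert.IH[of x] by blast
  define a' where "a' = a - ya"
  define \<alpha> where "\<alpha> = inner (x - yx) a' / inner a' a'"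
  have sub: "fn.span S \<subseteq> fn.span (insert a S)" by (rule fn.span_mono) auto
  have "a' \<in> fn.span (insert a S)"
    unfolding a'_def by (intro fn.span_diff fn.span_base subsetD[OF sub ya(1)]) simp
  then have mem: "yx + fscale \<alpha> a' \<in> fn.span (insert a S)"
    by (intro fn.span_add fn.span_scale subsetD[OF sub yx(1)])
  have "inner (x - yx) a' - \<alpha> * inner a' a' = 0"
  \<comment> \<open>On all functions the form is only semidefinite: an \<open>a'\<close> of length 0
    vanishes on \<open>Idx\<close> and is orthogonal to everything.\<close>
  proof (cases "inner a' a' = 0")
    case True
    then have "inner (x - yx) a' = 0"
      using inner_self_eq_0[OF True] unfolding inner_def[of "x - yx"] by (intro sum.neutral) auto
    then show ?thesis using True by simp
  qed (simp add: \<alpha>_def)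
  then have orth: "inner (x - (yx + fscale \<alpha> a')) a' = 0"
    by (simp only: inner_simps) (simp add: algebra_simps)
  have "inner (x - (yx + fscale \<alpha> a')) u = 0" if u: "u \<in> fn.span (insert a S)" for u
  proof -
    obtain k where k: "u - fscale k a \<in> fn.span S"
      using fn.span_breakdown_eq[THEN iffD1, OF u] by blast
    define r where "r = (u - fscale k a) + fscale k ya"
    have r: "r \<in> fn.span S"
      unfolding r_def using k ya(1) by (intro fn.span_add fn.span_scale)
    have "u = fscale k a' + r"
      by (simp add: r_def a'_def fun_eq_iff algebra_simps)
    moreover have "inner (x - (yx + fscale \<alpha> a')) r = 0"
      using yx(2)[OF r] ya(2)[OF r] by (simp only: inner_simps a'_def) (simp add: algebra_simps)
    ultimately show ?thesis
      using orth by (simp only: inner_simps(4,5)) simp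
  qed
  then show ?case using mem by blast
qed

text \<open>The matrix of \<open>adj g\<close> is the conjugate transpose, and this passes to tensor
  powers.\<close>

lemma inner_tensor_act: "inner (tensor_act g A) B = inner A (tensor_act (adj g) B)"
proof -
  have K: "cnj (kernel (adj g) u t) = kernel g t u" if "t \<in> X" "u \<in> X" for t u
    using that by (auto simp: kernel_def matrix_adj)
  have "inner (tensor_act g A) B = (\<Sum>t\<in>Idx. \<Sum>u\<in>Idx. (\<Prod>k<8. kernel g (t k) (u k)) * A u * cnj (B t))"
    by (simp add: inner_def tensor_act_def sum_distrib_right)
  also have "\<dots> = (\<Sum>u\<in>Idx. \<Sum>t\<in>Idx. (\<Prod>k<8. kernel g (t k) (u k)) * A u * cnj (B t))"
    by (rule sum.swap)
  also have "\<dots> = (\<Sum>u\<in>Idx. \<Sum>t\<in>Idx. A u * ((\<Prod>k<8. cnj (kernel (adj g) (u k) (t k))) * cnj (B t)))"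
  proof (intro sum.cong refl)
    fix u t assume "u \<in> Idx" "t \<in> Idx"
    then have "(\<Prod>k<8. cnj (kernel (adj g) (u k) (t k))) = (\<Prod>k<8. kernel g (t k) (u k))"
      by (intro prod.cong refl K) (auto dest: PiE_mem)
    then show "(\<Prod>k<8. kernel g (t k) (u k)) * A u * cnj (B t) =
        A u * ((\<Prod>k<8. cnj (kernel (adj g) (u k) (t k))) * cnj (B t))"
      by simp
  qed
  also have "\<dots> = inner A (tensor_act (adj g) B)"
    by (simp add: inner_def tensor_act_def sum_distrib_left)
  finally show ?thesis .
qed

lemma finite_spanning_set:
  assumes "fn.subspace (V :: ('b \<Rightarrow> complex) set)" "finite S" "V \<subseteq> fn.span S"
  obtains B where "finite B" "fn.independent B" "fn.span B = V"
proof -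
  obtain B where B: "B \<subseteq> V" "fn.independent B" "V \<subseteq> fn.span B"
    using fn.maximal_independent_subset[of V] by blast
  have "finite B"
    using fn.independent_span_bound[OF assms(2) B(2)] B(1) assms(3) by blast
  moreover have "fn.span B = V"
    using B assms(1) by (intro antisym fn.span_minimal) auto
  ultimately show ?thesis using that B(2) by blast
qed

text \<open>The preimage \<open>P\<close> of \<open>E1\<close> is stable under the group, hence
  under adjoints, so its orthogonal complement \<open>C\<close> is stable too. The image of
  \<open>C\<close> is the complement sought: an array in \<open>P\<close> and \<open>C\<close> is
  orthogonal to itself, so it maps to 0.\<close>

lemma complement_in_poly_space:
  assumes E1: "GL_module s fscale plethysm_act E1" "E1 \<subseteq> poly_space"
  obtains E2 where "GL_module s fscale plethysm_act E2" "E2 \<subseteq> poly_space" "E1 \<inter> E2 = {0}"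
    "\<And>x. x \<in> poly_space \<Longrightarrow> \<exists>y\<in>E1. \<exists>w\<in>E2. x = y + w"
proof -
  have sub1: "fn.subspace E1" using E1(1) by (simp add: GL_module_iff)
  define P where "P = {A. tensor_poly A \<in> E1}"
  \<comment> \<open>\<open>P\<close> contains every array that vanishes on \<open>Idx\<close>; its
    part supported on \<open>Idx\<close> is finite-dimensional, as the projection requires.\<close>
  define P0 where "P0 = {A \<in> P. \<forall>t. t \<notin> Idx \<longrightarrow> A t = 0}"
  define C where "C = {A. \<forall>B\<in>P. inner A B = 0}"
  define dlt where "dlt t = (\<lambda>u. if u = t then 1 else 0 :: complex)" for t :: "nat \<Rightarrow> nat \<times> nat \<times> nat"
  have "fn.subspace P0"
    unfolding P0_def P_def fn.subspace_def
    using fn.subspace_0[OF sub1] fn.subspace_add[OF sub1] fn.subspace_scale[OF sub1]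
    by (auto simp: tensor_poly_0 tensor_poly_add tensor_poly_scale)
  moreover have "P0 \<subseteq> fn.span (dlt ` Idx)"
  proof
    fix A assume A: "A \<in> P0"
    have "(\<Sum>t\<in>S. fscale (A t) (dlt t)) u = (if u \<in> S then A u else 0)" if "finite S" for S u
      using that by (induction S) (auto simp: dlt_def)
    then have "(\<Sum>t\<in>Idx. fscale (A t) (dlt t)) u = A u" for u
      using A finite_Idx by (simp only: P0_def mem_Collect_eq split: if_split) simp
    then have "A = (\<Sum>t\<in>Idx. fscale (A t) (dlt t))"
      by (intro ext) (rule sym)
    moreover have "(\<Sum>t\<in>Idx. fscale (A t) (dlt t)) \<in> fn.span (dlt ` Idx)"
      by (intro fn.span_sum fn.span_scale fn.span_base imageI)
    ultimately show "A \<in> fn.span (dlt ` Idx)" by (simp only:)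
  qed
  ultimately obtain S where S: "finite S" "fn.span S = P0"
    using finite_spanning_set finite_Idx by (metis finite_imageI)
  have Csub: "fn.subspace C"
    unfolding C_def fn.subspace_def by (auto simp: inner_simps) (simp add: inner_def)
  have CP: "tensor_poly A = 0" if "A \<in> C" "tensor_poly A \<in> E1" for A
  proof -
    have "inner A A = 0" using that by (auto simp: C_def P_def)
    then have "tensor_poly A = tensor_poly 0" by (intro tensor_poly_cong) (simp add: inner_self_eq_0)
    then show ?thesis by (simp only: tensor_poly_0)
  qed
  show ?thesis
  proof (rule that[of "tensor_poly ` C"])
    have "tensor_act g A \<in> C" if g: "g \<in> GL s" and A: "A \<in> C" for g A
    proof -
      have "tensor_act (adj g) B \<in> P" if "B \<in> P" for B
        using that E1(1) adj_GL[OF g] by (simp add: P_def tensor_poly_act GL_module_iff)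
      then show ?thesis using A by (simp add: C_def inner_tensor_act)
    qed
    then show "GL_module s fscale plethysm_act (tensor_poly ` C)"
      unfolding GL_module_iff using subspace_tensor_poly_image[OF Csub] by (auto simp: tensor_poly_act[symmetric])
    show "tensor_poly ` C \<subseteq> poly_space" by (auto simp: poly_space_def)
    show "E1 \<inter> tensor_poly ` C = {0}"
      using CP fn.subspace_0[OF sub1] fn.subspace_0[OF subspace_tensor_poly_image[OF Csub]] by auto
    fix x assume "x \<in> poly_space"
    then obtain A where A: "x = tensor_poly A" by (auto simp: poly_space_def)
    obtain y where y: "y \<in> P0" "\<And>u. u \<in> P0 \<Longrightarrow> inner (A - y) u = 0"
      using orthogonal_projection[OF S(1), of A] S(2) by blast
    have "A - y \<in> C"
      unfolding C_def
    proof (intro CollectI ballI)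
      fix B assume B: "B \<in> P"
      \<comment> \<open>Cutting \<open>B\<close> off outside \<open>Idx\<close> changes neither its
        polynomial nor its inner products.\<close>
      let ?B = "\<lambda>t. if t \<in> Idx then B t else 0"
      have "tensor_poly ?B = tensor_poly B" by (rule tensor_poly_cong) simp
      then have "?B \<in> P0" using B by (simp add: P0_def P_def)
      moreover have "inner (A - y) B = inner (A - y) ?B"
        unfolding inner_def by (rule sum.cong) auto
      ultimately show "inner (A - y) B = 0" using y(2) by simp
    qed
    moreover have "tensor_poly y \<in> E1" using y(1) by (simp add: P0_def P_def)
    moreover have "x = tensor_poly y + tensor_poly (A - y)" by (simp only: A tensor_poly_add[symmetric]) simp
    ultimately show "\<exists>y\<in>E1. \<exists>w\<in>tensor_poly ` C. x = y + w" by blast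
  qed
qed

end

lemma diff_eq_diffI: "a + b = c + d \<Longrightarrow> a - c = d - b" for a :: "'g::ab_group_add"
  by (simp add: algebra_simps)

lemma dim_less:
  assumes "fn.subspace (V :: ('b \<Rightarrow> complex) set)" "fn.subspace U" "U \<subset> V" "finite S" "V \<subseteq> fn.span S"
  shows "fn.dim U < fn.dim V"
proof -
  obtain B where B: "B \<subseteq> U" "fn.independent B" "U \<subseteq> fn.span B"
    using fn.maximal_independent_subset[of U] by blast
  obtain B' where B': "B \<subseteq> B'" "B' \<subseteq> V" "fn.independent B'" "V \<subseteq> fn.span B'"
    using fn.maximal_independent_subset_extend[of B V] B(1,2) assms(3) by blast
  have fin: "finite B'"
    using fn.independent_span_bound[OF assms(4) B'(3)] B'(2) assms(5) by blast
  have "fn.span B = U" using B assms(2) by (intro antisym fn.span_minimal) auto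
  moreover have "fn.span B' = V" using B' assms(1) by (intro antisym fn.span_minimal) auto
  ultimately have "fn.dim U = card B" "fn.dim V = card B'" "B \<noteq> B'"
    using fn.dim_span[of B] fn.dim_span[of B'] fn.dim_eq_card_independent B(2) B'(3) assms(3) by auto
  then show ?thesis using psubset_card_mono[OF fin, of B] B'(1) by auto
qed

context based_space
begin

section \<open>Projections onto irreducible submodules\<close>

abbreviation is_submodule :: "(('a \<Rightarrow> complex) \<Rightarrow> complex) set \<Rightarrow> bool" where
  "is_submodule \<equiv> GL_module s fscale plethysm_act"

lemma plethysm_act_add: "plethysm_act g (G + H) = plethysm_act g G + plethysm_act g H"
  by (simp add: plethysm_act_def fun_eq_iff)

lemma plethysm_act_scale: "plethysm_act g (fscale c G) = fscale c (plethysm_act g G)"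
  by (simp add: plethysm_act_def fun_eq_iff)

lemma plethysm_act_comp: "plethysm_act g (plethysm_act h G) = plethysm_act (g \<circ> h) G"
  by (simp add: plethysm_act_def comp_assoc)

lemma submodule_sum:
  assumes "is_submodule U" "is_submodule W"
  shows "is_submodule {u + w | u w. u \<in> U \<and> w \<in> W}"
  using assms fn.subspace_sums[of U W] unfolding GL_module_iff
  by (auto simp: plethysm_act_add) blast

lemma submodule_Int: "is_submodule U \<Longrightarrow> is_submodule W \<Longrightarrow> is_submodule (U \<inter> W)"
  unfolding GL_module_iff by (auto intro: fn.subspace_inter)

text \<open>\<open>f\<close> is the projection of \<open>G\<close> to \<open>N\<close> along some complementary submodule.\<close>

definition projects :: "(('a \<Rightarrow> complex) \<Rightarrow> complex) \<Rightarrow> (('a \<Rightarrow> complex) \<Rightarrow> complex) set \<Rightarrow> (('a \<Rightarrow> complex) \<Rightarrow> complex) \<Rightarrow> bool" where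
  "projects G N f \<longleftrightarrow> f \<in> N \<and> f \<noteq> 0 \<and> (\<exists>C. is_submodule C \<and> N \<inter> C = {0} \<and> G - f \<in> C)"

text \<open>The complement grows to \<open>C + N2\<close>. If an element of \<open>N1\<close> is
  \<open>u + w\<close> with \<open>u\<close> in \<open>C\<close> and \<open>w\<close> in
  \<open>N2\<close>, then \<open>u\<close> lies in \<open>N\<close> and in \<open>C\<close>, so it
  is 0 and the element lies in both \<open>N1\<close> and \<open>N2\<close>.\<close>

lemma projects_step:
  assumes N: "is_submodule N" "projects G N f"
    and sub: "is_submodule N1" "is_submodule N2" "N1 \<subseteq> N" "N2 \<subseteq> N" "N1 \<inter> N2 = {0}"
    and f: "f = f1 + f2" "f1 \<in> N1" "f2 \<in> N2" "f1 \<noteq> 0"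
  shows "projects G N1 f1"
proof -
  obtain C where C: "is_submodule C" "N \<inter> C = {0}" "G - f \<in> C"
    using N(2) by (auto simp: projects_def)
  let ?C = "{u + w | u w. u \<in> C \<and> w \<in> N2}"
  have "x = 0" if x: "x \<in> N1" "x \<in> ?C" for x
  proof -
    obtain u w where uw: "x = u + w" "u \<in> C" "w \<in> N2" using x(2) by blast
    have "x - w \<in> N"
      using N(1) x(1) uw(3) sub(3,4) by (auto simp: GL_module_iff intro: fn.subspace_diff)
    moreover have "x - w = u" using uw(1) by simp
    ultimately have "u = 0" using C(2) uw(2) by auto
    then have "x \<in> N2" using uw by simp
    then show ?thesis using x(1) sub(5) by auto
  qed
  moreover have "0 \<in> N1" "0 \<in> ?C"
    using sub(1) submodule_sum[OF C(1) sub(2)] by (auto simp only: GL_module_iff fn.subspace_0)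
  moreover have "G - f1 = (G - f) + f2" using f(1) by simp
  then have "G - f1 \<in> ?C" using C(3) f(3) by blast
  ultimately show ?thesis
    using submodule_sum[OF C(1) sub(2)] f unfolding projects_def by blast
qed

text \<open>\<open>N\<close> has least dimension among the submodules onto which \<open>G\<close>
  has a nonzero projection. A proper nonzero submodule would split \<open>N\<close>, and
  \<open>G\<close> would have a nonzero projection to one of two smaller summands.\<close>

lemma irreducible_projection:
  assumes V: "is_submodule V" "V \<subseteq> poly_space" and G: "G \<in> V" "G \<noteq> 0"
  obtains N f where "irreducible_GL_module s fscale plethysm_act N" "N \<subseteq> V" "projects G N f"
proof -
  have "is_submodule {0}"
    by (simp add: GL_module_iff fn.subspace_single_0) (simp add: plethysm_act_def zero_fun_def)
  moreover have "V \<inter> {0} = {0}" using V(1) by (auto simp: GL_module_iff fn.subspace_0)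
  moreover have "G - G \<in> {0}" by simp
  ultimately have "projects G V G"
    using G unfolding projects_def by blast
  then have ex: "\<exists>N f. is_submodule N \<and> N \<subseteq> V \<and> projects G N f" using V(1) by blast
  obtain N where N: "\<exists>f. is_submodule N \<and> N \<subseteq> V \<and> projects G N f"
    and min: "\<And>N'. \<exists>f. is_submodule N' \<and> N' \<subseteq> V \<and> projects G N' f \<Longrightarrow> fn.dim N \<le> fn.dim N'"
    using ex_has_least_nat[of "\<lambda>N. \<exists>f. is_submodule N \<and> N \<subseteq> V \<and> projects G N f" _ fn.dim] ex by blast
  obtain f where f: "is_submodule N" "N \<subseteq> V" "projects G N f" using N by blast
  have NE: "N \<subseteq> poly_space" using f(2) V(2) by blast
  have smaller: "fn.dim N1 < fn.dim N" if "is_submodule N1" "N1 \<subset> N" for N1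
    using that f(1) NE finite_Idx unfolding poly_space_span GL_module_iff
    by (intro dim_less[of N N1 "polar_monomial ` Idx"]) auto
  have "N1 = {0} \<or> N1 = N" if N1: "N1 \<subseteq> N" "is_submodule N1" for N1
  proof (rule ccontr)
    assume "\<not> ?thesis"
    then have nt: "N1 \<noteq> {0}" "N1 \<noteq> N" by auto
    obtain E2 where E2: "is_submodule E2" "N1 \<inter> E2 = {0}"
      "\<And>x. x \<in> poly_space \<Longrightarrow> \<exists>y\<in>N1. \<exists>w\<in>E2. x = y + w"
      using complement_in_poly_space[OF N1(2)] N1(1) NE by (metis order_trans)
    let ?N2 = "E2 \<inter> N"
    have N2: "is_submodule ?N2" by (rule submodule_Int[OF E2(1) f(1)])
    have zero: "0 \<in> N1" using N1(2) by (simp add: GL_module_iff fn.subspace_0)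
    have fN: "f \<in> N" "f \<noteq> 0" using f(3) by (auto simp: projects_def)
    then obtain f1 f2 where f12: "f1 \<in> N1" "f2 \<in> E2" "f = f1 + f2" using E2(3) NE by blast
    have "f - f1 \<in> N"
      using f(1) fN(1) f12(1) N1(1) by (auto simp: GL_module_iff intro: fn.subspace_diff)
    moreover have "f - f1 = f2" using f12(3) by simp
    ultimately have f2: "f2 \<in> ?N2" using f12(2) by simp
    have int: "N1 \<inter> ?N2 = {0}" "?N2 \<inter> N1 = {0}" using E2(2) N1(1) by auto
    have "?N2 \<noteq> N" using int nt(1) N1(1) zero by blast
    then have less: "fn.dim N1 < fn.dim N" "fn.dim ?N2 < fn.dim N"
      using smaller[OF N1(2)] smaller[OF N2] N1(1) nt(2) by auto
    show False
    proof (cases "f1 = 0")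
      case True
      then have "f2 \<noteq> 0" using fN(2) f12(3) by auto
      then have "projects G ?N2 f2"
        using projects_step[OF f(1,3) N2 N1(2) _ N1(1) int(2) _ f2 f12(1)] f12(3) by (simp add: add.commute)
      then have "fn.dim N \<le> fn.dim ?N2" using min[of ?N2] N2 f(2) by blast
      then show False using less by simp
    next
      case False
      then have "projects G N1 f1"
        using projects_step[OF f(1,3) N1(2) N2 N1(1) _ int(1) f12(3,1) f2] by simp
      then have "fn.dim N \<le> fn.dim N1" using min[of N1] N1 f(2) by blast
      then show False using less by simp
    qed
  qed
  moreover have "N \<noteq> {0}" using f(3) by (auto simp: projects_def)
  ultimately have "irreducible_GL_module s fscale plethysm_act N"
    using f(1) unfolding irreducible_GL_module_def by blast
  then show ?thesis using that f(2,3) by blast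
qed

text \<open>The difference \<open>x\<close> of both sides lies in \<open>N\<close>; it also lies in
  \<open>C\<close>, because \<open>G - f\<close> does and \<open>G\<close> satisfies the
  equation.\<close>

lemma projects_eigen:
  assumes N: "is_submodule N" "projects G N f" and g: "g \<in> GL s" "plethysm_act g G = fscale c G"
  shows "plethysm_act g f = fscale c f"
proof -
  obtain C where C: "is_submodule C" "N \<inter> C = {0}" "G - f \<in> C" and f: "f \<in> N"
    using N(2) by (auto simp: projects_def)
  define x where "x = plethysm_act g f - fscale c f"
  have "plethysm_act g G = plethysm_act g f + plethysm_act g (G - f)" "fscale c G = fscale c f + fscale c (G - f)"
    by (simp_all add: plethysm_act_def fun_eq_iff algebra_simps)
  then have "x = fscale c (G - f) - plethysm_act g (G - f)"
    unfolding x_def using g(2) by (intro diff_eq_diffI) (simp only:)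
  moreover have "fscale c H - plethysm_act g H \<in> U" if "is_submodule U" "H \<in> U" for H U
    using that g(1) by (auto simp: GL_module_iff intro: fn.subspace_diff fn.subspace_scale)
  from this[OF C(1,3)] have "fscale c (G - f) - plethysm_act g (G - f) \<in> C" .
  moreover have "x \<in> N"
    unfolding x_def using N(1) f g(1) by (auto simp: GL_module_iff intro: fn.subspace_diff fn.subspace_scale)
  ultimately have "x \<in> N \<inter> C" by (simp only: Int_iff)
  then have "x = 0" unfolding C(2) by (rule singletonD)
  then show ?thesis unfolding x_def by (rule eq_iff_diff_eq_0[THEN iffD2])
qed

end

section \<open>The highest weight vector\<close>

lemma indicator_disjoint_union:
  assumes "A \<inter> B = {}" "A \<inter> C = {}" "A \<inter> D = {}" "B \<inter> C = {}" "B \<inter> D = {}" "C \<inter> D = {}"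
  shows "(if t \<in> A then 1 else 0) + (if t \<in> B then 1 else 0) + (if t \<in> C then 1 else 0) + (if t \<in> D then 1 else 0) =
    (if t \<in> A \<union> B \<union> C \<union> D then 1 else 0 :: complex)"
  using assms by (cases "t \<in> A"; cases "t \<in> B"; cases "t \<in> C"; cases "t \<in> D") auto

locale big_based_space = based_space +
  assumes dim6: "6 \<le> length bs"
begin

lemma form_prod_cubic: "\<forall>i<3. l i \<in> dual_space s UNIV \<Longrightarrow> form_prod UNIV 3 l \<in> cubics"
  unfolding hom_poly_def by (rule fn.span_base) blast

lemma subspace_cubics: "fn.subspace cubics"
  by (rule subspace_hom_poly)

definition hw_poly :: "('a \<Rightarrow> complex) \<Rightarrow> complex" where
  "hw_poly z = (if z \<in> cubics then Psixi (unit_row 4) (unit_row 5) (\<lambda>i j k. polar_entry z (i, j, k)) else 0)"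

text \<open>Labels 0 and 1 contribute scalars; the other eight labels, shifted by 2, contribute one
  polar entry each.\<close>

lemma hw_poly_in_poly_space: "hw_poly \<in> poly_space"
proof -
  let ?Q = "PiE {..<5} (\<lambda>_. {p. p permutes {0..<6::nat}})"
  let ?xi = "with_xi (unit_row 4) (unit_row 5)"
  define t where "t P = (\<lambda>k\<in>{..<8::nat}. (slot P (Suc (Suc k)) 0, slot P (Suc (Suc k)) 1, slot P (Suc (Suc k)) 2))"
    for P :: "nat \<Rightarrow> nat \<Rightarrow> nat"
  define c where "c P = (\<Prod>c<5. of_int (sign (P c))) *
      (?xi (\<lambda>_ _ _. 0) 0 (slot P 0 0) (slot P 0 1) (slot P 0 2) * ?xi (\<lambda>_ _ _. 0) 1 (slot P 1 0) (slot P 1 1) (slot P 1 2))"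
    for P :: "nat \<Rightarrow> nat \<Rightarrow> nat"
  have "hw_poly z = (\<Sum>P\<in>?Q. fscale (c P) (polar_monomial (t P))) z" for z
  proof -
    have apply_sum: "(\<Sum>P\<in>S. fscale (c P) (polar_monomial (t P))) z = (\<Sum>P\<in>S. c P * polar_monomial (t P) z)" for S
      by (induction S rule: infinite_finite_induct) auto
    have "{..<10} = {..<Suc (Suc 8)}" by auto
    then have "(\<Prod>a<10. ?xi Z a (slot P a 0) (slot P a 1) (slot P a 2)) =
        ?xi Z 0 (slot P 0 0) (slot P 0 1) (slot P 0 2) * (?xi Z 1 (slot P 1 0) (slot P 1 1) (slot P 1 2) *
        (\<Prod>k<8. ?xi Z (Suc (Suc k)) (slot P (Suc (Suc k)) 0) (slot P (Suc (Suc k)) 1) (slot P (Suc (Suc k)) 2)))"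
      for P Z by (simp only: prod.lessThan_Suc_shift One_nat_def)
    then have "Psixi (unit_row 4) (unit_row 5) (\<lambda>i j k. polar_entry z (i, j, k)) = (\<Sum>P\<in>?Q. c P * (\<Prod>k<8. polar_entry z (t P k)))"
      unfolding Psixi_def Psi_def by (intro sum.cong) (simp_all add: c_def t_def with_xi_def)
    then show ?thesis
      unfolding apply_sum by (simp add: hw_poly_def polar_monomial_def)
  qed
  then have hw_poly: "hw_poly = (\<Sum>P\<in>?Q. fscale (c P) (polar_monomial (t P)))" by (rule ext)
  have "polar_monomial (t P) \<in> poly_space" if P: "P \<in> ?Q" for P
  proof -
    have "slot P (Suc (Suc k)) m < n" if "k < 8" "m < 3" for k m
      using slot_less[OF P, of "Suc (Suc k)" m] that dim6 by simp
    then have "t P \<in> Idx" by (auto simp: t_def)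
    then show ?thesis unfolding poly_space_span by (intro fn.span_base imageI)
  qed
  then show ?thesis
    unfolding hw_poly using poly_space_module by (auto simp: GL_module_iff intro!: fn.subspace_sum fn.subspace_scale)
qed

text \<open>Polar entries are linear in \<open>z\<close>, so a \<open>polar_monomial\<close> is a
  product of eight linear functionals on \<open>cubics\<close>.\<close>

lemma poly_space_hom_poly: "poly_space \<subseteq> hom_poly fscale cubics 8"
proof -
  have "polar_monomial t \<in> hom_poly fscale cubics 8" for t
  proof -
    let ?w = "\<lambda>k z. if z \<in> cubics then polar_entry z (t k) else 0"
    have "?w k \<in> dual_space fscale cubics" for k
      using fn.subspace_add[OF subspace_cubics] fn.subspace_scale[OF subspace_cubics]
      by (auto simp: dual_space_def polar_entry_def pol_add pol_scale split: prod.splits)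
    moreover have "polar_monomial t = form_prod cubics 8 ?w"
      by (auto simp: fun_eq_iff polar_monomial_def form_prod_def intro!: prod.cong)
    ultimately show ?thesis unfolding hom_poly_def[of fscale] by (intro fn.span_base) blast
  qed
  then show ?thesis
    unfolding poly_space_span by (intro fn.span_minimal subspace_hom_poly) auto
qed

text \<open>Only the first six basis vectors enter \<open>hw_poly\<close>; when \<open>g\<close>
  maps their span to itself, it acts through a \<open>6 \<times> 6\<close> matrix.\<close>

lemma hw_poly_pull:
  assumes g: "g \<in> GL s" and M: "\<And>i. i < 6 \<Longrightarrow> g (bs ! i) = (\<Sum>p<6. s (M p i) (bs ! p))" and z: "z \<in> cubics"
  shows "plethysm_act g hw_poly z = Psixi (unit_row 4) (unit_row 5) (pull M (\<lambda>i j k. polar_entry z (i, j, k)))"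
proof -
  have "polar_entry (z \<circ> g) (i, j, k) = pull M (\<lambda>i j k. polar_entry z (i, j, k)) i j k" if "i < 6" "j < 6" "k < 6" for i j k
  proof -
    have "polar_entry (z \<circ> g) (i, j, k) = pol z (\<Sum>p<6. s (M p i) (bs ! p)) (\<Sum>p<6. s (M p j) (bs ! p)) (\<Sum>p<6. s (M p k) (bs ! p))"
      using that by (simp add: polar_entry_def pol_comp[OF GLD(1)[OF g]] M)
    then show ?thesis by (simp add: pol_sum3[OF z] pull_def polar_entry_def)
  qed
  then have "Psixi (unit_row 4) (unit_row 5) (\<lambda>i j k. polar_entry (z \<circ> g) (i, j, k)) =
      Psixi (unit_row 4) (unit_row 5) (pull M (\<lambda>i j k. polar_entry z (i, j, k)))"
    by (intro Psixi_cong) auto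
  then show ?thesis
    using z cubics_comp_GL_iff[OF g] by (simp add: plethysm_act_def hw_poly_def)
qed

lemma plethysm_act_hw_polyI:
  assumes "g \<in> GL s" "\<And>z. z \<in> cubics \<Longrightarrow> plethysm_act g hw_poly z = c * hw_poly z"
  shows "plethysm_act g hw_poly = fscale c hw_poly"
proof
  fix z
  show "plethysm_act g hw_poly z = fscale c hw_poly z"
    using assms cubics_comp_GL_iff[OF assms(1)] by (cases "z \<in> cubics") (simp_all add: plethysm_act_def hw_poly_def)
qed

lemma hw_poly_torus:
  assumes g: "g \<in> GL s" and a: "\<And>i. i < n \<Longrightarrow> g (bs ! i) = s (a i) (bs ! i)"
  shows "plethysm_act g hw_poly = fscale (\<Prod>i<n. a i ^ part [5,5,5,5,3,1] i) hw_poly"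
proof -
  interpret g: Vector_Spaces.linear s s g using GLD(1)[OF g] .
  \<comment> \<open>Bijectivity of \<open>g\<close> excludes zeros; \<open>Psixi_torus\<close>
    divides by powers of \<open>a 4\<close> and \<open>a 5\<close>.\<close>
  have "a i \<noteq> 0" if "i < n" for i
  proof
    assume "a i = 0"
    then have "g (bs ! i) = g 0" using a[OF that] by (simp add: g.zero)
    then have "bs ! i = 0" using GLD(2)[OF g] by (metis bij_is_inj injD)
    then show False using that dependent_zero[of "set bs"] basis_simps(2) by (metis nth_mem)
  qed
  then have nz: "a 4 \<noteq> 0" "a 5 \<noteq> 0" using dim6 by auto
  \<comment> \<open>\<open>part\<close> is 0 from index 6 on, so the further torus coordinates drop
    out.\<close>
  have "(\<Prod>i<n. a i ^ part [5,5,5,5,3,1] i) = (\<Prod>i<6. a i ^ part [5,5,5,5,3,1] i)"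
    using dim6 by (intro prod.mono_neutral_right) (auto simp: Defs.part_def)
  also have "\<dots> = a 0 ^ 5 * a 1 ^ 5 * a 2 ^ 5 * a 3 ^ 5 * a 4 ^ 3 * a 5"
    by (simp add: Defs.part_def lessThan_nat_numeral lessThan_Suc numeral_eq_Suc)
  finally have char: "(\<Prod>i<n. a i ^ part [5,5,5,5,3,1] i) = a 0 ^ 5 * a 1 ^ 5 * a 2 ^ 5 * a 3 ^ 5 * a 4 ^ 3 * a 5" .
  have M: "g (bs ! i) = (\<Sum>p<6. s ((\<lambda>p i. if p = i then a i else 0) p i) (bs ! p))" if "i < 6" for i
    using that dim6 by (simp add: a if_distrib[of "\<lambda>c. s c _"] cong: if_cong)
  show ?thesis
    unfolding char
    by (rule plethysm_act_hw_polyI[OF g]) (simp only: hw_poly_pull[OF g M] Psixi_torus[OF nz], simp add: hw_poly_def)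
qed

text \<open>The matrix of \<open>g\<close> is upper unitriangular, so the first six basis vectors
  span a stable subspace and \<open>Psixi_unipotent\<close> applies.\<close>

lemma hw_poly_unipotent:
  assumes g: "g \<in> GL s" and u: "\<And>i. i < n \<Longrightarrow> g (bs ! i) - bs ! i \<in> span (set (take i bs))"
  shows "plethysm_act g hw_poly = hw_poly"
proof -
  have zero: "coord p v = 0" if "v \<in> span (set (take i bs))" "i \<le> p" "p < n" for i p v
    using that(1)
  proof (induction rule: span_induct_alt)
    case base
    show ?case using coord_scale[of p 0 0] by simp
  next
    case (step c x y)
    then obtain j where "j < i" "j < n" "x = bs ! j" by (auto simp: in_set_conv_nth)
    then show ?case using step that by (simp add: coord_add coord_scale coord_basis)
  qed
  have matrix: "matrix g p i = (if p = i then 1 else 0)" if "i \<le> p" "p < n" for i p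
  proof -
    have "coord p (g (bs ! i)) = coord p (g (bs ! i) - bs ! i) + coord p (bs ! i)"
      by (simp flip: coord_add)
    then show ?thesis
      using that zero[OF u, of i p] by (simp add: matrix_def coord_basis)
  qed
  have M: "g (bs ! i) = (\<Sum>p<6. s (matrix g p i) (bs ! p))" if "i < 6" for i
  proof -
    have "(\<Sum>p<n. s (matrix g p i) (bs ! p)) = (\<Sum>p<6. s (matrix g p i) (bs ! p))"
      using dim6 that by (intro sum.mono_neutral_right) (auto simp: matrix)
    then show ?thesis by (simp only: linear_basis[of g i])
  qed
  have "Psixi (unit_row 4) (unit_row 5) (pull (matrix g) Z) = Psixi (unit_row 4) (unit_row 5) Z" for Z
    using dim6 by (intro Psixi_unipotent) (auto simp: matrix)
  then have "plethysm_act g hw_poly = fscale 1 hw_poly"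
    by (intro plethysm_act_hw_polyI[OF g]) (simp add: hw_poly_pull[OF g M] hw_poly_def)
  then show ?thesis by simp
qed

lemma hw_poly_nonzero: "hw_poly \<noteq> 0"
proof -
  define m where "m p q r = form_prod UNIV 3 (\<lambda>i. coord ([p, q, r] ! i))" for p q r
  \<comment> \<open>A square in a monomial doubles its polar entries; the factors 1/2 bring them
    back to 1.\<close>
  define z where "z = m 1 2 4 + m 0 3 5 + fscale (1/2) (m 2 3 3) + fscale (1/2) (m 0 0 1)"
  have dual: "\<forall>i<3. coord ([p, q, r] ! i) \<in> dual_space s UNIV" for p q r
    by (simp add: coord_dual)
  have z: "z \<in> cubics"
    unfolding z_def m_def
    by (intro fn.subspace_add fn.subspace_scale subspace_cubics form_prod_cubic dual)
  let ?d = "\<lambda>x y :: nat. if x = y then 1 else 0 :: complex"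
  have m: "polar_entry (m p q r) (i, j, k) =
      ?d p i * ?d q j * ?d r k + ?d p i * ?d r j * ?d q k + ?d q i * ?d p j * ?d r k +
      ?d q i * ?d r j * ?d p k + ?d r i * ?d p j * ?d q k + ?d r i * ?d q j * ?d p k"
    if "i < 6" "j < 6" "k < 6" "p < 6" "q < 6" "r < 6" for i j k p q r
    using that dim6 by (simp only: m_def polar_entry_def prod.case pol_form_prod[OF dual] nth_Cons_0 nth_Cons_numeral) (simp add: coord_basis)
  have "polar_entry z t = (if t \<in> set witness_entries then 1 else 0)" if t: "t \<in> triples6" for t
  proof -
    let ?A = "{(1,2,4),(1,4,2),(2,1,4),(2,4,1),(4,1,2),(4,2,1)} :: (nat \<times> nat \<times> nat) set"
    let ?B = "{(0,3,5),(0,5,3),(3,0,5),(3,5,0),(5,0,3),(5,3,0)} :: (nat \<times> nat \<times> nat) set"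
    let ?C = "{(2,3,3),(3,2,3),(3,3,2)} :: (nat \<times> nat \<times> nat) set"
    let ?D = "{(0,0,1),(0,1,0),(1,0,0)} :: (nat \<times> nat \<times> nat) set"
    obtain i j k where ijk: "t = (i, j, k)" "i < 6" "j < 6" "k < 6" using t by auto
    have parts: "polar_entry (m 1 2 4) t = (if t \<in> ?A then 1 else 0)" "polar_entry (m 0 3 5) t = (if t \<in> ?B then 1 else 0)"
      "polar_entry (m 2 3 3) t = (if t \<in> ?C then 2 else 0)" "polar_entry (m 0 0 1) t = (if t \<in> ?D then 2 else 0)"
      unfolding ijk(1) by (subst m; use ijk in auto)+
    have "polar_entry z t = polar_entry (m 1 2 4) t + polar_entry (m 0 3 5) t + (1/2) * polar_entry (m 2 3 3) t + (1/2) * polar_entry (m 0 0 1) t"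
      by (simp only: ijk(1) z_def polar_entry_def prod.case pol_add pol_scale)
    moreover have half: "(1/2) * (if Q then 2 else 0) = (if Q then 1 else 0 :: complex)" for Q
      by simp
    moreover have "set witness_entries = ?A \<union> ?B \<union> ?C \<union> ?D" by (auto simp: witness_entries_def)
    moreover have "(if t \<in> ?A then 1 else 0) + (if t \<in> ?B then 1 else 0) + (if t \<in> ?C then 1 else 0) + (if t \<in> ?D then 1 else 0) =
        (if t \<in> ?A \<union> ?B \<union> ?C \<union> ?D then 1 else 0 :: complex)"
      by (rule indicator_disjoint_union) simp_all
    ultimately show ?thesis unfolding parts half by (simp only:)
  qed
  then have "hw_poly z = Psixi (unit_row 4) (unit_row 5) (\<lambda>i j k. if (i, j, k) \<in> set witness_entries then 1 else 0)"
    unfolding hw_poly_def using z by (simp cong: if_cong) (intro Psixi_cong; simp)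
  then have "hw_poly z = 3360" by (simp only: Psixi_nonzero)
  then show ?thesis by auto
qed

text \<open>With the six linear forms as rows of \<open>Y\<close>, the polar entries are the
  pullback of the indicator of \<open>block_triples\<close>. The forms may be dependent, since
  \<open>Y\<close> is arbitrary in \<open>Psixi_pull_two_triples\<close>.\<close>

lemma hw_poly_two_products:
  assumes l: "\<forall>i<3. l i \<in> dual_space s UNIV" and m: "\<forall>i<3. m i \<in> dual_space s UNIV"
  shows "hw_poly (form_prod UNIV 3 l + form_prod UNIV 3 m) = 0"
proof -
  let ?z = "form_prod UNIV 3 l + form_prod UNIV 3 m"
  let ?U = "\<lambda>i j k. if (i, j, k) \<in> block_triples then 1 else 0 :: complex"
  define Y where "Y r j = (if r < 3 then l r else m (r - 3)) (bs ! j)" for r j :: nat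
  have z: "?z \<in> cubics"
    by (intro fn.subspace_add subspace_cubics form_prod_cubic l m)
  have "polar_entry ?z (i, j, k) = pull Y ?U i j k" for i j k
  proof -
    have block6: "block_triples \<subseteq> triples6" by (auto simp: block_triples_def)
    have "pull Y ?U i j k = (\<Sum>(p, q, r)\<in>block_triples. Y p i * Y q j * Y r k)"
      unfolding pull_def by (rule sum.mono_neutral_cong_right) (use block6 in auto)
    also have "\<dots> = polar_entry ?z (i, j, k)"
      by (simp add: block_triples_def polar_entry_def pol_add pol_form_prod[OF l] pol_form_prod[OF m] Y_def)
    finally show ?thesis by simp
  qed
  then have "(\<lambda>i j k. polar_entry ?z (i, j, k)) = pull Y ?U" by (intro ext)
  then show ?thesis
    using z by (simp only: hw_poly_def if_True Psixi_pull_two_triples)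
qed

section \<open>From sums of two products to the secant variety\<close>

definition vanishing_submodule :: "(('a \<Rightarrow> complex) \<Rightarrow> complex) set" where
  "vanishing_submodule = {G \<in> poly_space. \<forall>l m. (\<forall>i<3. l i \<in> dual_space s UNIV) \<longrightarrow> (\<forall>i<3. m i \<in> dual_space s UNIV) \<longrightarrow>
     G (form_prod UNIV 3 l + form_prod UNIV 3 m) = 0}"

text \<open>Substituting \<open>g\<close> turns a product of linear forms into such a
  product.\<close>

lemma vanishing_submodule_module: "is_submodule vanishing_submodule"
proof -
  have "plethysm_act g G \<in> vanishing_submodule" if g: "g \<in> GL s" and G: "G \<in> vanishing_submodule" for g G
  proof -
    interpret g: Vector_Spaces.linear s s g using GLD(1)[OF g] .
    have "plethysm_act g G (form_prod UNIV 3 l + form_prod UNIV 3 m) = 0"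
      if l: "\<forall>i<3. l i \<in> dual_space s UNIV" and m: "\<forall>i<3. m i \<in> dual_space s UNIV" for l m
    proof -
      have "(form_prod UNIV 3 l + form_prod UNIV 3 m) \<circ> g = form_prod UNIV 3 (\<lambda>i. l i \<circ> g) + form_prod UNIV 3 (\<lambda>i. m i \<circ> g)"
        by (simp add: fun_eq_iff form_prod_def)
      moreover have "\<forall>i<3. (f i \<circ> g) \<in> dual_space s UNIV" if "\<forall>i<3. f i \<in> dual_space s UNIV"
        for f :: "nat \<Rightarrow> 'a \<Rightarrow> complex"
        using that by (simp add: dual_space_def g.add g.scale)
      ultimately show ?thesis
        using G l m unfolding vanishing_submodule_def plethysm_act_def by simp
    qed
    then show ?thesis using G g poly_space_module by (simp add: vanishing_submodule_def GL_module_iff)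
  qed
  moreover have "fn.subspace poly_space" using poly_space_module by (simp add: GL_module_iff)
  then have "fn.subspace vanishing_submodule"
    unfolding vanishing_submodule_def fn.subspace_def by auto
  ultimately show ?thesis by (simp add: GL_module_iff)
qed

text \<open>Points spanned by two points of the Chow variety are combinations of two products of
  linear forms. Vanishing there passes to the Zariski closure because \<open>G\<close> is
  homogeneous.\<close>

lemma vanishing_submodule_ideal: "vanishing_submodule \<subseteq> ideal_part fscale cubics 8 (secant_variety fscale cubics 2 (chow_dual s 3))"
proof
  fix G assume G: "G \<in> vanishing_submodule"
  have hom: "G \<in> hom_poly fscale cubics 8" using G poly_space_hom_poly by (auto simp: vanishing_submodule_def)
  let ?S = "\<Union>ps\<in>{ps. length ps = 2 \<and> set ps \<subseteq> chow_dual s 3}. proj_span fscale (set ps)"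
  have "vanishes_on G ?S"
    unfolding vanishes_on_def
  proof (intro ballI)
    fix p z' assume "p \<in> ?S" and z': "z' \<in> p"
    then obtain ps where ps: "length ps = 2" "set ps \<subseteq> chow_dual s 3" "p \<in> proj_span fscale (set ps)" by blast
    from ps(1) obtain p1 p2 where p12: "ps = [p1, p2]" by (auto simp: length_Suc_conv numeral_2_eq_2)
    obtain l where l: "\<forall>i<3. l i \<in> dual_space s UNIV" "p1 = fn.span {form_prod UNIV 3 l}"
      using ps(2) p12 unfolding chow_dual_def proj_def by auto
    obtain m where m: "\<forall>i<3. m i \<in> dual_space s UNIV" "p2 = fn.span {form_prod UNIV 3 m}"
      using ps(2) p12 unfolding chow_dual_def proj_def by auto
    obtain z where z: "z \<in> fn.span (p1 \<union> p2)" "p = fn.span {z}"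
      using ps(3) p12 unfolding proj_span_def proj_def by auto
    let ?L = "form_prod UNIV 3 l" and ?M = "form_prod UNIV 3 m"
    have "p1 \<union> p2 \<subseteq> fn.span {?L, ?M}"
      unfolding l(2) m(2) using fn.span_mono[of "{?L}" "{?L, ?M}"] fn.span_mono[of "{?M}" "{?L, ?M}"] by auto
    from fn.span_minimal[OF this fn.subspace_span] have "z \<in> fn.span {?L, ?M}"
      using z(1) by blast
    then have "fn.span {z} \<subseteq> fn.span {?L, ?M}"
      by (intro fn.span_minimal fn.subspace_span) simp
    then have "z' \<in> fn.span {?L, ?M}" using z' z(2) by blast
    then obtain c where "z' - fscale c ?L \<in> fn.span {?M}"
      using fn.span_breakdown_eq by blast
    then obtain d where "z' - fscale c ?L - fscale d ?M \<in> fn.span {}"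
      using fn.span_breakdown_eq by blast
    then have "z' - fscale c ?L - fscale d ?M = 0"
      unfolding fn.span_empty by (rule singletonD)
    then have z'eq: "z' = fscale c ?L + fscale d ?M"
      unfolding diff_diff_add by (rule eq_iff_diff_eq_0[THEN iffD2])
    \<comment> \<open>Coefficients, zero included, are absorbed into the first linear form, so plain
      sums of two products suffice.\<close>
    have scale: "fscale c (form_prod UNIV 3 l) = form_prod UNIV 3 (l(0 := fscale c (l 0)))" for c and l :: "nat \<Rightarrow> 'a \<Rightarrow> complex"
      by (simp add: fun_eq_iff form_prod_def numeral_3_eq_3 lessThan_Suc)
    have dual: "\<forall>i<3. (l(0 := fscale c (l 0))) i \<in> dual_space s UNIV" if "\<forall>i<3. l i \<in> dual_space s UNIV" for c and l :: "nat \<Rightarrow> 'a \<Rightarrow> complex"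
      using that by (auto simp: dual_space_def algebra_simps)
    show "G z' = 0"
      using G dual[OF l(1), of c] dual[OF m(1), of d] unfolding z'eq scale vanishing_submodule_def by blast
  qed
  then have "vanishes_on G (secant_variety fscale cubics 2 (chow_dual s 3))"
    using hom unfolding secant_variety_def zariski_closure_def vanishes_on_def by blast
  then show "G \<in> ideal_part fscale cubics 8 (secant_variety fscale cubics 2 (chow_dual s 3))"
    using hom by (simp add: ideal_part_def)
qed

end

section \<open>The Schur module\<close>

text \<open>\<open>f\<close> is linear on the span only, as is a member of
  \<open>dual_space\<close>, which is 0 outside its carrier.\<close>

lemma (in vector_space_pair) functional_agree:
  assumes "\<And>x. x \<in> B \<Longrightarrow> f x = g x" "x \<in> vs1.span B"
    and "\<And>x y. x \<in> vs1.span B \<Longrightarrow> y \<in> vs1.span B \<Longrightarrow> f (x + y) = f x + f y"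
    "\<And>c x. x \<in> vs1.span B \<Longrightarrow> f (s1 c x) = s2 c (f x)" "Vector_Spaces.linear s1 s2 g"
  shows "f x = g x"
proof -
  interpret g: Vector_Spaces.linear s1 s2 g by fact
  have "x \<in> vs1.span B \<and> f x = g x"
    using assms(2)
  proof (induction rule: vs1.span_induct_alt)
    case base
    have "f 0 = 0" using assms(4)[OF vs1.span_zero, of 0] by simp
    then show ?case by (simp add: vs1.span_zero g.zero)
  next
    case (step c x y)
    have x: "x \<in> vs1.span B" using step(1) by (rule vs1.span_base)
    then have "f (s1 c x + y) = s2 c (f x) + f y"
      using step by (simp add: assms(3,4) vs1.span_scale)
    then show ?case using step x assms(1)[OF step(1)]
      by (simp add: vs1.span_add vs1.span_scale g.add g.scale)
  qed
  then show ?thesis by simp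
qed

context big_based_space
begin

text \<open>A functional that is 0 outside a submodule is in general not linear on the whole type.
  Its extension \<open>h\<close> can be applied to polar monomials that lie outside the
  submodule.\<close>

lemma linear_extension:
  assumes "\<psi> \<in> dual_space fscale (fn.span B)" "fn.independent (B :: ('b \<Rightarrow> complex) set)"
  obtains h where "Vector_Spaces.linear fscale (*) h" "\<And>x. x \<in> fn.span B \<Longrightarrow> \<psi> x = h x"
proof -
  interpret c: vector_space "(*) :: complex \<Rightarrow> complex \<Rightarrow> complex"
    by unfold_locales (simp_all add: algebra_simps)
  interpret pr: vector_space_pair "fscale :: complex \<Rightarrow> ('b \<Rightarrow> complex) \<Rightarrow> 'b \<Rightarrow> complex" "(*) :: complex \<Rightarrow> complex \<Rightarrow> complex" ..
  obtain h where h: "Vector_Spaces.linear fscale (*) h" "\<forall>x\<in>B. h x = \<psi> x"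
    using pr.linear_independent_extend[OF assms(2), of \<psi>] by blast
  have \<psi>: "\<And>x y. x \<in> fn.span B \<Longrightarrow> y \<in> fn.span B \<Longrightarrow> \<psi> (x + y) = \<psi> x + \<psi> y"
    "\<And>c x. x \<in> fn.span B \<Longrightarrow> \<psi> (fscale c x) = c * \<psi> x"
    using assms(1) unfolding dual_space_def by blast+
  show ?thesis
  proof (rule that[OF h(1)])
    fix x assume x: "x \<in> fn.span B"
    have "\<psi> x = h x" if "x \<in> B" for x using h(2) that by simp
    then show "\<psi> x = h x"
      using x \<psi> h(1) by (rule pr.functional_agree)
  qed
qed

section \<open>Matrix coefficients as polynomials in the group element\<close>

definition entry :: "nat \<Rightarrow> nat \<Rightarrow> ('a \<Rightarrow> 'a) \<Rightarrow> complex" where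
  "entry i j g = (if g \<in> End s then matrix g i j else 0)"

lemma entry_dual: "entry i j \<in> dual_space (fun_scale s) (End s)"
proof -
  have "f + g \<in> End s" if "f \<in> End s" "g \<in> End s" for f g
  proof -
    interpret f: Vector_Spaces.linear s s f using that(1) by (simp add: End_def)
    interpret g: Vector_Spaces.linear s s g using that(2) by (simp add: End_def)
    show ?thesis unfolding End_def
      by (intro CollectI, unfold_locales) (simp_all add: f.add g.add f.scale g.scale scale_right_distrib ac_simps)
  qed
  moreover have "fun_scale s c f \<in> End s" if "f \<in> End s" for c f
  proof -
    interpret f: Vector_Spaces.linear s s f using that by (simp add: End_def)
    show ?thesis unfolding End_def
      by (intro CollectI, unfold_locales) (simp_all add: fun_scale_def f.add f.scale scale_right_distrib mult.commute)
  qed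
  ultimately show ?thesis
    by (auto simp: dual_space_def entry_def matrix_def coord_add coord_scale fun_scale_def)
qed

text \<open>24 is 8 times 3: factor \<open>i\<close> belongs to argument \<open>i mod 3\<close> at
  label \<open>i div 3\<close>.\<close>

definition kernel_poly :: "(nat \<Rightarrow> nat \<times> nat \<times> nat) \<Rightarrow> (nat \<Rightarrow> nat \<times> nat \<times> nat) \<Rightarrow> ('a \<Rightarrow> 'a) \<Rightarrow> complex" where
  "kernel_poly t u = form_prod (End s) 24
    (\<lambda>i. entry (idx (t (i div 3)) (i mod 3)) (idx (u (i div 3)) (i mod 3)))"

lemma kernel_poly_hom_poly: "kernel_poly t u \<in> hom_poly (fun_scale s) (End s) 24"
  unfolding hom_poly_def kernel_poly_def using entry_dual by (intro fn.span_base) blast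

lemma kernel_poly_eq:
  assumes "g \<in> GL s"
  shows "(\<Prod>k<8. kernel g (t k) (u k)) = kernel_poly t u g"
proof -
  let ?w = "\<lambda>i. entry (idx (t (i div 3)) (i mod 3)) (idx (u (i div 3)) (i mod 3))"
  have g: "g \<in> End s" using assms by (simp add: GL_def)
  have "kernel g (t k) (u k) = (\<Prod>i\<in>{k * 3..<k * 3 + 3}. ?w i g)" for k
  proof -
    have "{k * 3..<k * 3 + 3} = {k * 3, k * 3 + 1, k * 3 + 2}" by auto
    moreover have "(k * 3 + 1) div 3 = k" "(k * 3 + 2) div 3 = k" "(k * 3 + 1) mod 3 = 1" "(k * 3 + 2) mod 3 = 2"
      by presburger+
    ultimately show ?thesis
      by (cases "t k"; cases "u k") (simp add: g entry_def kernel_def)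
  qed
  then have "(\<Prod>k<8. kernel g (t k) (u k)) = (\<Prod>k<8. \<Prod>i\<in>{k * 3..<k * 3 + 3}. ?w i g)" by simp
  also have "\<dots> = (\<Prod>i<8 * 3. ?w i g)" by (rule prod.nat_group)
  finally show ?thesis by (simp add: g form_prod_def kernel_poly_def)
qed

lemma subspace_poly_fun: "fn.subspace (poly_fun (fun_scale s) (End s))"
  unfolding poly_fun_def by (rule fn.subspace_span)

text \<open>On \<open>tensor_poly A\<close> the group acts by products of 24 matrix entries, and a
  linear functional turns these into a combination of the \<open>kernel_poly\<close>.\<close>

lemma submodule_polynomial:
  assumes N: "is_submodule N" "N \<subseteq> poly_space"
  shows "polynomial_GL_module s fscale plethysm_act N"
proof -
  have "fn.subspace N" using N(1) by (simp add: GL_module_iff)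
  then obtain B where B: "finite B" "fn.independent B" "fn.span B = N"
    using finite_spanning_set[of N "polar_monomial ` Idx"] N(2) finite_Idx unfolding poly_space_span by auto
  have "\<exists>P\<in>poly_fun (fun_scale s) (End s). \<forall>g\<in>GL s. \<psi> (plethysm_act g G) = P g"
    if \<psi>: "\<psi> \<in> dual_space fscale N" and G: "G \<in> N" for \<psi> G
  proof -
    obtain h where h: "Vector_Spaces.linear fscale (*) h" "\<And>x. x \<in> N \<Longrightarrow> \<psi> x = h x"
      using linear_extension[of \<psi> B] \<psi> B(2,3) by metis
    interpret h: Vector_Spaces.linear "fscale :: complex \<Rightarrow> (('a \<Rightarrow> complex) \<Rightarrow> complex) \<Rightarrow> _" "(*)" h by fact
    obtain A where A: "G = tensor_poly A" using G N(2) by (auto simp: poly_space_def)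
    define R where "R = (\<Sum>t\<in>Idx. \<Sum>u\<in>Idx. fscale (A u * h (polar_monomial t)) (kernel_poly t u))"
    have "kernel_poly t u \<in> poly_fun (fun_scale s) (End s)" for t u
      unfolding poly_fun_def using kernel_poly_hom_poly by (intro fn.span_base) blast
    then have "R \<in> poly_fun (fun_scale s) (End s)"
      unfolding R_def by (intro fn.subspace_sum fn.subspace_scale subspace_poly_fun)
    moreover have "\<psi> (plethysm_act g G) = R g" if g: "g \<in> GL s" for g
    proof -
      have app: "(\<Sum>t\<in>S. f t) g = (\<Sum>t\<in>S. f t g)" for S :: "(nat \<Rightarrow> nat \<times> nat \<times> nat) set" and f :: "_ \<Rightarrow> _ \<Rightarrow> complex"
        by (induction S rule: infinite_finite_induct) auto
      have "\<psi> (plethysm_act g G) = h (tensor_poly (tensor_act g A))"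
        using h(2) N(1) G g by (simp add: A tensor_poly_act GL_module_iff)
      also have "\<dots> = (\<Sum>t\<in>Idx. tensor_act g A t * h (polar_monomial t))"
        unfolding tensor_poly_monomials h.sum h.scale by (rule refl)
      also have "\<dots> = R g"
        unfolding R_def app tensor_act_def sum_distrib_right
        by (intro sum.cong refl) (simp add: kernel_poly_eq[OF g])
      finally show ?thesis .
    qed
    ultimately show ?thesis by blast
  qed
  then show ?thesis
    unfolding polynomial_GL_module_def using N(1) B(1,3) by blast
qed

section \<open>Passage to another ordered basis\<close>

lemma basis_change:
  assumes "ordered_basis s cs"
  obtains g where "g \<in> GL s" "map g bs = cs"
proof -
  interpret c: based_space s cs by unfold_locales fact
  have len: "length cs = n"
  proof -
    have "card (set cs) = card (set bs)"
      by (metis basis_simps(2,3) c.basis_simps(2,3) dim_eq_card)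
    then show ?thesis using distinct_card[of cs] distinct_card[of bs] by simp
  qed
  define g where "g v = (\<Sum>i<n. s (coord i v) (cs ! i))" for v
  define h where "h v = (\<Sum>i<n. s (c.coord i v) (bs ! i))" for v
  have lin: "Vector_Spaces.linear s s g"
    unfolding g_def by unfold_locales
      (simp_all add: coord_add coord_scale scale_left_distrib sum.distrib scale_sum_right)
  have "coord i (h v) = c.coord i v" if "i < n" for i v
    using that unfolding h_def by (rule coord_lincomb)
  then have gh: "g (h v) = v" for v
    using c.sum_coord[of v] by (simp add: g_def len)
  have "c.coord i (g v) = coord i v" if "i < n" for i v
    using c.coord_lincomb[of i "\<lambda>i. coord i v"] that by (simp add: g_def len)
  then have hg: "h (g v) = v" for v
    using sum_coord[of v] by (simp add: h_def)
  have "bij g" by (rule o_bij[of h]) (auto simp: fun_eq_iff gh hg)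
  then have "g \<in> GL s" using lin by (simp add: GL_def End_def)
  moreover have "map g bs = cs"
  proof (rule nth_equalityI)
    fix i assume "i < length (map g bs)"
    then have i: "i < n" by simp
    have "g (bs ! i) = (\<Sum>j<n. if j = i then cs ! j else 0)"
      unfolding g_def by (rule sum.cong) (use i in \<open>auto simp: coord_basis\<close>)
    then show "map g bs ! i = cs ! i" using i by simp
  qed (simp add: len)
  ultimately show ?thesis by (rule that)
qed

text \<open>Conjugation by \<open>g\<close> carries the torus and the unipotent group of
  \<open>cs\<close> to those of \<open>bs\<close>.\<close>

lemma highest_weight_vector_change:
  assumes f: "highest_weight_vector s fscale plethysm_act bs la f" and g: "g \<in> GL s" "map g bs = cs"
  shows "highest_weight_vector s fscale plethysm_act cs la (plethysm_act g f)"
proof -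
  have bij: "bij g" by (rule GLD(2)[OF g(1)])
  have inverse [simp]: "Hilbert_Choice.inv g (g x) = x" "g (Hilbert_Choice.inv g x) = x" for x
    using bij by (simp_all add: bij_is_inj bij_is_surj surj_f_inv_f)
  have ig: "Hilbert_Choice.inv g \<in> GL s" by (rule GL_inv[OF g(1)])
  interpret ig: Vector_Spaces.linear s s "Hilbert_Choice.inv g" using GLD(1)[OF ig] .
  have len: "length cs = n" and cs: "\<And>i. i < n \<Longrightarrow> cs ! i = g (bs ! i)" using g(2) by auto
  have conj: "Hilbert_Choice.inv g \<circ> h \<circ> g \<in> GL s" if "h \<in> GL s" for h
    by (intro GL_comp ig that g(1))
  have act: "plethysm_act h (plethysm_act g f) = plethysm_act g (plethysm_act (Hilbert_Choice.inv g \<circ> h \<circ> g) f)" for h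
  proof -
    have "g \<circ> (Hilbert_Choice.inv g \<circ> h \<circ> g) = h \<circ> g" by (simp add: fun_eq_iff)
    then show ?thesis by (simp only: plethysm_act_comp)
  qed
  show ?thesis
    unfolding highest_weight_vector_def
  proof (intro conjI ballI allI impI)
    show "plethysm_act g f \<noteq> 0"
    proof
      assume "plethysm_act g f = 0"
      then have "plethysm_act (Hilbert_Choice.inv g) (plethysm_act g f) = 0" by (simp add: plethysm_act_def fun_eq_iff)
      then have "plethysm_act (Hilbert_Choice.inv g \<circ> g) f = 0" by (simp only: plethysm_act_comp)
      moreover have "Hilbert_Choice.inv g \<circ> g = id" by (simp add: fun_eq_iff)
      ultimately have "f = 0" by (simp add: plethysm_act_def)
      then show False using f by (simp add: highest_weight_vector_def)
    qed
    fix h a assume h: "h \<in> GL s" "\<forall>i<length cs. h (cs ! i) = s (a i) (cs ! i)"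
    have "(Hilbert_Choice.inv g \<circ> h \<circ> g) (bs ! i) = s (a i) (bs ! i)" if "i < n" for i
      using h(2) that by (simp add: len cs ig.scale)
    then have "plethysm_act (Hilbert_Choice.inv g \<circ> h \<circ> g) f = fscale (\<Prod>i<n. a i ^ part la i) f"
      using f conj[OF h(1)] unfolding highest_weight_vector_def by blast
    then show "plethysm_act h (plethysm_act g f) = fscale (\<Prod>i<length cs. a i ^ part la i) (plethysm_act g f)"
      unfolding act len by (simp only: plethysm_act_scale)
  next
    fix h assume h: "h \<in> GL s" "\<forall>i<length cs. h (cs ! i) - cs ! i \<in> span (set (take i cs))"
    have "(Hilbert_Choice.inv g \<circ> h \<circ> g) (bs ! i) - bs ! i \<in> span (set (take i bs))" if i: "i < n" for i
    proof -
      have "Hilbert_Choice.inv g (h (cs ! i) - cs ! i) \<in> Hilbert_Choice.inv g ` span (set (take i cs))"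
        using h(2) i by (auto simp: len)
      also have "Hilbert_Choice.inv g ` span (set (take i cs)) = span (Hilbert_Choice.inv g ` set (take i cs))"
        by (rule ig.span_image[symmetric])
      also have "Hilbert_Choice.inv g ` set (take i cs) = set (take i bs)"
        unfolding g(2)[symmetric] take_map set_map image_image by simp
      finally show ?thesis using i by (simp add: cs ig.diff)
    qed
    then have "plethysm_act (Hilbert_Choice.inv g \<circ> h \<circ> g) f = f"
      using f conj[OF h(1)] unfolding highest_weight_vector_def by blast
    then show "plethysm_act h (plethysm_act g f) = plethysm_act g f"
      unfolding act by (simp only:)
  qed
qed

lemma Schur_module_exists:
  "\<exists>M. M \<subseteq> ideal_part fscale cubics 8 (secant_variety fscale cubics 2 (chow_dual s 3)) \<and>
    is_Schur_module s [5,5,5,5,3,1] fscale plethysm_act M"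
proof -
  have vanishing_submodule: "is_submodule vanishing_submodule" "vanishing_submodule \<subseteq> poly_space" by (rule vanishing_submodule_module) (auto simp: vanishing_submodule_def)
  have "hw_poly \<in> vanishing_submodule" using hw_poly_in_poly_space hw_poly_two_products by (simp add: vanishing_submodule_def)
  then obtain N f where N: "irreducible_GL_module s fscale plethysm_act N" "N \<subseteq> vanishing_submodule" and f: "projects hw_poly N f"
    using irreducible_projection[OF vanishing_submodule _ hw_poly_nonzero] by blast
  have sub: "is_submodule N" using N(1) by (simp add: irreducible_GL_module_def)
  \<comment> \<open>Torus and unipotent elements act on \<open>hw_poly\<close> by scalars, and its
    projection \<open>f\<close> inherits these equations.\<close>
  have hw: "highest_weight_vector s fscale plethysm_act bs [5,5,5,5,3,1] f"
    unfolding highest_weight_vector_def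
  proof (intro conjI ballI allI impI)
    show "f \<noteq> 0" using f by (simp add: projects_def)
    fix g a assume g: "g \<in> GL s" "\<forall>i<n. g (bs ! i) = s (a i) (bs ! i)"
    then have "plethysm_act g hw_poly = fscale (\<Prod>i<n. a i ^ part [5,5,5,5,3,1] i) hw_poly"
      by (intro hw_poly_torus) auto
    then show "plethysm_act g f = fscale (\<Prod>i<n. a i ^ part [5,5,5,5,3,1] i) f"
      by (rule projects_eigen[OF sub f g(1)])
  next
    fix g assume g: "g \<in> GL s" "\<forall>i<n. g (bs ! i) - bs ! i \<in> span (set (take i bs))"
    then have "plethysm_act g hw_poly = hw_poly" by (intro hw_poly_unipotent) auto
    then have "plethysm_act g hw_poly = fscale 1 hw_poly" by simp
    then have "plethysm_act g f = fscale 1 f" by (rule projects_eigen[OF sub f g(1)])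
    then show "plethysm_act g f = f" by simp
  qed
  \<comment> \<open>\<open>N\<close> is stable, so moving \<open>f\<close> to the basis
    \<open>cs\<close> stays inside it.\<close>
  have "\<exists>m\<in>N. highest_weight_vector s fscale plethysm_act cs [5,5,5,5,3,1] m" if "ordered_basis s cs" for cs
  proof -
    obtain g where g: "g \<in> GL s" "map g bs = cs" using basis_change[OF \<open>ordered_basis s cs\<close>] by blast
    moreover have "plethysm_act g f \<in> N"
      using f sub g(1) by (simp add: projects_def GL_module_iff)
    ultimately show ?thesis using highest_weight_vector_change[OF hw] by blast
  qed
  moreover have "dim UNIV = n"
    using dim_eq_card[of "set bs" UNIV] distinct_card[of bs] by simp
  moreover have "is_partition [5,5,5,5,3,1]" by (simp add: is_partition_def)
  moreover have "polynomial_GL_module s fscale plethysm_act N"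
    using submodule_polynomial[OF sub] N(2) vanishing_submodule(2) by blast
  ultimately have "is_Schur_module s [5,5,5,5,3,1] fscale plethysm_act N"
    using N(1) dim6 unfolding is_Schur_module_def by simp
  then show ?thesis using N(2) vanishing_submodule_ideal by blast
qed

end

theorem theorem1p3:
  fixes s :: "complex \<Rightarrow> 'v::ab_group_add \<Rightarrow> 'v" and B :: "'v set"
  assumes "finite_dimensional_vector_space s B"
    and "vector_space.dim s UNIV \<ge> 6"
  shows "\<exists>M. M \<subseteq> ideal_part (fun_scale (*)) (hom_poly s UNIV 3) 8
                 (secant_variety (fun_scale (*)) (hom_poly s UNIV 3) 2 (chow_dual s 3)) \<and>
             is_Schur_module s [5,5,5,5,3,1] (fun_scale (*)) plethysm_act M"
proof -
  interpret V: finite_dimensional_vector_space s B by fact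
  obtain bs where bs: "set bs = B" "distinct bs" using finite_distinct_list[OF V.finite_Basis] by blast
  have basis: "ordered_basis s bs"
    using bs V.independent_Basis V.span_Basis by (simp add: ordered_basis_def)
  have "6 \<le> length bs"
    using assms(2) V.dim_UNIV distinct_card[OF bs(2)] bs(1) by simp
  then interpret big_based_space s bs
    by unfold_locales (use basis in auto)
  show ?thesis by (rule Schur_module_exists)
qed

end
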